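(* Let $M,N\in\mathbb{N}$ be positive integers and let $\{\phi_1,\dots,\phi_k\}$ be a finite irreducible family of contracting similarity maps of $\mathbb{R}^{MN}$ satisfying the open set condition, with attractor $\mathcal{K}$. Identify $\mathbb{R}^{MN}$ with the space of real $M\times N$ matrices. Then $$\dim(\mathbf{BA}(M,N)\cap\mathcal{K})=\dim\mathcal{K},$$ where $\dim$ denotes Hausdorff dimension.
   Context: **Badly approximable matrices.** For $t\in\mathbb{R}$ let $\langle t\rangle$ be the distance from $t$ to the nearest integer, and for $U=(u_1,\dots,u_D)\in\mathbb{R}^D$ put $\operatorname{dist}(U,\mathbb{Z}^D)=\max_i\langle u_i\rangle$. A real $M\times N$ matrix $A$ is badly approximable if there is a constant $C=C(A)>0$ such that $\operatorname{dist}(A\mathbf{x},\mathbb{Z}^M)>C\|\mathbf{x}\|_\infty^{-N/M}$ for every $0\neq\mathbf{x}\in\mathbb{Z}^N$. $\mathbf{BA}(M,N)$ is the set of all badly approximable $M\times N$ matrices. **Self-similar sets.** A map $\phi:\mathbb{R}^n\to\mathbb{R}^n$ is a similarity if $\phi(\mathbf{x})=\rho\,\Theta(\mathbf{x})+\mathbf{y}$ with $\rho>0$, $\Theta\in O(n,\mathbb{R})$, $\mathbf{y}\in\mathbb{R}^n$; it is contracting if $\rho<1$. The attractor of a finite family $\phi_1,\dots,\phi_k$ of contracting similarities is the unique nonempty compact set $\mathcal{K}$ with $\mathcal{K}=\bigcup_{i=1}^k\phi_i(\mathcal{K})$. The family satisfies the open set condition if there is a (nonempty) open set $U\subset\mathbb{R}^n$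 with $\phi_i(U)\subset U$ for all $i$ and $\phi_i(U)\cap\phi_j(U)=\varnothing$ for $i\ne j$. The family is irreducible if there is no (nonempty) finite collection of proper affine subspaces of $\mathbb{R}^n$ that is invariant under each $\phi_i$. *)

theory Defs
  imports "HOL-Analysis.Analysis"
begin

section \<open>Hausdorff dimension\<close>

text \<open>
  The \<open>s\<close>-th power of the diameter, with the usual conventions at \<open>s = 0\<close>: the empty set
  contributes 0 and every nonempty set contributes 1 (note that \<open>0 powr 0 = 0\<close>).
\<close>
definition diam_powr :: "real \<Rightarrow> 'a::metric_space set \<Rightarrow> real" where
  "diam_powr s U = (if U = {} then 0 else if s = 0 then 1 else diameter U powr s)"

text \<open>
  Covers are by sequences of sets; finite covers are included because the sets may be empty.
  Boundedness is required explicitly since \<^const>\<open>diameter\<close> is meaningless on unbounded sets.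
\<close>
definition hausdorff_premeasure :: "real \<Rightarrow> real \<Rightarrow> 'a::metric_space set \<Rightarrow> ennreal" where
  "hausdorff_premeasure s \<delta> A =
     (INF U \<in> {U :: nat \<Rightarrow> 'a set.
                 A \<subseteq> (\<Union>i. U i) \<and> (\<forall>i. bounded (U i) \<and> diameter (U i) \<le> \<delta>)}.
        \<Sum>i. ennreal (diam_powr s (U i)))"

definition hausdorff_measure :: "real \<Rightarrow> 'a::metric_space set \<Rightarrow> ennreal" where
  "hausdorff_measure s A = (SUP \<delta> \<in> {0<..}. hausdorff_premeasure s \<delta> A)"

definition hausdorff_dim :: "'a::metric_space set \<Rightarrow> ennreal" where
  "hausdorff_dim A = (INF s \<in> {s. 0 \<le> s \<and> hausdorff_measure s A = 0}. ennreal s)"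

section \<open>Badly approximable matrices\<close>

definition dist_nearest_int :: "real \<Rightarrow> real" where
  "dist_nearest_int t = \<bar>t - of_int (round t)\<bar>"

definition dist_int_lattice :: "real ^ 'd \<Rightarrow> real" where
  "dist_int_lattice u = (MAX i. dist_nearest_int (u $ i))"

text \<open>
  A matrix with \<open>M = CARD('m)\<close> rows and \<open>N = CARD('n)\<close> columns has type
  \<open>real ^ 'n ^ 'm\<close>. As a Euclidean space this type is the space of all \<open>M * N\<close> entries: its
  inner product is the sum of the entrywise products and its norm is the Frobenius norm.
\<close>
definition badly_approximable :: "real ^ 'n ^ 'm \<Rightarrow> bool" where
  "badly_approximable A \<longleftrightarrow>
     (\<exists>C>0. \<forall>x :: int ^ 'n. x \<noteq> 0 \<longrightarrow>
        dist_int_lattice (A *v (\<chi> j. real_of_int (x $ j)))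
          > C * infnorm ((\<chi> j. real_of_int (x $ j)) :: real ^ 'n)
                  powr (- (real CARD('n) / real CARD('m))))"

definition BA :: "(real ^ 'n ^ 'm) set" where
  "BA = {A. badly_approximable A}"

section \<open>Self-similar sets\<close>

definition similarity_with_ratio :: "real \<Rightarrow> ('a::euclidean_space \<Rightarrow> 'a) \<Rightarrow> bool" where
  "similarity_with_ratio \<rho> f \<longleftrightarrow>
     0 < \<rho> \<and> (\<exists>\<Theta> y. orthogonal_transformation \<Theta> \<and> (\<forall>x. f x = \<rho> *\<^sub>R \<Theta> x + y))"

definition contracting_similarity :: "('a::euclidean_space \<Rightarrow> 'a) \<Rightarrow> bool" where
  "contracting_similarity f \<longleftrightarrow> (\<exists>\<rho><1. similarity_with_ratio \<rho> f)"

text \<open>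
  Families are indexed, so that the disjointness in the open set condition is over
  different indices rather than over different maps. For a finite nonempty family of contracting
  similarities, exactly one set satisfies \<open>is_attractor\<close>.
\<close>
definition is_attractor :: "'i set \<Rightarrow> ('i \<Rightarrow> 'a::euclidean_space \<Rightarrow> 'a) \<Rightarrow> 'a set \<Rightarrow> bool" where
  "is_attractor I \<phi> K \<longleftrightarrow> K \<noteq> {} \<and> compact K \<and> K = (\<Union>i\<in>I. \<phi> i ` K)"

definition open_set_condition :: "'i set \<Rightarrow> ('i \<Rightarrow> 'a::euclidean_space \<Rightarrow> 'a) \<Rightarrow> bool" where
  "open_set_condition I \<phi> \<longleftrightarrow>
     (\<exists>U. open U \<and> U \<noteq> {} \<and> (\<forall>i\<in>I. \<phi> i ` U \<subseteq> U) \<and>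
          (\<forall>i\<in>I. \<forall>j\<in>I. i \<noteq> j \<longrightarrow> \<phi> i ` U \<inter> \<phi> j ` U = {}))"

text \<open>
  Affine subspaces are nonempty, whereas \<^const>\<open>affine\<close> holds of the empty set; single points are
  affine subspaces. Invariance means that each map sends members of the collection to members
  of the collection. For families of similarities, requiring only that the union of the
  collection be mapped into itself gives the same notion of irreducibility (pass to the members
  of maximal dimension).
\<close>
definition irreducible_family :: "'i set \<Rightarrow> ('i \<Rightarrow> 'a::euclidean_space \<Rightarrow> 'a) \<Rightarrow> bool" where
  "irreducible_family I \<phi> \<longleftrightarrow>
     \<not> (\<exists>\<L>. finite \<L> \<and> \<L> \<noteq> {} \<and>
            (\<forall>L\<in>\<L>. affine L \<and> L \<noteq> {} \<and> L \<noteq> UNIV) \<and>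
            (\<forall>i\<in>I. \<forall>L\<in>\<L>. \<phi> i ` L \<in> \<L>))"

end

theory Submission
  imports Defs
begin

text \<open>
  By the Dani correspondence, a matrix \<open>A\<close> is badly approximable as soon as the lattices obtained from
  the integer lattice by the shear \<open>(x, y) \<mapsto> (x + A y, y)\<close> followed by the flow
  \<open>diag(X\<^sup>n, Y\<^sup>n)\<close>, with \<open>X\<^sup>M Y\<^sup>N = 1\<close> and \<open>X > 1\<close>, have no short vectors. So one builds a Cantor set inside
  \<open>K\<close>, keeping at each stage only those subcylinders for which all covolumes of rational
  subspaces stay above a fixed log-convex profile of the rank. By submodularity of
  covolumes, for each rank at most one rational subspace is in danger of dropping below the profile at
  the next stage; and since \<open>K\<close> is not contained in a hyperplane, the flow expands that one subspace
  on all but a small proportion of the subcylinders. If the stages are long, keeping half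
  of the subcylinders each time loses an arbitrarily small amount of dimension. Different contraction
  ratios are dealt with beforehand by passing to a subfamily of iterates that all have the
  same ratio and almost the same similarity dimension.
\<close>

section \<open>Hausdorff dimension of tree-like sets\<close>

text \<open>Degeneracy of \<open>shear b\<close> on a j-dimensional subspace is a condition on
  minors of size j, while non-planarity of \<open>K\<close> controls affine functions;
  \<open>shear_fraction\<close> therefore inducts on the dimension and meets one affine function per
  dimension on a small cylinder. Subspaces of dimension at most M suffice: a rational subspace of
  rank i with M \<le> i < d = M + N has at least one contracted direction fewer than the whole
  space, so once an M-dimensional part of it is robustly expanded, \<open>X^M * Y^(i - M)\<close> is
  at least \<open>1 / Y\<close> and absorbs all constants. Equal ratios keep flow and cylinders
  synchronous: a stage-n cylinder has size of order \<open>(Y / X)^n\<close>, which n steps of the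
  flow magnify to order one. The rotation in the cylinder map and the subspace in danger change from
  node to node, so the estimates are uniform over all orthogonal \<Theta> and all subspaces of given
  dimension. Full rank cannot gain from expansion; its bound is recomputed from the integer lattice
  at every stage, so that no constants accumulate.\<close>

lemma diam_powr_nonneg: "0 \<le> diam_powr s U"
  by (simp add: diam_powr_def)

lemma hausdorff_dim_mono:
  assumes "A \<subseteq> B" shows "hausdorff_dim A \<le> hausdorff_dim B"
proof -
  have "hausdorff_premeasure s \<delta> A \<le> hausdorff_premeasure s \<delta> B" for s \<delta>
    unfolding hausdorff_premeasure_def using assms by (intro INF_superset_mono) auto
  then have "hausdorff_measure s A \<le> hausdorff_measure s B" for s
    unfolding hausdorff_measure_def by (intro SUP_mono) auto
  then show ?thesis unfolding hausdorff_dim_def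
    by (intro INF_superset_mono) (auto, metis le_zero_eq)
qed

lemma hausdorff_measure_eq_0I:
  fixes A :: "'a::metric_space set"
  assumes "\<And>\<delta> e. \<delta> > 0 \<Longrightarrow> e > 0 \<Longrightarrow> \<exists>(I :: 'i set) V. finite I \<and> A \<subseteq> (\<Union>i\<in>I. V i) \<and>
     (\<forall>i\<in>I. bounded (V i) \<and> diameter (V i) \<le> \<delta>) \<and> (\<Sum>i\<in>I. diam_powr s (V i)) \<le> e"
  shows "hausdorff_measure s A = 0"
proof -
  have "hausdorff_premeasure s \<delta> A \<le> ennreal e" if "\<delta> > 0" "e > 0" for \<delta> e
  proof -
    obtain I :: "'i set" and V where I: "finite I" "A \<subseteq> (\<Union>i\<in>I. V i)"
     "\<forall>i\<in>I. bounded (V i) \<and> diameter (V i) \<le> \<delta>" "(\<Sum>i\<in>I. diam_powr s (V i)) \<le> e"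
      using assms[OF \<open>\<delta> > 0\<close> \<open>e > 0\<close>] by blast
    obtain f where f: "bij_betw f {..<card I} I"
      using ex_bij_betw_nat_finite[OF I(1)] by (auto simp: atLeast0LessThan)
    \<comment> \<open>Padding by the empty set is free: \<open>diam_powr\<close> gives it the value
      0 for every exponent, including 0.\<close>
    define U where "U n = (if n < card I then V (f n) else {})" for n
    have fI: "f n \<in> I" if "n < card I" for n using bij_betw_apply[OF f] that by auto
    have "A \<subseteq> (\<Union>n. U n)"
    proof
      fix x assume "x \<in> A"
      then obtain i where "i \<in> I" "x \<in> V i" using I(2) by auto
      moreover from this obtain n where "n < card I" "i = f n" using f by (auto simp: bij_betw_def)
      ultimately show "x \<in> (\<Union>n. U n)" by (auto simp: U_def)
    qed
    moreover have "\<forall>i. bounded (U i) \<and> diameter (U i) \<le> \<delta>"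
      using I(3) fI \<open>\<delta> > 0\<close> by (auto simp: U_def)
    ultimately have "hausdorff_premeasure s \<delta> A \<le> (\<Sum>n. ennreal (diam_powr s (U n)))"
      unfolding hausdorff_premeasure_def by (intro INF_lower) auto
    also have "\<dots> = (\<Sum>n<card I. ennreal (diam_powr s (U n)))"
      by (rule suminf_finite) (auto simp: U_def diam_powr_def)
    also have "\<dots> = ennreal (\<Sum>n<card I. diam_powr s (U n))"
      by (rule sum_ennreal) (rule diam_powr_nonneg)
    also have "(\<Sum>n<card I. diam_powr s (U n)) = (\<Sum>n<card I. diam_powr s (V (f n)))"
      by (rule sum.cong) (auto simp: U_def)
    also have "\<dots> = (\<Sum>i\<in>I. diam_powr s (V i))" by (rule sum.reindex_bij_betw[OF f])
    finally show ?thesis using I(4) by (meson ennreal_leI order_trans)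
  qed
  then have "hausdorff_premeasure s \<delta> A = 0" if "\<delta> > 0" for \<delta>
    using that ennreal_le_epsilon[of 0 "hausdorff_premeasure s \<delta> A"] by (simp add: le_zero_eq)
  then show ?thesis unfolding hausdorff_measure_def by (auto intro!: SUP_eqI)
qed

lemma hausdorff_dim_le:
  assumes "0 \<le> s" "\<And>s'. s < s' \<Longrightarrow> hausdorff_measure s' A = 0"
  shows "hausdorff_dim A \<le> ennreal s"
proof (rule ennreal_le_epsilon)
  fix e :: real assume "0 < e"
  then have "hausdorff_dim A \<le> ennreal (s + e)"
    unfolding hausdorff_dim_def using assms by (intro INF_lower) auto
  then show "hausdorff_dim A \<le> ennreal s + ennreal e" using assms \<open>0 < e\<close> by (simp add: ennreal_plus)
qed

lemma hausdorff_dim_ge: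
  assumes "\<And>s'. 0 \<le> s' \<Longrightarrow> s' < t \<Longrightarrow> hausdorff_measure s' A \<noteq> 0"
  shows "ennreal t \<le> hausdorff_dim A"
  unfolding hausdorff_dim_def using assms by (intro INF_greatest) (force simp: not_less intro: ennreal_leI)

section \<open>Lower bounds for Hausdorff measure from regular trees\<close>

primrec tree_level :: "('w \<Rightarrow> 'w set) \<Rightarrow> 'w \<Rightarrow> nat \<Rightarrow> 'w set" where
  "tree_level ch w 0 = {w}"
| "tree_level ch w (Suc n) = (\<Union>v\<in>tree_level ch w n. ch v)"

lemma tree_level_add: "tree_level ch w (n + k) = (\<Union>v\<in>tree_level ch w n. tree_level ch v k)"
  by (induction k) auto

text \<open>The exponent 0 is treated on its own: \<open>diam_powr\<close> changes its convention
  there, and the general argument takes powers \<open>1/s\<close>.\<close>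

lemma hausdorff_measure_0_pos:
  assumes "A \<noteq> {}" shows "hausdorff_measure 0 A \<noteq> 0"
proof -
  have "1 \<le> (\<Sum>i. ennreal (diam_powr 0 (U i)))" if A: "A \<subseteq> (\<Union>i. U i)" for U :: "nat \<Rightarrow> 'a set"
  proof -
    obtain i where "U i \<noteq> {}" using A assms by blast
    then have "1 = (\<Sum>i\<in>{i}. ennreal (diam_powr 0 (U i)))" by (simp add: diam_powr_def)
    also have "\<dots> \<le> (\<Sum>i. ennreal (diam_powr 0 (U i)))" by (rule sum_le_suminf) auto
    finally show ?thesis .
  qed
  then have "1 \<le> hausdorff_premeasure 0 1 A"
    unfolding hausdorff_premeasure_def by (intro INF_greatest) auto
  also have "\<dots> \<le> hausdorff_measure 0 A" unfolding hausdorff_measure_def by (intro SUP_upper) auto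
  finally show ?thesis by auto
qed

lemma open_enlargement:
  fixes U :: "'a::euclidean_space set"
  assumes "bounded U" "diameter U < d"
  obtains V where "open V" "bounded V" "U \<subseteq> V" "diameter V \<le> d"
proof -
  \<comment> \<open>Half of the slack, because both endpoints of a distance may move by up to
    \<eta>.\<close>
  define \<eta> where "\<eta> = (d - diameter U) / 2"
  define V where "V = (\<Union>x\<in>U. ball x \<eta>)"
  have d0: "0 \<le> d" using diameter_ge_0[OF assms(1)] assms(2) by simp
  have dist: "dist x y \<le> d" if xy: "x \<in> V" "y \<in> V" for x y
  proof -
    obtain x' y' where *: "x' \<in> U" "y' \<in> U" "dist x' x < \<eta>" "dist y' y < \<eta>" using xy by (auto simp: V_def)
    have "dist x' y' \<le> diameter U" by (rule diameter_bounded_bound[OF assms(1) *(1,2)])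
    moreover have "dist x y \<le> dist x' x + dist x' y' + dist y' y"
      using dist_triangle[of x y x'] dist_triangle[of x' y y'] by (simp add: dist_commute)
    ultimately show ?thesis using * by (simp add: \<eta>_def field_simps)
  qed
  have "bounded V" unfolding bounded_two_points using dist by blast
  moreover have "diameter V \<le> d" using dist d0 by (intro diameter_le) (auto simp: dist_norm)
  moreover have "U \<subseteq> V" using assms by (auto simp: V_def \<eta>_def intro!: bexI)
  moreover have "open V" by (auto simp: V_def)
  ultimately show ?thesis using that by blast
qed

text \<open>Assigns to a diameter \<open>d\<close> the level at which pieces have comparable size.
  The least \<open>n\<close> is taken; \<open>d \<le> 1\<close> covers the case where it is
  0.\<close>

lemma power_scale_exists:
  fixes \<beta> d :: real
  assumes "0 < \<beta>" "\<beta> < 1" "0 < d" "d \<le> 1"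
  obtains n where "\<beta> ^ Suc n < d" "d \<le> \<beta> ^ n"
proof -
  obtain k where "\<beta> ^ k < d" using real_arch_pow_inv[OF assms(3,2)] by blast
  moreover have "\<beta> ^ Suc k \<le> \<beta> ^ k" using assms by (intro power_decreasing) auto
  ultimately have ex: "\<exists>n. \<beta> ^ Suc n < d" by (meson le_less_trans)
  define n where "n = (LEAST n. \<beta> ^ Suc n < d)"
  have 1: "\<beta> ^ Suc n < d" unfolding n_def using ex by (rule LeastI_ex)
  have "d \<le> \<beta> ^ n"
  proof (cases n)
    case (Suc m)
    then have "\<not> \<beta> ^ Suc m < d" using not_less_Least[of m "\<lambda>n. \<beta> ^ Suc n < d"] by (simp add: n_def)
    then show ?thesis using Suc by simp
  qed (use assms in simp)
  with 1 show ?thesis by (rule that)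
qed

text \<open>A mass distribution argument by counting: by compactness a cover may be taken finite and
  open, and then one compares the number of nodes of a very deep level with the number of those
  descending from the few nodes met by each member of the cover.\<close>
lemma hausdorff_measure_tree:
  fixes S :: "'w \<Rightarrow> 'a::euclidean_space set" and C :: nat
  assumes P0: "P w0"
    and ch: "\<And>v. P v \<Longrightarrow> finite (ch v) \<and> card (ch v) = q \<and> (\<forall>u\<in>ch v. P u \<and> S u \<subseteq> S v)"
    and S: "\<And>v. P v \<Longrightarrow> compact (S v) \<and> S v \<noteq> {}"
    and disj: "\<And>n v v'. v \<in> tree_level ch w0 n \<Longrightarrow> v' \<in> tree_level ch w0 n \<Longrightarrow> v \<noteq> v' \<Longrightarrow> ch v \<inter> ch v' = {}"
    and mult: "\<And>n U. bounded U \<Longrightarrow> diameter U \<le> \<beta> ^ n \<Longrightarrow>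
      card {v\<in>tree_level ch w0 n. S v \<inter> U \<noteq> {}} \<le> C"
    and \<beta>: "0 < \<beta>" "\<beta> < 1" and s: "0 \<le> s" and q: "1 \<le> q * \<beta> powr s"
  shows "hausdorff_measure s {x. \<forall>n. \<exists>v\<in>tree_level ch w0 n. x \<in> S v} \<noteq> 0"
proof -
  define E where "E = {x. \<forall>n. \<exists>v\<in>tree_level ch w0 n. x \<in> S v}"
  have q0: "q > 0" using q by (cases q) auto
  have P: "\<forall>u\<in>tree_level ch v k. P u \<and> S u \<subseteq> S v" if "P v" for v k
    using that ch by (induction k) force+
  have fin: "finite (tree_level ch v k)" if "P v" for v k
    using P[OF that] ch by (induction k) (auto intro!: finite_UN_I)
  \<comment> \<open>Below an arbitrary node only an upper bound holds, since disjointness of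
    children is assumed along the levels of the root; for the root itself the count is
    exact.\<close>
  have le: "card (tree_level ch v k) \<le> q ^ k" if "P v" for v k
  proof (induction k)
    case (Suc k)
    have "card (tree_level ch v (Suc k)) \<le> (\<Sum>u\<in>tree_level ch v k. card (ch u))"
      using fin[OF that] by (simp add: card_UN_le)
    also have "\<dots> = card (tree_level ch v k) * q" using P[OF that] ch by simp
    finally show ?case using Suc by (metis mult_le_mono1 order_trans power_Suc2)
  qed simp
  have card: "card (tree_level ch w0 k) = q ^ k" for k
  proof (induction k)
    case (Suc k)
    have "card (tree_level ch w0 (Suc k)) = (\<Sum>u\<in>tree_level ch w0 k. card (ch u))"
      unfolding tree_level.simps using fin[OF P0] P[OF P0] ch disj by (intro card_UN_disjoint) blast+
    also have "\<dots> = card (tree_level ch w0 k) * q" using P[OF P0] ch by simp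
    finally show ?case using Suc by simp
  qed simp
  \<comment> \<open>Every node carries a point of \<open>E\<close>, found by descending through
    nested compact sets. Hence a cover of \<open>E\<close> must meet every node, so nodes can be
    counted through the cover.\<close>
  have pt: "\<exists>x. x \<in> S v \<and> x \<in> E" if v: "v \<in> tree_level ch w0 N" for v N
  proof -
    have Pv: "P v" using P[OF P0] v by blast
    have "\<exists>f. \<forall>k::nat. (P (f k) \<and> (k = 0 \<longrightarrow> f k = v)) \<and> f (Suc k) \<in> ch (f k)"
    proof (rule dependent_nat_choice)
      show "\<exists>x. P x \<and> ((0::nat) = 0 \<longrightarrow> x = v)" using Pv by auto
      fix x and k :: nat assume "P x \<and> (k = 0 \<longrightarrow> x = v)"
      then have "ch x \<noteq> {}" using ch q0 by (metis card.empty less_irrefl)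
      then show "\<exists>y. (P y \<and> (Suc k = 0 \<longrightarrow> y = v)) \<and> y \<in> ch x"
        using ch \<open>P x \<and> (k = 0 \<longrightarrow> x = v)\<close> by blast
    qed
    then obtain f where f: "\<And>k. P (f k)" "f 0 = v" "\<And>k. f (Suc k) \<in> ch (f k)" by blast
    have sub: "S (f n) \<subseteq> S (f m)" if "m \<le> n" for m n
      using that by (rule lift_Suc_antimono_le[of "\<lambda>n. S (f n)", rotated]) (use f ch in blast)
    have "\<Inter>(range (\<lambda>k. S (f k))) \<noteq> {}"
      by (rule compact_nest) (use S f sub in auto)
    then obtain x where x: "\<And>k. x \<in> S (f k)" by auto
    have fk: "f k \<in> tree_level ch v k" for k using f by (induction k) auto
    have "\<exists>u\<in>tree_level ch w0 n. x \<in> S u" for n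
    proof (cases "n \<le> N")
      case True
      then have "v \<in> (\<Union>u\<in>tree_level ch w0 n. tree_level ch u (N - n))"
        using v tree_level_add[of ch w0 n "N - n"] by simp
      then obtain u where u: "u \<in> tree_level ch w0 n" "v \<in> tree_level ch u (N - n)" by auto
      then have "P u" using P[OF P0] by blast
      then have "S v \<subseteq> S u" using P u by blast
      then show ?thesis using u x[of 0] f(2) by auto
    next
      case False
      then have "f (n - N) \<in> tree_level ch w0 n" using fk[of "n - N"] v tree_level_add[of ch w0 N "n - N"] by auto
      then show ?thesis using x by blast
    qed
    then show ?thesis using x[of 0] f(2) by (auto simp: E_def)
  qed
  have "E \<noteq> {}" using pt[of w0 0] by auto
  have "compact E"
  proof -
    have cl: "closed (\<Union>v\<in>tree_level ch w0 n. S v)" for n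
      using fin[OF P0] P[OF P0] S by (intro closed_UN) (auto intro: compact_imp_closed)
    have "E = S w0 \<inter> (\<Inter>n. \<Union>v\<in>tree_level ch w0 n. S v)"
    proof
      show "E \<subseteq> S w0 \<inter> (\<Inter>n. \<Union>v\<in>tree_level ch w0 n. S v)"
      proof
        fix x assume x: "x \<in> E"
        then have "\<exists>v\<in>tree_level ch w0 0. x \<in> S v" unfolding E_def by blast
        then show "x \<in> S w0 \<inter> (\<Inter>n. \<Union>v\<in>tree_level ch w0 n. S v)" using x by (auto simp: E_def)
      qed
    qed (auto simp: E_def)
    then show ?thesis using S[OF P0] cl by (auto intro!: compact_Int_closed closed_INT)
  qed
  show ?thesis
  proof (cases "s = 0")
    case True
    then show ?thesis using hausdorff_measure_0_pos[OF \<open>E \<noteq> {}\<close>] unfolding E_def by simp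
  next
    case False
    then have s: "0 < s" using s by simp
    have dp: "diam_powr s U = diameter U powr s" for U :: "'a set"
      using s by (simp add: diam_powr_def)
    show ?thesis unfolding E_def[symmetric]
    proof
      assume H: "hausdorff_measure s E = 0"
      \<comment> \<open>Chosen so that the final count comes out as \<open>C / (C + 1)\<close>,
        which is below 1.\<close>
      define c where "c = \<beta> powr s / (real C + 1)"
      have c: "0 < c" using \<beta> by (simp add: c_def)
      have "hausdorff_premeasure s (1/2) E \<le> hausdorff_measure s E"
        unfolding hausdorff_measure_def by (intro SUP_upper) auto
      then have "hausdorff_premeasure s (1/2) E < ennreal (c/2)" using H c by simp
      then obtain U where U: "E \<subseteq> (\<Union>i. U i)" "\<And>i. bounded (U i) \<and> diameter (U i) \<le> 1/2"
        and Us: "(\<Sum>i. ennreal (diam_powr s (U i))) < ennreal (c/2)"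
        unfolding hausdorff_premeasure_def by (auto simp: INF_less_iff)
      \<comment> \<open>The errors sum to at most \<open>c/2\<close>. They make \<open>d j\<close>
        positive even for a single point, and room for an open enlargement; the cap at 1 in
        \<open>d j\<close> guarantees a matching level.\<close>
      define e where "e j = c/2 * (1/2) ^ Suc j" for j
      define d where "d j = min 1 ((diameter (U j) powr s + e j) powr (1/s))" for j
      have e0: "0 < e j" for j using c by (simp add: e_def)
      have d1: "diameter (U j) < d j" for j
      proof -
        have "diameter (U j) = (diameter (U j) powr s) powr (1/s)"
          using s diameter_ge_0[of "U j"] U(2) by (simp add: powr_powr)
        also have "\<dots> < (diameter (U j) powr s + e j) powr (1/s)"
          using s e0 by (intro powr_less_mono2) auto
        finally show ?thesis using U(2)[of j] by (simp add: d_def)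
      qed
      have d0: "0 < d j" "d j \<le> 1" for j
        using d1[of j] diameter_ge_0[of "U j"] U(2)[of j] by (linarith, simp add: d_def)
      have ds: "d j powr s \<le> diameter (U j) powr s + e j" for j
      proof -
        have "d j powr s \<le> ((diameter (U j) powr s + e j) powr (1/s)) powr s"
          using d0[of j] s by (intro powr_mono2) (auto simp: d_def)
        also have "\<dots> = diameter (U j) powr s + e j"
          using s e0[of j] by (simp add: powr_powr add_nonneg_nonneg less_imp_le)
        finally show ?thesis .
      qed
      have "\<exists>V. open V \<and> bounded V \<and> U j \<subseteq> V \<and> diameter V \<le> d j" for j
        using open_enlargement[of "U j" "d j"] U(2) d1 by metis
      then obtain V where V: "\<And>j. open (V j) \<and> bounded (V j) \<and> U j \<subseteq> V j \<and> diameter (V j) \<le> d j" by metis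
      have "\<exists>n. \<beta> ^ Suc n < d j \<and> d j \<le> \<beta> ^ n" for j
        using power_scale_exists[OF \<beta> d0[of j]] by metis
      then obtain n where n: "\<And>j. \<beta> ^ Suc (n j) < d j \<and> d j \<le> \<beta> ^ n j" by metis
      have EV: "E \<subseteq> (\<Union>j\<in>UNIV. V j)" using U(1) V by blast
      have "open (V j)" for j using V by blast
      then obtain J where J: "finite J" "E \<subseteq> (\<Union>j\<in>J. V j)"
        using compactE_image[OF \<open>compact E\<close> _ EV] by metis
      have "J \<noteq> {}" using J \<open>E \<noteq> {}\<close> by auto
      define N where "N = Max (n ` J)"
      have nN: "n j \<le> N" if "j \<in> J" for j using that J by (auto simp: N_def)
      obtain x where x: "\<And>v. v \<in> tree_level ch w0 N \<Longrightarrow> x v \<in> S v \<and> x v \<in> E" using pt by metis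
      define A where "A j = {u\<in>tree_level ch w0 (n j). S u \<inter> V j \<noteq> {}}" for j
      have cov: "tree_level ch w0 N \<subseteq> (\<Union>j\<in>J. \<Union>u\<in>A j. tree_level ch u (N - n j))"
      proof
        fix v assume v: "v \<in> tree_level ch w0 N"
        then obtain j where j: "j \<in> J" "x v \<in> V j" using J x by blast
        have "v \<in> (\<Union>u\<in>tree_level ch w0 (n j). tree_level ch u (N - n j))"
          using v nN[OF j(1)] tree_level_add[of ch w0 "n j" "N - n j"] by simp
        then obtain u where u: "u \<in> tree_level ch w0 (n j)" "v \<in> tree_level ch u (N - n j)" by auto
        then have "S v \<subseteq> S u" using P P[OF P0] by blast
        then have "u \<in> A j" using u j x[OF v] by (auto simp: A_def)
        then show "v \<in> (\<Union>j\<in>J. \<Union>u\<in>A j. tree_level ch u (N - n j))" using u j by auto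
      qed
      have finA: "finite (A j)" for j using fin[OF P0] by (simp add: A_def)
      have PA: "P u" if "u \<in> A j" for u j using that P[OF P0] by (auto simp: A_def)
      have cA: "card (\<Union>u\<in>A j. tree_level ch u (N - n j)) \<le> C * q ^ (N - n j)" for j
      proof -
        have "card (\<Union>u\<in>A j. tree_level ch u (N - n j)) \<le> (\<Sum>u\<in>A j. card (tree_level ch u (N - n j)))"
          using finA by (rule card_UN_le)
        also have "\<dots> \<le> (\<Sum>u\<in>A j. q ^ (N - n j))" using le PA by (intro sum_mono) auto
        also have "\<dots> \<le> C * q ^ (N - n j)"
          using mult[of "V j" "n j"] V[of j] n[of j] by (auto simp: A_def)
        finally show ?thesis .
      qed
      \<comment> \<open>All nodes of the deepest level \<open>N\<close> descend from the at most
        \<open>C\<close> nodes of level \<open>n j\<close> met by some \<open>V j\<close>.\<close>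
      have "q ^ N \<le> (\<Sum>j\<in>J. C * q ^ (N - n j))"
      proof -
        have "q ^ N \<le> card (\<Union>j\<in>J. \<Union>u\<in>A j. tree_level ch u (N - n j))"
          unfolding card[symmetric] using J finA PA fin by (intro card_mono cov finite_UN_I) auto
        also have "\<dots> \<le> (\<Sum>j\<in>J. card (\<Union>u\<in>A j. tree_level ch u (N - n j)))" using J by (intro card_UN_le)
        also have "\<dots> \<le> (\<Sum>j\<in>J. C * q ^ (N - n j))" using cA by (intro sum_mono)
        finally show ?thesis .
      qed
      then have "real (q ^ N) \<le> real (\<Sum>j\<in>J. C * q ^ (N - n j))" by (simp only: of_nat_le_iff)
      then have "real q ^ N \<le> (\<Sum>j\<in>J. real C * real q ^ (N - n j))" by simp
      also have "\<dots> = real q ^ N * (\<Sum>j\<in>J. real C * (1 / real q) ^ n j)"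
        unfolding sum_distrib_left using q0 nN by (intro sum.cong) (auto simp: power_diff power_one_over field_simps)
      finally have "1 \<le> (\<Sum>j\<in>J. real C * (1 / real q) ^ n j)" using q0 by simp
      also have "\<dots> \<le> (\<Sum>j\<in>J. real C * (\<beta> powr (-s) * d j powr s))"
      proof (intro sum_mono mult_left_mono)
        fix j
        have "1 / real q \<le> \<beta> powr s" using q q0 by (simp add: field_simps)
        then have "(1 / real q) ^ n j \<le> (\<beta> powr s) ^ n j" by (intro power_mono) auto
        also have "\<dots> = (\<beta> ^ n j) powr s"
          using \<beta> by (simp add: powr_powr mult.commute flip: powr_realpow)
        also have "\<dots> = \<beta> powr (-s) * (\<beta> ^ Suc (n j)) powr s"
          using \<beta> by (simp add: powr_mult powr_minus field_simps)
        also have "\<dots> \<le> \<beta> powr (-s) * d j powr s"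
          using n[of j] \<beta> s by (intro mult_left_mono powr_mono2) auto
        finally show "(1 / real q) ^ n j \<le> \<beta> powr (-s) * d j powr s" .
      qed simp
      also have "\<dots> = real C * \<beta> powr (-s) * (\<Sum>j\<in>J. d j powr s)"
        by (simp add: sum_distrib_left mult.assoc)
      also have "\<dots> \<le> real C * \<beta> powr (-s) * c"
      proof (intro mult_left_mono)
        have "(\<Sum>j\<in>J. d j powr s) \<le> (\<Sum>j\<in>J. diameter (U j) powr s) + (\<Sum>j\<in>J. e j)"
          unfolding sum.distrib[symmetric] by (intro sum_mono ds)
        moreover have "(\<Sum>j\<in>J. diameter (U j) powr s) \<le> c/2"
        proof -
          have "ennreal (\<Sum>j\<in>J. diameter (U j) powr s) = (\<Sum>j\<in>J. ennreal (diam_powr s (U j)))"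
            by (simp add: dp sum_ennreal)
          also have "\<dots> \<le> (\<Sum>i. ennreal (diam_powr s (U i)))" using J by (intro sum_le_suminf) auto
          also have "\<dots> \<le> ennreal (c/2)" using Us by simp
          finally show ?thesis using c by (simp add: ennreal_le_iff)
        qed
        moreover have "(\<Sum>j\<in>J. e j) \<le> c/2"
        proof -
          have g: "(\<lambda>j. (1/2::real) ^ Suc j) sums 1" using power_half_series .
          then have "(\<Sum>j\<in>J. (1/2::real) ^ Suc j) \<le> 1"
            using sum_le_suminf[of "\<lambda>j. (1/2::real) ^ Suc j" J] J sums_unique[OF g] sums_summable[OF g] by simp
          then have "c/2 * (\<Sum>j\<in>J. (1/2::real) ^ Suc j) \<le> c/2 * 1" using c by (intro mult_left_mono) auto
          then show ?thesis by (simp only: e_def sum_distrib_left mult_1_right)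
        qed
        ultimately show "(\<Sum>j\<in>J. d j powr s) \<le> c" by linarith
      qed simp
      also have "\<dots> = real C / (real C + 1)" using \<beta> by (simp add: c_def powr_minus field_simps)
      also have "\<dots> < 1" by simp
      finally show False by simp
    qed
  qed
qed

section \<open>Covolumes of lists of vectors\<close>

lemma infdist_span_add:
  fixes v :: "'a::euclidean_space"
  assumes "z \<in> span T"
  shows "infdist (v + z) (span T) = infdist v (span T)"
proof -
  have le: "infdist (v + z) (span T) \<le> infdist v (span T)" if "z \<in> span T" for v z :: 'a
  proof -
    have "span T \<noteq> {}" using span_zero by blast
    then obtain y where y: "y \<in> span T" "infdist v (span T) = dist v y"
      using infdist_attains_inf[of "span T" v] closed_span by metis
    have "infdist (v + z) (span T) \<le> dist (v + z) (y + z)"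
      by (intro infdist_le span_add y that)
    then show ?thesis using y by (simp add: dist_norm)
  qed
  show ?thesis using le[OF assms, of v] le[of "-z" "v + z"] assms span_neg[of z T] by auto
qed

lemma infdist_span_orthogonal:
  fixes z y :: "'a::euclidean_space"
  assumes "z \<in> span T" "\<And>w. w \<in> span T \<Longrightarrow> y \<bullet> w = 0"
  shows "infdist (z + y) (span T) = norm y"
proof -
  have "infdist y (span T) = norm y"
  proof (rule antisym)
    show "infdist y (span T) \<le> norm y" using infdist_le[OF span_zero, of y T] by simp
    have "span T \<noteq> {}" using span_zero by blast
    then obtain w where w: "w \<in> span T" "infdist y (span T) = dist y w"
      using infdist_attains_inf[of "span T" y] closed_span by metis
    have "(norm y)\<^sup>2 \<le> (norm (y - w))\<^sup>2"
      using assms(2)[OF w(1)] unfolding power2_norm_eq_inner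
      by (simp add: inner_diff_left inner_diff_right inner_commute)
    then have "norm y \<le> norm (y - w)" by (rule power2_le_imp_le) simp
    then show "norm y \<le> infdist y (span T)" using w(2) by (simp add: dist_norm)
  qed
  then show ?thesis using infdist_span_add[OF assms(1), of y] by (simp add: add.commute)
qed

lemma infdist_span_scale:
  fixes v :: "'a::euclidean_space"
  shows "infdist (c *\<^sub>R v) (span T) = \<bar>c\<bar> * infdist v (span T)"
proof -
  obtain y z where yz: "y \<in> span T" "\<And>w. w \<in> span T \<Longrightarrow> orthogonal z w" "v = y + z"
    using orthogonal_subspace_decomp_exists[of T v] by metis
  have "infdist (c *\<^sub>R y + c *\<^sub>R z) (span T) = norm (c *\<^sub>R z)"
    by (rule infdist_span_orthogonal) (use yz in \<open>auto simp: span_scale orthogonal_def\<close>)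
  moreover have "infdist (y + z) (span T) = norm z"
    by (rule infdist_span_orthogonal) (use yz in \<open>auto simp: orthogonal_def\<close>)
  ultimately show ?thesis by (simp add: yz scaleR_add_right)
qed

lemma infdist_span_eq_0:
  fixes v :: "'a::euclidean_space"
  shows "infdist v (span T) = 0 \<longleftrightarrow> v \<in> span T"
  using in_closed_iff_infdist_zero[of "span T" v] closed_span span_zero by blast

text \<open>The square of either side is the Gram determinant of the components of \<open>u\<close>
  and \<open>v\<close> orthogonal to \<open>span T\<close>, which is symmetric in the two vectors.
  This is what makes \<open>rcovol\<close> independent of the order of the list.\<close>

lemma infdist_span_insert_times:
  fixes u v :: "'a::euclidean_space"
  shows "infdist v (span (insert u T)) * infdist u (span T)
       = infdist u (span (insert v T)) * infdist v (span T)"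
proof -
  have *: "(infdist v (span (insert u T)) * infdist u (span T))\<^sup>2 =
     (norm v1)\<^sup>2 * (norm u1)\<^sup>2 - (v1 \<bullet> u1)\<^sup>2"
    if u: "u0 \<in> span T" "\<And>w. w \<in> span T \<Longrightarrow> u1 \<bullet> w = 0" "u = u0 + u1"
    and v: "v0 \<in> span T" "\<And>w. w \<in> span T \<Longrightarrow> v1 \<bullet> w = 0" "v = v0 + v1" for u v u0 u1 v0 v1
  proof (cases "u1 = 0")
    case True
    then show ?thesis using u infdist_span_eq_0 by auto
  next
    case False
    \<comment> \<open>The Gram-Schmidt coefficient: \<open>v1 - c *\<^sub>R u1\<close> is orthogonal
      to all of \<open>span (insert u T)\<close>.\<close>
    define c where "c = (v1 \<bullet> u1) / (u1 \<bullet> u1)"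
    have u1: "u1 \<in> span (insert u T)"
    proof -
      have "u1 = u - u0" using u by simp
      then show ?thesis using u(1) span_mono[of T "insert u T"] span_base[of u "insert u T"] span_diff
        by (metis insertI1 subsetD subset_insertI)
    qed
    have "infdist ((v0 + c *\<^sub>R u1) + (v1 - c *\<^sub>R u1)) (span (insert u T)) = norm (v1 - c *\<^sub>R u1)"
    proof (rule infdist_span_orthogonal)
      show "v0 + c *\<^sub>R u1 \<in> span (insert u T)"
        using v(1) span_mono[of T "insert u T"] u1 by (auto intro: span_add span_scale)
      fix w assume "w \<in> span (insert u T)"
      then obtain k where k: "w - k *\<^sub>R u \<in> span T" using span_breakdown_eq by blast
      then have "w - k *\<^sub>R u + k *\<^sub>R u0 \<in> span T" using u(1) by (intro span_add span_scale)
      moreover have "w = (w - k *\<^sub>R u + k *\<^sub>R u0) + k *\<^sub>R u1" using u(3) by (simp add: algebra_simps)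
      moreover have "(v1 - c *\<^sub>R u1) \<bullet> u1 = 0" using False by (simp add: c_def inner_diff_left)
      moreover define y where "y = w - k *\<^sub>R u + k *\<^sub>R u0"
      ultimately have "y \<in> span T" "w = y + k *\<^sub>R u1" "(v1 - c *\<^sub>R u1) \<bullet> u1 = 0" by simp_all
      then show "(v1 - c *\<^sub>R u1) \<bullet> w = 0" using u(2)[of y] v(2)[of y]
        by (simp add: inner_add_right inner_diff_left)
    qed
    then have 1: "infdist v (span (insert u T)) = norm (v1 - c *\<^sub>R u1)" using v(3) by simp
    have 2: "infdist u (span T) = norm u1" using infdist_span_orthogonal[OF u(1,2)] u(3) by simp
    have "(norm (v1 - c *\<^sub>R u1))\<^sup>2 * (norm u1)\<^sup>2 = (v1 \<bullet> v1 - 2 * c * (v1 \<bullet> u1) + c * c * (u1 \<bullet> u1)) * (u1 \<bullet> u1)"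
      unfolding power2_norm_eq_inner by (simp add: inner_diff_left inner_diff_right inner_commute algebra_simps)
    also have "\<dots> = (norm v1)\<^sup>2 * (norm u1)\<^sup>2 - (v1 \<bullet> u1)\<^sup>2"
      using False unfolding power2_norm_eq_inner by (simp add: c_def field_simps power2_eq_square)
    finally show ?thesis using 1 2 by (simp add: power_mult_distrib)
  qed
  obtain u0 u1 where u: "u0 \<in> span T" "\<And>w. w \<in> span T \<Longrightarrow> orthogonal u1 w" "u = u0 + u1"
    using orthogonal_subspace_decomp_exists[of T u] by metis
  obtain v0 v1 where v: "v0 \<in> span T" "\<And>w. w \<in> span T \<Longrightarrow> orthogonal v1 w" "v = v0 + v1"
    using orthogonal_subspace_decomp_exists[of T v] by metis
  have "(infdist v (span (insert u T)) * infdist u (span T))\<^sup>2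
       = (infdist u (span (insert v T)) * infdist v (span T))\<^sup>2"
    using *[of u0 u1 u v0 v1 v] *[of v0 v1 v u0 u1 u] u v unfolding orthogonal_def
    by (simp add: inner_commute mult.commute)
  then show ?thesis by (rule power2_eq_imp_eq) (simp_all add: infdist_nonneg)
qed

text \<open>The lower bound on \<open>h\<close> is asked for only on the span involved, so that maps
  expanding one subspace and contracting others are covered.\<close>

lemma infdist_span_linear_ge:
  fixes h :: "'a::euclidean_space \<Rightarrow> 'b::euclidean_space"
  assumes h: "linear h" and c: "\<And>x. x \<in> span (insert v T) \<Longrightarrow> c * norm x \<le> norm (h x)" "0 \<le> c"
  shows "c * infdist v (span T) \<le> infdist (h v) (span (h ` T))"
proof -
  have "span (h ` T) \<noteq> {}" using span_zero by blast
  then obtain y where y: "y \<in> span (h ` T)" "infdist (h v) (span (h ` T)) = dist (h v) y"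
    using infdist_attains_inf[of "span (h ` T)" "h v"] closed_span by metis
  then obtain z where z: "z \<in> span T" "y = h z" using linear_span_image[OF h, of T] by auto
  have "c * infdist v (span T) \<le> c * dist v z" using infdist_le[OF z(1)] c(2) by (simp add: mult_left_mono)
  also have "\<dots> \<le> norm (h (v - z))" unfolding dist_norm
    by (rule c) (use z span_mono[of T "insert v T"] span_base[of v "insert v T"] in \<open>auto intro!: span_diff\<close>)
  finally show ?thesis using y z h by (simp add: dist_norm linear_diff)
qed

lemma infdist_span_linear_le:
  fixes h :: "'a::euclidean_space \<Rightarrow> 'b::euclidean_space"
  assumes h: "linear h" and c: "\<And>x. norm (h x) \<le> norm x"
  shows "infdist (h v) (span (h ` T)) \<le> infdist v (span T)"
proof -
  have "span T \<noteq> {}" using span_zero by blast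
  then obtain y where y: "y \<in> span T" "infdist v (span T) = dist v y"
    using infdist_attains_inf[of "span T" v] closed_span by metis
  have "infdist (h v) (span (h ` T)) \<le> dist (h v) (h y)"
    by (rule infdist_le) (use y linear_span_image[OF h, of T] in auto)
  also have "\<dots> \<le> dist v y" using c[of "v - y"] h by (simp add: dist_norm linear_diff)
  finally show ?thesis using y by simp
qed

text \<open>The covolume of \<open>vs\<close> modulo the span of \<open>S\<close>, computed by the Gram-Schmidt process.\<close>
fun rcovol :: "'a::euclidean_space set \<Rightarrow> 'a list \<Rightarrow> real" where
  "rcovol S [] = 1"
| "rcovol S (v # vs) = infdist v (span (S \<union> set vs)) * rcovol S vs"

lemma rcovol_nonneg: "0 \<le> rcovol S vs"
  by (induction vs) (auto simp: infdist_nonneg)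

lemma span_Un_cong: "span A = span A' \<Longrightarrow> span (A \<union> B) = span (A' \<union> B)"
  by (simp add: span_Un)

lemma rcovol_cong: "span S = span S' \<Longrightarrow> rcovol S vs = rcovol S' vs"
proof (induction vs)
  case (Cons v vs)
  then show ?case using span_Un_cong[OF Cons.prems, of "set vs"] by simp
qed simp

lemma rcovol_append: "rcovol S (xs @ ys) = rcovol (S \<union> set ys) xs * rcovol S ys"
  by (induction xs) (simp_all add: ac_simps)

lemma rcovol_swap: "rcovol S (u # v # vs) = rcovol S (v # u # vs)"
  using infdist_span_insert_times[of u v "S \<union> set vs"] by simp

lemma rcovol_remove1: "x \<in> set xs \<Longrightarrow> rcovol S xs = rcovol S (x # remove1 x xs)"
proof (induction xs)
  case (Cons y xs)
  show ?case
  proof (cases "x = y")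
    case False
    then have x: "x \<in> set xs" using Cons by auto
    then have "set xs = set (x # remove1 x xs)"
      by (intro mset_eq_setD) simp
    then have "rcovol S (y # xs) = rcovol S (y # x # remove1 x xs)"
      using Cons.IH[OF x] by simp
    also have "\<dots> = rcovol S (x # y # remove1 x xs)" by (rule rcovol_swap)
    finally show ?thesis using False by simp
  qed simp
qed simp

lemma rcovol_perm: "mset xs = mset ys \<Longrightarrow> rcovol S xs = rcovol S ys"
proof (induction xs arbitrary: ys)
  case (Cons x xs)
  then have x: "x \<in> set ys" by (metis list.set_intros(1) set_mset_mset)
  then have m: "mset xs = mset (remove1 x ys)" using Cons.prems by (metis add_mset_remove_trivial mset.simps(2) mset_remove1)
  have "set xs = set (remove1 x ys)" using mset_eq_setD[OF m] .
  then show ?case using rcovol_remove1[OF x, of S] Cons.IH[OF m] by simp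
qed simp

text \<open>Moving \<open>u\<close> to the end of the list puts it into the base set. This is the
  other way to peel off a vector, and the one on which the induction for \<open>rcovol_ratio\<close>
  runs.\<close>

lemma rcovol_Cons_inner: "rcovol S (u # us) = rcovol (insert u S) us * infdist u (span S)"
proof -
  have "rcovol S (u # us) = rcovol S (us @ [u])" by (rule rcovol_perm) simp
  then show ?thesis by (simp add: rcovol_append)
qed

lemma span_image_cong:
  fixes h :: "'a::euclidean_space \<Rightarrow> 'b::euclidean_space"
  assumes "linear h" "span A = span B"
  shows "span (h ` A) = span (h ` B)"
  using assms linear_span_image by metis

text \<open>The factor by which \<open>h\<close> changes covolumes is the determinant of
  \<open>h\<close> on the subspace modulo \<open>S\<close>, so it does not depend on the spanning
  list. It is stated with the denominators multiplied out, so that dependent lists need no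
  exception.\<close>

lemma rcovol_ratio:
  fixes h :: "'a::euclidean_space \<Rightarrow> 'b::euclidean_space"
  assumes h: "linear h"
  shows "length vs = length us \<Longrightarrow> span (S \<union> set vs) = span (S \<union> set us) \<Longrightarrow>
    rcovol (h ` S) (map h vs) * rcovol S us = rcovol (h ` S) (map h us) * rcovol S vs"
proof (induction vs arbitrary: us S)
  case (Cons v vs)
  show ?case
  proof (cases "set us \<subseteq> span (S \<union> set vs)")
    case True
    then have "span (S \<union> set us) \<subseteq> span (S \<union> set vs)"
      by (intro span_minimal) (auto simp: span_base)
    then have v: "v \<in> span (S \<union> set vs)" using Cons.prems(2) span_base[of v "S \<union> set (v # vs)"] by auto
    then have "h v \<in> span (h ` (S \<union> set vs))" using linear_span_image[OF h] by auto
    then have "rcovol (h ` S) (map h (v # vs)) = 0"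
      using infdist_span_eq_0[of "h v" "h ` S \<union> h ` set vs"] by (simp add: image_Un)
    moreover have "rcovol S (v # vs) = 0" using v infdist_span_eq_0[of v] by simp
    ultimately show ?thesis by (simp only: mult_zero_left mult_zero_right)
  next
    case False
    \<comment> \<open>Steinitz exchange: replacing \<open>v\<close> by \<open>u\<close> scales the
      covolumes before and after \<open>h\<close> by the same \<open>\<bar>a\<bar>\<close>. The two
      lists then share \<open>u\<close>, which moves into the base set.\<close>
    then obtain u where u: "u \<in> set us" "u \<notin> span (S \<union> set vs)" by auto
    define us' where "us' = remove1 u us"
    have mus: "mset us = mset (u # us')" using u by (simp add: us'_def)
    have "u \<in> span (insert v (S \<union> set vs))" using Cons.prems(2) span_base[of u "S \<union> set us"] u by auto
    then obtain a where a: "u - a *\<^sub>R v \<in> span (S \<union> set vs)" using span_breakdown_eq by blast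
    have a0: "a \<noteq> 0" using a u by auto
    define z where "z = u - a *\<^sub>R v"
    have uz: "u = a *\<^sub>R v + z" by (simp add: z_def)
    have "h z \<in> span (h ` (S \<union> set vs))" using linear_span_image[OF h] a by (auto simp: z_def)
    then have hz: "h z \<in> span (h ` S \<union> set (map h vs))" by (simp add: image_Un)
    have 1: "rcovol S (u # vs) = \<bar>a\<bar> * rcovol S (v # vs)"
      using infdist_span_add[OF a, of "a *\<^sub>R v"] by (simp add: infdist_span_scale)
    have 2: "rcovol (h ` S) (map h (u # vs)) = \<bar>a\<bar> * rcovol (h ` S) (map h (v # vs))"
      using infdist_span_add[OF hz, of "a *\<^sub>R h v"] h
      by (simp add: infdist_span_scale uz linear_add linear_scale)
    have "v \<in> span (insert u (S \<union> set vs))"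
    proof -
      have "(1/a) *\<^sub>R (u - z) \<in> span (insert u (S \<union> set vs))"
        using a span_mono[of "S \<union> set vs" "insert u (S \<union> set vs)"] span_base[of u "insert u (S \<union> set vs)"]
        by (auto intro!: span_scale span_diff simp: z_def[symmetric])
      then show ?thesis using a0 by (simp add: uz)
    qed
    then have "span (insert u (S \<union> set vs)) = span (insert v (insert u (S \<union> set vs)))"
      by (simp add: span_redundant)
    also have "\<dots> = span (insert u (insert v (S \<union> set vs)))" by (simp add: insert_commute)
    also have "\<dots> = span (insert v (S \<union> set vs))"
      by (rule span_redundant) (fact \<open>u \<in> span (insert v (S \<union> set vs))\<close>)
    also have "\<dots> = span (S \<union> set us)" using Cons.prems(2) by simp
    also have "S \<union> set us = insert u S \<union> set us'" using mset_eq_setD[OF mus] by auto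
    finally have sp: "span (insert u S \<union> set vs) = span (insert u S \<union> set us')" by simp
    have len: "length vs = length us'" using Cons.prems(1) mset_eq_length[OF mus] by simp
    have IH: "rcovol (insert (h u) (h ` S)) (map h vs) * rcovol (insert u S) us'
            = rcovol (insert (h u) (h ` S)) (map h us') * rcovol (insert u S) vs"
      using Cons.IH[OF len sp] by simp
    have us: "rcovol S us = rcovol S (u # us')" "rcovol (h ` S) (map h us) = rcovol (h ` S) (map h (u # us'))"
      using mus by (auto intro!: rcovol_perm simp del: rcovol.simps)
    have "rcovol (h ` S) (map h (u # vs)) * rcovol S us = rcovol (h ` S) (map h us) * rcovol S (u # vs)"
      unfolding us list.map rcovol_Cons_inner using IH by (simp add: mult.assoc mult.commute mult.left_commute)
    then have "\<bar>a\<bar> * (rcovol (h ` S) (map h (v # vs)) * rcovol S us)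
             = \<bar>a\<bar> * (rcovol (h ` S) (map h us) * rcovol S (v # vs))"
      unfolding 1 2 by (simp only: ac_simps)
    then show ?thesis using a0 by simp
  qed
qed simp

lemma rcovol_linear_ge:
  fixes h :: "'a::euclidean_space \<Rightarrow> 'b::euclidean_space"
  assumes h: "linear h" and "0 \<le> c"
  shows "(\<And>x. x \<in> span (set vs) \<Longrightarrow> c * norm x \<le> norm (h x)) \<Longrightarrow>
    c ^ length vs * rcovol {} vs \<le> rcovol {} (map h vs)"
proof (induction vs)
  case (Cons v vs)
  have "c * infdist v (span (set vs)) \<le> infdist (h v) (span (h ` set vs))"
    using Cons.prems by (intro infdist_span_linear_ge h \<open>0 \<le> c\<close>) simp
  moreover have "c ^ length vs * rcovol {} vs \<le> rcovol {} (map h vs)"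
    using Cons.prems span_mono[of "set vs" "set (v # vs)"] by (intro Cons.IH) auto
  ultimately have "(c * infdist v (span (set vs))) * (c ^ length vs * rcovol {} vs)
      \<le> infdist (h v) (span (h ` set vs)) * rcovol {} (map h vs)"
    using \<open>0 \<le> c\<close> by (intro mult_mono) (auto simp: infdist_nonneg rcovol_nonneg)
  then show ?case by (simp add: ac_simps)
qed simp

lemma rcovol_linear_le:
  fixes h :: "'a::euclidean_space \<Rightarrow> 'b::euclidean_space"
  assumes "linear h" "\<And>x. norm (h x) \<le> norm x"
  shows "rcovol (h ` S) (map h vs) \<le> rcovol S vs"
proof (induction vs)
  case (Cons v vs)
  have "infdist (h v) (span (h ` (S \<union> set vs))) \<le> infdist v (span (S \<union> set vs))"
    by (rule infdist_span_linear_le) fact+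
  then show ?case using Cons.IH
    by (simp add: image_Un mult_mono infdist_nonneg rcovol_nonneg)
qed simp

lemma rcovol_antimono: "S \<subseteq> span T \<Longrightarrow> rcovol T vs \<le> rcovol S vs"
proof (induction vs)
  case (Cons v vs)
  have "span (S \<union> set vs) \<subseteq> span (T \<union> set vs)"
    using Cons.prems span_mono[of T "T \<union> set vs"]
    by (intro span_minimal) (auto intro: span_base)
  moreover have "span (S \<union> set vs) \<noteq> {}" using span_zero by blast
  ultimately have "infdist v (span (T \<union> set vs)) \<le> infdist v (span (S \<union> set vs))"
    by (rule infdist_mono)
  then show ?case using Cons by (simp add: mult_mono infdist_nonneg rcovol_nonneg)
qed simp

text \<open>Comparing \<open>dim\<close> with \<open>length\<close> makes repeated entries count as
  dependence.\<close>

definition lindep :: "'a::euclidean_space list \<Rightarrow> bool" where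
  "lindep vs \<longleftrightarrow> dim (set vs) = length vs"

lemma lindep_Cons: "lindep (v # vs) \<longleftrightarrow> v \<notin> span (set vs) \<and> lindep vs"
proof -
  have "dim (set vs) \<le> length vs" using dim_le_card'[of "set vs"] card_length[of vs] by simp
  then show ?thesis by (auto simp: lindep_def dim_insert)
qed

lemma lindep_Nil: "lindep []"
  by (simp add: lindep_def)

lemma rcovol_pos: "lindep vs \<Longrightarrow> 0 < rcovol {} vs"
proof (induction vs)
  case (Cons v vs)
  then show ?case using infdist_span_eq_0[of v "set vs"] infdist_nonneg[of v "span (set vs)"]
    by (auto simp: lindep_Cons intro!: mult_pos_pos)
qed simp

lemma lindep_append: "lindep (xs @ ys) \<Longrightarrow> lindep ys"
  by (induction xs) (auto simp: lindep_Cons)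

lemma exists_lindep_list:
  fixes W :: "'a::euclidean_space set"
  assumes "subspace W"
  obtains vs where "lindep vs" "span (set vs) = W" "length vs = dim W"
proof -
  obtain B where B: "B \<subseteq> W" "independent B" "W \<subseteq> span B" "card B = dim W" using basis_exists[of W] by metis
  then obtain vs where vs: "set vs = B" "distinct vs"
    using finite_distinct_list[of B] independent_imp_finite by blast
  have "span B = W" using B assms span_minimal[of B W] by blast
  moreover have "length vs = dim W" using vs B(4) distinct_card by metis
  moreover have "dim (set vs) = dim W" using \<open>span B = W\<close> vs dim_span[of B] by simp
  ultimately show ?thesis using that vs unfolding lindep_def by auto
qed

text \<open>The integer lattice in any Euclidean space; on pairs of vectors it is the product of the
  two integer lattices.\<close>

definition intvec :: "'a::euclidean_space \<Rightarrow> bool" where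
  "intvec v \<longleftrightarrow> (\<forall>b\<in>Basis. v \<bullet> b \<in> \<int>)"

lemma intvec_scale: "c \<in> \<int> \<Longrightarrow> intvec v \<Longrightarrow> intvec (c *\<^sub>R v)"
  by (auto simp: intvec_def)

lemma intvec_diff: "intvec u \<Longrightarrow> intvec v \<Longrightarrow> intvec (u - v)"
  by (auto simp: intvec_def inner_diff_left)

lemma intvec_Basis: "b \<in> Basis \<Longrightarrow> intvec b"
  by (auto simp: intvec_def inner_Basis)

lemma intvec_inner:
  fixes u v :: "'a::euclidean_space"
  assumes "intvec u" "intvec v" shows "u \<bullet> v \<in> \<int>"
  unfolding euclidean_inner[of u v] using assms by (intro Ints_sum Ints_mult) (auto simp: intvec_def)

section \<open>Unimodular changes of basis and submodularity of covolumes\<close>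

text \<open>Unimodular equivalence of lists, recorded only through the consequences that are needed.\<close>
definition uequiv :: "'a::euclidean_space list \<Rightarrow> 'a list \<Rightarrow> bool" where
  "uequiv xs ys \<longleftrightarrow> length xs = length ys \<and> (\<forall>S. span (S \<union> set xs) = span (S \<union> set ys)) \<and>
     (\<forall>h :: 'a \<Rightarrow> 'a. linear h \<longrightarrow> (\<forall>S. rcovol S (map h xs) = rcovol S (map h ys))) \<and>
     ((\<forall>x\<in>set xs. intvec x) \<longrightarrow> (\<forall>y\<in>set ys. intvec y))"

lemma uequiv_refl: "uequiv xs xs"
  by (simp add: uequiv_def)

lemma uequiv_trans: "uequiv xs ys \<Longrightarrow> uequiv ys zs \<Longrightarrow> uequiv xs zs"
  by (simp add: uequiv_def)

lemma uequiv_span: "uequiv xs ys \<Longrightarrow> span (set xs) = span (set ys)"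
  unfolding uequiv_def by (metis Un_empty_left)

lemma uequiv_perm: 
  assumes "mset xs = mset ys" shows "uequiv xs ys"
proof -
  have "mset (map h xs) = mset (map h ys)" for h :: "'a \<Rightarrow> 'a" using assms by simp
  then have "rcovol S (map h xs) = rcovol S (map h ys)" for h :: "'a \<Rightarrow> 'a" and S by (rule rcovol_perm)
  then show ?thesis unfolding uequiv_def using mset_eq_setD[OF assms] mset_eq_length[OF assms] by auto
qed

lemma uequiv_Cons:
  assumes "uequiv xs ys" shows "uequiv (u # xs) (u # ys)"
proof -
  have sp: "span (S \<union> set xs) = span (S \<union> set ys)" for S using assms by (simp add: uequiv_def)
  have "rcovol S (map h (u # xs)) = rcovol S (map h (u # ys))" if h: "linear h" for h :: "'a \<Rightarrow> 'a" and S
  proof -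
    have "span (h ` set xs) = span (h ` set ys)"
      by (rule span_image_cong[OF h uequiv_span[OF assms]])
    then have "span (S \<union> h ` set xs) = span (S \<union> h ` set ys)" by (simp add: span_Un)
    then show ?thesis using assms h by (simp add: uequiv_def)
  qed
  moreover have "span (S \<union> set (u # xs)) = span (S \<union> set (u # ys))" for S
    using sp[of "insert u S"] by simp
  ultimately show ?thesis using assms unfolding uequiv_def by auto
qed

lemma uequiv_append: "uequiv xs ys \<Longrightarrow> uequiv (us @ xs) (us @ ys)"
  by (induction us) (auto intro: uequiv_Cons)

lemma uequiv_add:
  assumes "c \<in> \<int>" shows "uequiv (x # u # us) ((x - c *\<^sub>R u) # u # us)"
proof -
  have "rcovol S (map h (x # u # us)) = rcovol S (map h ((x - c *\<^sub>R u) # u # us))"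
    if h: "linear h" for h :: "'a \<Rightarrow> 'a" and S
  proof -
    have "- (c *\<^sub>R h u) \<in> span (S \<union> set (map h (u # us)))"
      by (intro span_neg span_scale span_base) auto
    from infdist_span_add[OF this, of "h x"] show ?thesis
      by (simp add: linear_diff[OF h] linear_scale[OF h])
  qed
  moreover have "span (S \<union> set (x # u # us)) = span (S \<union> set ((x - c *\<^sub>R u) # u # us))" for S
  proof (intro antisym span_minimal)
    let ?B = "S \<union> set ((x - c *\<^sub>R u) # u # us)"
    have "(x - c *\<^sub>R u) + c *\<^sub>R u \<in> span ?B" by (intro span_add span_scale span_base) auto
    then show "S \<union> set (x # u # us) \<subseteq> span ?B" by (auto intro: span_base)
    have "x - c *\<^sub>R u \<in> span (S \<union> set (x # u # us))" by (intro span_diff span_scale span_base) auto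
    then show "?B \<subseteq> span (S \<union> set (x # u # us))" by (auto intro: span_base)
  qed auto
  ultimately show ?thesis using assms unfolding uequiv_def by (auto intro: intvec_diff intvec_scale)
qed

lemma uequiv_lindep: "uequiv xs ys \<Longrightarrow> lindep xs \<Longrightarrow> lindep ys"
  unfolding lindep_def using uequiv_span[of xs ys] dim_span by (metis uequiv_def)

text \<open>Euclid's algorithm on the integers \<open>\<phi> \<bullet> x\<close> and
  \<open>\<phi> \<bullet> u\<close>, carried out on the vectors themselves by subtracting multiples
  and swapping.\<close>

lemma uequiv_euclid:
  fixes \<phi> :: "'a::euclidean_space"
  assumes \<phi>: "intvec \<phi>"
  shows "intvec x \<Longrightarrow> intvec u \<Longrightarrow>
    \<exists>x' u'. uequiv (x # u # us) (x' # u' # us) \<and> \<phi> \<bullet> u' = 0"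
proof (induction "nat \<lfloor>\<bar>\<phi> \<bullet> u\<bar>\<rfloor>" arbitrary: x u rule: less_induct)
  case less
  show ?case
  proof (cases "\<phi> \<bullet> u = 0")
    case True
    then show ?thesis using uequiv_refl by blast
  next
    case False
    obtain a where a: "\<phi> \<bullet> x = of_int a" using intvec_inner[OF \<phi> less.prems(1)] by (elim Ints_cases)
    obtain b where b: "\<phi> \<bullet> u = of_int b" using intvec_inner[OF \<phi> less.prems(2)] by (elim Ints_cases)
    have b0: "b \<noteq> 0" using False b by auto
    define x1 where "x1 = x - of_int (a div b) *\<^sub>R u"
    have x1: "intvec x1" unfolding x1_def by (intro intvec_diff intvec_scale less.prems Ints_of_int)
    have "a mod b = a - a div b * b" by (simp add: minus_div_mult_eq_mod)
    then have "\<phi> \<bullet> x1 = of_int (a mod b)" by (simp add: x1_def inner_diff_right a b)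
    moreover have "\<bar>a mod b\<bar> < \<bar>b\<bar>" using b0 by (rule abs_mod_less)
    ultimately have "nat \<lfloor>\<bar>\<phi> \<bullet> x1\<bar>\<rfloor> < nat \<lfloor>\<bar>\<phi> \<bullet> u\<bar>\<rfloor>" by (simp add: b flip: of_int_abs)
    from less.hyps[OF this less.prems(2) x1] obtain x' u' where
      *: "uequiv (u # x1 # us) (x' # u' # us)" "\<phi> \<bullet> u' = 0" by blast
    have "uequiv (x # u # us) (x1 # u # us)" unfolding x1_def by (rule uequiv_add) simp
    moreover have "uequiv (x1 # u # us) (u # x1 # us)" by (rule uequiv_perm) simp
    ultimately show ?thesis using * uequiv_trans by blast
  qed
qed

text \<open>Euclid's algorithm applied along the list concentrates the functional \<phi> in a single
  vector.\<close>

lemma uequiv_kernel: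
  fixes \<phi> :: "'a::euclidean_space"
  assumes \<phi>: "intvec \<phi>"
  shows "xs \<noteq> [] \<Longrightarrow> \<forall>x\<in>set xs. intvec x \<Longrightarrow>
    \<exists>u us. uequiv xs (u # us) \<and> (\<forall>v\<in>set us. \<phi> \<bullet> v = 0)"
proof (induction xs)
  case (Cons x xs)
  show ?case
  proof (cases "xs = []")
    case True
    then show ?thesis using uequiv_refl[of "[x]"] by fastforce
  next
    case False
    then obtain u us where u: "uequiv xs (u # us)" "\<forall>v\<in>set us. \<phi> \<bullet> v = 0" using Cons by auto
    then have "intvec u" using Cons.prems by (auto simp: uequiv_def)
    then obtain x' u' where *: "uequiv (x # u # us) (x' # u' # us)" "\<phi> \<bullet> u' = 0"
      using uequiv_euclid[OF \<phi>, of x u us] Cons.prems by auto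
    then have "uequiv (x # xs) (x' # u' # us)" using u uequiv_Cons uequiv_trans by blast
    then show ?thesis using * u by (intro exI[of _ x'] exI[of _ "u' # us"]) auto
  qed
qed simp

text \<open>A lattice basis adapted to a rational subspace. For each functional in turn, the one
  vector that carries it, if it is nonzero there, goes to \<open>B\<close>; the vectors in the
  kernel are treated further.\<close>

lemma uequiv_adapted:
  fixes xs :: "'a::euclidean_space list"
  shows "\<forall>\<phi>\<in>set \<Phi>. intvec \<phi> \<Longrightarrow> \<forall>x\<in>set xs. intvec x \<Longrightarrow>
    \<exists>B A. uequiv xs (B @ A) \<and> span (set A) = span (set xs) \<inter> {v. \<forall>\<phi>\<in>set \<Phi>. \<phi> \<bullet> v = 0}"
proof (induction \<Phi> arbitrary: xs)
  case Nil
  show ?case using uequiv_refl[of xs] by (intro exI[of _ "[]"] exI[of _ xs]) auto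
next
  case (Cons \<phi> \<Phi>)
  have step: "\<exists>B A. uequiv xs (B @ A) \<and> span (set A) = span (set xs) \<inter> {v. \<phi> \<bullet> v = 0}"
  proof (cases "xs = []")
    case True
    then show ?thesis using uequiv_refl[of "[]"] by (intro exI[of _ "[]"]) auto
  next
    case False
    then obtain u us where u: "uequiv xs (u # us)" "\<forall>v\<in>set us. \<phi> \<bullet> v = 0"
      using uequiv_kernel[of \<phi> xs] Cons.prems by auto
    have sub: "span (set us) \<subseteq> {v. \<phi> \<bullet> v = 0}"
      using u by (intro span_minimal) (auto simp: subspace_hyperplane)
    show ?thesis
    proof (cases "\<phi> \<bullet> u = 0")
      case True
      then have "span (set (u # us)) \<subseteq> {v. \<phi> \<bullet> v = 0}"
        using u by (intro span_minimal) (auto simp: subspace_hyperplane)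
      then show ?thesis using u uequiv_span[OF u(1)]
        by (intro exI[of _ "[]"] exI[of _ "u # us"]) auto
    next
      case False
      have "v \<in> span (set us)" if v: "v \<in> span (set (u # us))" "\<phi> \<bullet> v = 0" for v
      proof -
        obtain k where k: "v - k *\<^sub>R u \<in> span (set us)" using v(1) by (auto simp: span_breakdown_eq)
        then have "\<phi> \<bullet> (v - k *\<^sub>R u) = 0" using sub by auto
        then have "k = 0" using v(2) False by (simp add: inner_diff_right)
        then show ?thesis using k by simp
      qed
      moreover have "span (set us) \<subseteq> span (set (u # us))" by (intro span_mono) auto
      ultimately show ?thesis using u sub uequiv_span[OF u(1)]
        by (intro exI[of _ "[u]"] exI[of _ us]) auto
    qed
  qed
  then obtain B A where BA: "uequiv xs (B @ A)" "span (set A) = span (set xs) \<inter> {v. \<phi> \<bullet> v = 0}" by blast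
  then have "\<forall>x\<in>set A. intvec x" using Cons.prems by (auto simp: uequiv_def)
  then obtain B' A' where *: "uequiv A (B' @ A')" 
    "span (set A') = span (set A) \<inter> {v. \<forall>\<phi>\<in>set \<Phi>. \<phi> \<bullet> v = 0}" using Cons.IH[of A] Cons.prems by auto
  have "uequiv xs ((B @ B') @ A')" using uequiv_trans[OF BA(1) uequiv_append[OF *(1)]] by simp
  then show ?case using * BA by (intro exI[of _ "B @ B'"] exI[of _ A']) auto
qed

text \<open>Elimination over the integers, turning a span into linear equations so that
  intersections can be handled by \<open>uequiv_adapted\<close>.\<close>

lemma span_integer_kernel:
  fixes us :: "'a::euclidean_space list"
  shows "\<forall>u\<in>set us. intvec u \<Longrightarrow>
    \<exists>\<Phi>. (\<forall>\<phi>\<in>set \<Phi>. intvec \<phi>) \<and> span (set us) = {v. \<forall>\<phi>\<in>set \<Phi>. \<phi> \<bullet> v = 0}"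
proof (induction us)
  case Nil
  obtain bs where "set bs = (Basis :: 'a set)" using finite_list[OF finite_Basis] by blast
  moreover have "{v. \<forall>\<phi>\<in>Basis. \<phi> \<bullet> v = 0} = {0::'a}"
    by (auto simp: euclidean_all_zero_iff inner_commute intro: euclidean_eqI)
  ultimately show ?case by (intro exI[of _ bs]) (auto simp: intvec_Basis)
next
  case (Cons u us)
  then obtain \<Phi> where \<Phi>: "\<forall>\<phi>\<in>set \<Phi>. intvec \<phi>" "span (set us) = {v. \<forall>\<phi>\<in>set \<Phi>. \<phi> \<bullet> v = 0}" by auto
  show ?case
  proof (cases "u \<in> span (set us)")
    case True
    then have "span (set (u # us)) = span (set us)" by (simp add: span_redundant)
    then show ?thesis using \<Phi> by (intro exI[of _ \<Phi>]) auto
  next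
    case False
    then obtain \<psi> where \<psi>: "\<psi> \<in> set \<Phi>" "\<psi> \<bullet> u \<noteq> 0" using \<Phi> by auto
    \<comment> \<open>With \<psi> as pivot, every functional is corrected by a multiple of \<psi> so
      that it vanishes on \<open>u\<close>; cross-multiplication instead of division keeps the
      coefficients integral.\<close>
    define \<Psi> where "\<Psi> = map (\<lambda>\<phi>. (\<psi> \<bullet> u) *\<^sub>R \<phi> - (\<phi> \<bullet> u) *\<^sub>R \<psi>) \<Phi>"
    have "v \<in> span (set (u # us)) \<longleftrightarrow> (\<forall>\<phi>\<in>set \<Psi>. \<phi> \<bullet> v = 0)" for v
    proof
      assume "v \<in> span (set (u # us))"
      then obtain k where k: "v - k *\<^sub>R u \<in> span (set us)" by (auto simp: span_breakdown_eq)
      then have "\<phi> \<bullet> v = k * (\<phi> \<bullet> u)" if "\<phi> \<in> set \<Phi>" for \<phi>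
        using \<Phi>(2) that by (auto simp: inner_diff_right)
      then show "\<forall>\<phi>\<in>set \<Psi>. \<phi> \<bullet> v = 0" using \<psi> by (auto simp: \<Psi>_def inner_diff_left)
    next
      assume *: "\<forall>\<phi>\<in>set \<Psi>. \<phi> \<bullet> v = 0"
      define s where "s = (\<psi> \<bullet> v) / (\<psi> \<bullet> u)"
      have "\<phi> \<bullet> (v - s *\<^sub>R u) = 0" if "\<phi> \<in> set \<Phi>" for \<phi>
        using * that \<psi> by (auto simp: \<Psi>_def inner_diff_left inner_diff_right s_def field_simps)
      then have "v - s *\<^sub>R u \<in> span (set us)" using \<Phi> by auto
      then show "v \<in> span (set (u # us))" by (auto simp: span_breakdown_eq)
    qed
    moreover have "\<forall>\<phi>\<in>set \<Psi>. intvec \<phi>" using \<Phi>(1) \<psi>(1) Cons.prems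
      by (auto simp: \<Psi>_def intro!: intvec_diff intvec_scale intvec_inner)
    ultimately show ?thesis by (intro exI[of _ \<Psi>]) auto
  qed
qed

text \<open>After a unimodular change a coordinate functional \<open>b\<close> vanishes on all
  vectors but one, where it is a nonzero integer. The distance of that vector to the span of the
  others is then at least 1, and induction handles the rest.\<close>

lemma rcovol_integer_ge_1:
  fixes vs :: "'a::euclidean_space list"
  shows "\<forall>v\<in>set vs. intvec v \<Longrightarrow> lindep vs \<Longrightarrow> 1 \<le> rcovol {} vs"
proof (induction "length vs" arbitrary: vs)
  case (Suc n)
  then have "vs \<noteq> []" by auto
  then have "hd vs \<noteq> 0" using Suc.prems(2) span_zero by (cases vs) (auto simp: lindep_Cons)
  then obtain b where b: "b \<in> Basis" "b \<bullet> hd vs \<noteq> 0"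
    using euclidean_all_zero_iff[of "hd vs"] by (auto simp: inner_commute)
  obtain u us where u: "uequiv vs (u # us)" "\<forall>v\<in>set us. b \<bullet> v = 0"
    using uequiv_kernel[OF intvec_Basis[OF b(1)] \<open>vs \<noteq> []\<close>] Suc.prems by blast
  have us: "span (set us) \<subseteq> {v. b \<bullet> v = 0}"
    using u by (intro span_minimal) (auto simp: subspace_hyperplane)
  have "hd vs \<in> span (set (u # us))" using uequiv_span[OF u(1)] \<open>vs \<noteq> []\<close> span_base[of "hd vs" "set vs"] by auto
  then obtain k where "hd vs - k *\<^sub>R u \<in> span (set us)" by (auto simp: span_breakdown_eq)
  then have "b \<bullet> (hd vs - k *\<^sub>R u) = 0" using us by auto
  then have bu: "b \<bullet> u \<noteq> 0" using b by (auto simp: inner_diff_right)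
  have iu: "intvec u" "\<forall>v\<in>set us. intvec v" using u(1) Suc.prems(1) by (auto simp: uequiv_def)
  have "1 \<le> \<bar>b \<bullet> u\<bar>" using intvec_inner[OF intvec_Basis[OF b(1)] iu(1)] bu by (auto elim!: Ints_cases)
  have ne: "span (set us) \<noteq> {}" using span_zero by blast
  then obtain y where y: "y \<in> span (set us)" "infdist u (span (set us)) = dist u y"
    using infdist_attains_inf[of "span (set us)" u] closed_span by metis
  have "1 \<le> \<bar>b \<bullet> (u - y)\<bar>" using us y(1) \<open>1 \<le> \<bar>b \<bullet> u\<bar>\<close> by (auto simp: inner_diff_right)
  also have "\<dots> \<le> dist u y" using Cauchy_Schwarz_ineq2[of b "u - y"] b by (simp add: dist_norm)
  finally have d: "1 \<le> infdist u (span (set us))" using y by simp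
  have li: "lindep (u # us)" using uequiv_lindep[OF u(1)] Suc.prems(2) .
  have "length vs = length (u # us)" using u(1) by (simp add: uequiv_def)
  then have "1 \<le> rcovol {} us" using Suc.hyps iu li by (intro Suc.hyps(1)) (auto simp: lindep_Cons)
  moreover have "rcovol {} vs = rcovol {} (u # us)"
    using u(1) unfolding uequiv_def by (metis linear_id list.map_id)
  ultimately show ?case using d mult_mono[of 1 "infdist u (span (set us))" 1 "rcovol {} us"] by simp
qed simp

text \<open>The factor contributed by \<open>B\<close> and \<open>C\<close> depends only on the span of what follows them, so the
  smaller of the two bases found for the intersection can be used on both sides.\<close>
lemma rcovol_submodular:
  fixes g :: "'a::euclidean_space \<Rightarrow> 'a"
  assumes g: "linear g"
    and vs: "\<forall>v\<in>set vs. intvec v" "lindep vs"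
    and us: "\<forall>u\<in>set us. intvec u" "lindep us"
    and len: "length vs = length us" and ne: "span (set vs) \<noteq> span (set us)"
  obtains as es j where
    "\<forall>a\<in>set as. intvec a" "lindep as" "\<forall>e\<in>set es. intvec e" "lindep es"
    "0 < j" "length as + j = length vs" "length es = length vs + j"
    "rcovol {} (map g as) * rcovol {} (map g es) \<le> rcovol {} (map g vs) * rcovol {} (map g us)"
proof -
  note result = that
  define W1 W2 where "W1 = span (set vs)" and "W2 = span (set us)"
  obtain \<Phi>1 where \<Phi>1: "\<forall>\<phi>\<in>set \<Phi>1. intvec \<phi>" "W1 = {v. \<forall>\<phi>\<in>set \<Phi>1. \<phi> \<bullet> v = 0}"
    using span_integer_kernel[OF vs(1)] W1_def by blast
  obtain \<Phi>2 where \<Phi>2: "\<forall>\<phi>\<in>set \<Phi>2. intvec \<phi>" "W2 = {v. \<forall>\<phi>\<in>set \<Phi>2. \<phi> \<bullet> v = 0}"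
    using span_integer_kernel[OF us(1)] W2_def by blast
  obtain B A where B: "uequiv vs (B @ A)" "span (set A) = W1 \<inter> W2"
    using uequiv_adapted[OF \<Phi>2(1) vs(1)] unfolding W1_def \<Phi>2(2) by blast
  obtain C A' where C: "uequiv us (C @ A')" "span (set A') = W2 \<inter> W1"
    using uequiv_adapted[OF \<Phi>1(1) us(1)] unfolding W2_def \<Phi>1(2) by blast
  have iB: "\<forall>v\<in>set (B @ A). intvec v" and iC: "\<forall>v\<in>set (C @ A'). intvec v"
    using B(1) C(1) vs us by (auto simp: uequiv_def)
  have lB: "lindep (B @ A)" "lindep A" and lC: "lindep (C @ A')" "lindep A'"
    using uequiv_lindep[OF B(1) vs(2)] uequiv_lindep[OF C(1) us(2)] lindep_append by auto
  have lenB: "length vs = length B + length A" "length us = length C + length A'"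
    using B(1) C(1) by (simp_all add: uequiv_def)
  \<comment> \<open>Same subspace, but possibly different lattices in it, because \<open>vs\<close>
    and \<open>us\<close> need not be primitive; the covolumes of \<open>A\<close> and
    \<open>A'\<close> may therefore differ.\<close>
  have AA: "span (set A) = span (set A')" unfolding B(2) C(2) by (rule Int_commute)
  have lenA: "length A = length A'" using lB(2) lC(2) AA dim_span[of "set A"] dim_span[of "set A'"] by (simp add: lindep_def)
  have "length A \<noteq> length vs"
  proof
    assume "length A = length vs"
    then have "B = []" "C = []" using lenB lenA len by auto
    then have "span (set vs) = span (set A)" "span (set us) = span (set A')"
      using uequiv_span[OF B(1)] uequiv_span[OF C(1)] by simp_all
    then show False using ne AA by simp
  qed
  then have jpos: "0 < length B" using lenB by auto
  have gB: "rcovol {} (map g vs) = rcovol (g ` set A) (map g B) * rcovol {} (map g A)"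
    using B(1) g by (simp add: uequiv_def rcovol_append)
  have gC: "rcovol {} (map g us) = rcovol (g ` set A') (map g C) * rcovol {} (map g A')"
    using C(1) g by (simp add: uequiv_def rcovol_append)
  have gA: "span (g ` set A) = span (g ` set A')" by (rule span_image_cong[OF g AA])
  have main: ?thesis if A'': "A'' \<in> {A, A'}"
    and le: "rcovol {} (map g A'') * rcovol {} (map g A'') \<le> rcovol {} (map g A) * rcovol {} (map g A')" for A''
  proof -
    have sA'': "span (set A'') = W1 \<inter> W2" "span (g ` set A'') = span (g ` set A)"
       "span (g ` set A'') = span (g ` set A')" and lA'': "length A'' = length A" "lindep A''" 
       "\<forall>v\<in>set A''. intvec v"
      using A'' B C gA lenA lB lC iB iC by auto
    \<comment> \<open>This list spans \<open>W1 + W2\<close>, and the dimension formula for sums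
      then forces it to be independent.\<close>
    define es where "es = B @ C @ A''"
    have spW1: "span (set (B @ A'')) = W1"
      using uequiv_span[OF B(1)] W1_def sA''(1) B(2) by (simp add: span_Un)
    have spW2: "span (set (C @ A'')) = W2"
      using uequiv_span[OF C(1)] W2_def sA''(1) C(2) by (simp add: span_Un Int_commute)
    have "set es = set (B @ A'') \<union> set (C @ A'')" by (auto simp: es_def)
    then have sp: "span (set es) = {x + y |x y. x \<in> W1 \<and> y \<in> W2}"
      by (simp only: span_Un spW1 spW2)
    have d: "dim (set es) = dim {x + y |x y. x \<in> W1 \<and> y \<in> W2}"
      unfolding sp[symmetric] by (rule dim_span[symmetric])
    have "dim {x + y |x y. x \<in> W1 \<and> y \<in> W2} + dim (W1 \<inter> W2) = dim W1 + dim W2"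
      by (rule dim_sums_Int) (simp_all add: W1_def W2_def)
    moreover have "dim W1 = length vs" using vs(2) by (simp add: W1_def lindep_def)
    moreover have "dim W2 = length us" using us(2) by (simp add: W2_def lindep_def)
    moreover have "dim (W1 \<inter> W2) = length A" using lB(2) by (simp add: lindep_def flip: B(2))
    ultimately have "dim (set es) + length A = length vs + length us" using d by linarith
    then have les: "lindep es" unfolding lindep_def es_def using lenB lA'' len lenA by simp
    have R1: "rcovol (set (map g C) \<union> g ` set A'') (map g B) \<le> rcovol (g ` set A) (map g B)"
    proof (rule rcovol_antimono)
      have "g ` set A \<subseteq> span (g ` set A'')" unfolding sA''(2) by (rule span_superset)
      then show "g ` set A \<subseteq> span (set (map g C) \<union> g ` set A'')"
        using span_mono[of "g ` set A''" "set (map g C) \<union> g ` set A''"] by blast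
    qed
    have R2: "rcovol (g ` set A'') (map g C) = rcovol (g ` set A') (map g C)"
      by (rule rcovol_cong) (rule sA'')
    have "rcovol {} (map g es) = rcovol (set (map g C) \<union> g ` set A'') (map g B) *
       (rcovol (g ` set A'') (map g C) * rcovol {} (map g A''))"
      by (simp add: es_def rcovol_append)
    also have "\<dots> \<le> rcovol (g ` set A) (map g B) * (rcovol (g ` set A') (map g C) * rcovol {} (map g A''))"
      unfolding R2 by (intro mult_right_mono R1 mult_nonneg_nonneg rcovol_nonneg)
    finally have "rcovol {} (map g A'') * rcovol {} (map g es) \<le> 
       rcovol {} (map g A'') * (rcovol (g ` set A) (map g B) * (rcovol (g ` set A') (map g C) * rcovol {} (map g A'')))"
      by (intro mult_left_mono rcovol_nonneg)
    also have "\<dots> = (rcovol (g ` set A) (map g B) * rcovol (g ` set A') (map g C)) * (rcovol {} (map g A'') * rcovol {} (map g A''))"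
      by simp
    also have "\<dots> \<le> (rcovol (g ` set A) (map g B) * rcovol (g ` set A') (map g C)) * (rcovol {} (map g A) * rcovol {} (map g A'))"
      by (intro mult_left_mono le mult_nonneg_nonneg rcovol_nonneg)
    also have "\<dots> = rcovol {} (map g vs) * rcovol {} (map g us)" unfolding gB gC by simp
    finally show ?thesis
      using lA'' les iB iC jpos lenB lenA len by (intro result[of A'' es "length B"]) (auto simp: es_def)
  qed
  show ?thesis
  proof (cases "rcovol {} (map g A) \<le> rcovol {} (map g A')")
    case True
    then show ?thesis by (intro main[of A]) (auto intro!: mult_left_mono rcovol_nonneg)
  next
    case False
    then show ?thesis by (intro main[of A']) (auto intro!: mult_right_mono rcovol_nonneg)
  qed
qed

section \<open>The flow on lattices and the Dani correspondence\<close>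

lemma norm_matrix_vector_mult_le: "norm (b *v y) \<le> norm b * norm (y :: real ^ 'n)" for b :: "real ^ 'n ^ 'm"
proof -
  have "norm (b *v y) = L2_set (\<lambda>i. \<bar>b $ i \<bullet> y\<bar>) UNIV"
    by (simp add: norm_vec_def matrix_vector_mul_component)
  also have "\<dots> \<le> L2_set (\<lambda>i. norm (b $ i) * norm y) UNIV"
    by (intro L2_set_mono) (auto intro: Cauchy_Schwarz_ineq2)
  also have "\<dots> = norm b * norm y" by (simp add: norm_vec_def L2_set_left_distrib)
  finally show ?thesis .
qed

lemma norm_fst_prod_le: "norm (fst v) \<le> norm v"
  using norm_fst_le[of "fst v" "snd v"] by simp

lemma norm_snd_prod_le: "norm (snd v) \<le> norm v"
  using norm_snd_le[of "snd v" "fst v"] by simp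

definition shear :: "real ^ 'n ^ 'm \<Rightarrow> (real ^ 'm) \<times> (real ^ 'n) \<Rightarrow> real ^ 'm" where
  "shear b v = fst v + b *v snd v"

text \<open>The composition \<open>g\<^sub>t u\<^sub>b\<close> of the Dani correspondence, for \<open>X = exp (t / M)\<close> and \<open>Y = exp (- t / N)\<close>.\<close>
definition flow :: "real \<Rightarrow> real \<Rightarrow> real ^ 'n ^ 'm \<Rightarrow> (real ^ 'm) \<times> (real ^ 'n) \<Rightarrow> (real ^ 'm) \<times> (real ^ 'n)" where
  "flow X Y b v = (X *\<^sub>R shear b v, Y *\<^sub>R snd v)"

lemma linear_shear: "linear (shear b)"
  by (rule linearI) (simp_all add: shear_def matrix_vector_right_distrib scaleR_matrix_vector_assoc
    matrix_vector_mult_scaleR scaleR_add_right)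

lemma linear_flow: "linear (flow X Y b)"
  using linear_shear[of b] by (intro linearI) (simp_all add: flow_def linear_add linear_scale scaleR_add_right)

text \<open>The renormalisation identity: after the flow by \<open>X'\<close>, \<open>Y'\<close>, a
  change of the matrix by \<open>Y' / X'\<close> times \<open>b\<close> acts like a fresh shear by
  \<open>b\<close>. One stage of the construction can thus be analysed at unit scale.\<close>

lemma flow_flow:
  assumes "X' \<noteq> 0"
  shows "flow X Y b (flow X' Y' c v) = flow (X * X') (Y * Y') (c + (Y' / X') *\<^sub>R b) v"
  using assms by (simp add: flow_def shear_def matrix_vector_mult_add_rdistrib scaleR_add_right
    matrix_vector_mult_scaleR scaleR_matrix_vector_assoc[symmetric] mult.assoc)

lemma norm_shear_diff_le: "norm (shear b v - shear c v) \<le> norm (b - c) * norm (snd v)"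
  using norm_matrix_vector_mult_le[of "b - c" "snd v"] by (simp add: shear_def matrix_vector_mult_diff_rdistrib)

text \<open>The worst loss in one stage: the flow shrinks by at most \<open>Y\<close>, and undoing
  the shear costs a factor bounded in terms of \<open>R\<close>.\<close>

lemma flow_norm_ge:
  assumes "norm b \<le> R" "0 < Y" "Y \<le> X"
  shows "Y / (2 + R) * norm v \<le> norm (flow X Y b v)"
proof -
  have R: "0 \<le> R" using assms(1) norm_ge_zero order_trans by blast
  let ?n = "norm (flow X Y b v)"
  have 1: "Y * norm (snd v) \<le> ?n" using norm_snd_prod_le[of "flow X Y b v"] assms by (simp add: flow_def)
  have "Y * norm (shear b v) \<le> X * norm (shear b v)" using assms by (intro mult_right_mono) auto
  also have "\<dots> \<le> ?n" using norm_fst_prod_le[of "flow X Y b v"] assms by (simp add: flow_def)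
  finally have 2: "Y * norm (shear b v) \<le> ?n" .
  have "norm (fst v) \<le> norm (shear b v) + norm (b *v snd v)"
    using norm_triangle_ineq4[of "shear b v" "b *v snd v"] by (simp add: shear_def)
  also have "norm (b *v snd v) \<le> R * norm (snd v)"
    using norm_matrix_vector_mult_le[of b "snd v"] mult_right_mono[OF assms(1), of "norm (snd v)"] by simp
  finally have "Y * norm (fst v) \<le> Y * (norm (shear b v) + R * norm (snd v))" using assms by simp
  also have "\<dots> \<le> ?n + R * ?n" using 2 mult_left_mono[OF 1 R] by (simp add: algebra_simps)
  finally have "Y * norm v \<le> ?n + R * ?n + ?n"
    using norm_Pair_le[of "fst v" "snd v"] mult_left_mono[of "norm v" "norm (fst v) + norm (snd v)" Y] 1 assms
    by (simp add: algebra_simps)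
  then show ?thesis using R by (simp add: field_simps)
qed

lemma flow_rcovol_ge_small:
  assumes "0 \<le> X" "0 \<le> \<delta>" "\<And>v. v \<in> span (set vs) \<Longrightarrow> \<delta> * norm v \<le> norm (shear b v)"
  shows "(X * \<delta>) ^ length vs * rcovol {} vs \<le> rcovol {} (map (flow X Y b) vs)"
proof (rule rcovol_linear_ge[OF linear_flow])
  fix v assume "v \<in> span (set vs)"
  then have "X * (\<delta> * norm v) \<le> X * norm (shear b v)" using assms by (intro mult_left_mono) auto
  also have "\<dots> \<le> norm (flow X Y b v)" using norm_fst_prod_le[of "flow X Y b v"] assms by (simp add: flow_def)
  finally show "X * \<delta> * norm v \<le> norm (flow X Y b v)" by simp
qed (use assms in auto)

text \<open>\<open>shear b\<close> maps \<open>F\<close> isomorphically onto its target space, so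
  the span of \<open>vs\<close> is the direct sum of \<open>F\<close> and the kernel of
  \<open>shear b\<close> in it. \<open>F\<close> contributes an expansion by
  \<open>X * \<delta>\<close> in each direction even modulo the image of the kernel; on the kernel
  the second component controls the norm and only \<open>Y / (1 + R)\<close> is lost.\<close>

lemma flow_rcovol_ge_large:
  fixes b :: "real ^ 'n ^ 'm"
  assumes "0 \<le> X" "0 < \<delta>" "0 \<le> Y" "norm b \<le> R"
    and F: "subspace F" "dim F = CARD('m)" "F \<subseteq> span (set vs)"
    and \<delta>: "\<And>v. v \<in> F \<Longrightarrow> \<delta> * norm v \<le> norm (shear b v)"
    and vs: "lindep vs"
  shows "(X * \<delta>) ^ CARD('m) * (Y / (1 + R)) ^ (length vs - CARD('m)) * rcovol {} vs
    \<le> rcovol {} (map (flow X Y b) vs)"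
proof -
  have R: "0 \<le> R" using assms(4) norm_ge_zero order_trans by blast
  define W where "W = span (set vs)"
  define K where "K = W \<inter> {v. shear b v = 0}"
  have sK: "subspace K" unfolding K_def W_def
    using linear_shear[of b] by (intro subspace_inter subspace_span linear_subspace_kernel)
  obtain fs where fs: "lindep fs" "span (set fs) = F" "length fs = CARD('m)"
    using exists_lindep_list[OF F(1)] F(2) by metis
  obtain ks where ks: "lindep ks" "span (set ks) = K" "length ks = dim K"
    using exists_lindep_list[OF sK] by metis
  have inj: "inj_on (shear b) F"
  proof (rule inj_onI)
    fix x y assume "x \<in> F" "y \<in> F" "shear b x = shear b y"
    then have "x - y \<in> F" "shear b (x - y) = 0"
      using F(1) linear_diff[OF linear_shear, of b] by (auto intro: subspace_diff)
    then have "\<delta> * norm (x - y) \<le> 0" using \<delta> by fastforce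
    then show "x = y" using \<open>0 < \<delta>\<close> by (simp add: mult_le_0_iff)
  qed
  have "dim (shear b ` F) = CARD('m)"
    using dim_image_eq[OF linear_shear, of b F] inj F span_eq_iff by (metis)
  then have surj: "shear b ` F = UNIV"
    using dim_eq_full[of "shear b ` F"] span_eq_iff[of "shear b ` F"] linear_subspace_image[OF linear_shear F(1), of b]
    by simp
  have sum: "W = {x + y |x y. x \<in> F \<and> y \<in> K}"
  proof (intro equalityI subsetI)
    fix w assume w: "w \<in> W"
    obtain f where f: "f \<in> F" "shear b w = shear b f" using surj by (metis UNIV_I imageE)
    then have "w - f \<in> K" using w F(3) linear_diff[OF linear_shear, of b] by (auto simp: K_def W_def intro: span_diff)
    moreover have "w = f + (w - f)" by simp
    ultimately show "w \<in> {x + y |x y. x \<in> F \<and> y \<in> K}" using f(1) by blast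
  next
    fix w assume "w \<in> {x + y |x y. x \<in> F \<and> y \<in> K}"
    then obtain x y where "w = x + y" "x \<in> W" "y \<in> W" using F(3) by (auto simp: K_def W_def)
    then show "w \<in> W" by (simp add: W_def span_add)
  qed
  have "F \<inter> K = {0}"
  proof -
    have "v = 0" if "v \<in> F \<inter> K" for v
      using \<delta>[of v] that \<open>0 < \<delta>\<close> by (auto simp: K_def mult_le_0_iff)
    then show ?thesis using F(1) sK subspace_0 by auto
  qed
  then have "dim W = CARD('m) + dim K" using dim_sums_Int[OF F(1) sK] F(2) sum by simp
  then have len: "length vs = length (fs @ ks)" using vs fs ks by (simp add: W_def lindep_def)
  have spW: "span (set vs) = span (set (fs @ ks))"
    using sum fs(2) ks(2) by (simp add: span_Un W_def)
  have lfk: "lindep (fs @ ks)" using vs len spW dim_span unfolding lindep_def by metis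
  let ?h = "flow X Y b"
  have "(X * \<delta>) ^ CARD('m) * rcovol {} fs \<le> rcovol {} (map (\<lambda>v. X *\<^sub>R shear b v) fs)"
    unfolding fs(3)[symmetric]
  proof (rule rcovol_linear_ge)
    show "linear (\<lambda>v. X *\<^sub>R shear b v)" by (intro linear_compose_scale_right linear_shear)
    fix v assume "v \<in> span (set fs)"
    then have "X * (\<delta> * norm v) \<le> X * norm (shear b v)" using assms fs by (intro mult_left_mono) auto
    then show "X * \<delta> * norm v \<le> norm (X *\<^sub>R shear b v)" using assms by simp
  qed (use assms in auto)
  \<comment> \<open>The projection \<open>fst\<close> kills the image of \<open>ks\<close> and does
    not increase norms, so it bounds the covolume modulo that image from below.\<close>
  also have "\<dots> = rcovol (fst ` (?h ` set ks)) (map fst (map ?h fs))"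
  proof -
    have "shear b v = 0" if "v \<in> set ks" for v
      using span_base[OF that] unfolding ks(2) by (simp add: K_def)
    then have "fst ` (?h ` set ks) \<subseteq> {0}" by (auto simp: flow_def)
    then have "span (fst ` (?h ` set ks)) = span {}" by (auto simp: subset_singleton_iff)
    then show ?thesis by (simp add: rcovol_cong flow_def comp_def)
  qed
  also have "\<dots> \<le> rcovol (?h ` set ks) (map ?h fs)"
    by (intro rcovol_linear_le linear_fst norm_fst_prod_le)
  finally have 1: "(X * \<delta>) ^ CARD('m) * rcovol {} fs \<le> rcovol (?h ` set ks) (map ?h fs)" .
  have 2: "(Y / (1 + R)) ^ length ks * rcovol {} ks \<le> rcovol {} (map ?h ks)"
  proof (rule rcovol_linear_ge[OF linear_flow])
    fix v assume "v \<in> span (set ks)"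
    then have "shear b v = 0" using ks by (auto simp: K_def)
    then have "fst v = - (b *v snd v)" by (simp add: shear_def eq_neg_iff_add_eq_0)
    then have "norm (fst v) \<le> R * norm (snd v)"
      using norm_matrix_vector_mult_le[of b "snd v"] mult_right_mono[OF assms(4), of "norm (snd v)"] by simp
    then have "norm v \<le> (1 + R) * norm (snd v)"
      using norm_Pair_le[of "fst v" "snd v"] by (simp add: algebra_simps)
    then have "Y * norm v \<le> Y * ((1 + R) * norm (snd v))" using assms by (intro mult_left_mono)
    also have "\<dots> \<le> (1 + R) * norm (?h v)" 
      using norm_snd_prod_le[of "?h v"] R assms mult_left_mono[of "Y * norm (snd v)" "norm (?h v)" "1 + R"]
      by (simp add: flow_def algebra_simps)
    finally show "Y / (1 + R) * norm v \<le> norm (?h v)" using R by (simp add: field_simps)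
  qed (use assms R in auto)
  have 3: "rcovol {} (fs @ ks) \<le> rcovol {} fs * rcovol {} ks"
    by (simp add: rcovol_append rcovol_antimono mult_right_mono rcovol_nonneg)
  define a where "a = (X * \<delta>) ^ CARD('m) * (Y / (1 + R)) ^ length ks"
  have a: "0 \<le> a" using assms R by (simp add: a_def)
  have "a * rcovol {} (fs @ ks) \<le> a * (rcovol {} fs * rcovol {} ks)" using 3 a by (rule mult_left_mono)
  also have "\<dots> = ((X * \<delta>) ^ CARD('m) * rcovol {} fs) * ((Y / (1 + R)) ^ length ks * rcovol {} ks)"
    by (simp add: a_def)
  also have "\<dots> \<le> rcovol (?h ` set ks) (map ?h fs) * rcovol {} (map ?h ks)"
    using 1 2 assms R by (intro mult_mono) (auto intro!: mult_nonneg_nonneg rcovol_nonneg)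
  also have "\<dots> = rcovol {} (map ?h (fs @ ks))" by (simp add: rcovol_append)
  \<comment> \<open>The list \<open>fs @ ks\<close> spans the same space as \<open>vs\<close> but
    need not be integral; \<open>rcovol_ratio\<close> transfers the factor to
    \<open>vs\<close>.\<close>
  finally have "a * rcovol {} (fs @ ks) * rcovol {} vs \<le> rcovol {} (map ?h (fs @ ks)) * rcovol {} vs"
    by (intro mult_right_mono rcovol_nonneg)
  also have "\<dots> = rcovol {} (map ?h vs) * rcovol {} (fs @ ks)"
    using rcovol_ratio[OF linear_flow len, of "{}" X Y b] spW by simp
  finally have "a * rcovol {} vs \<le> rcovol {} (map ?h vs)"
    using rcovol_pos[OF lfk] by (simp add: ac_simps)
  then show ?thesis using len fs(3) by (simp add: a_def)
qed

section \<open>Thick lattices and one stage of the construction\<close>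

lemma rcovol_pos_imp_lindep: "0 < rcovol {} vs \<Longrightarrow> lindep vs"
proof (induction vs)
  case (Cons v vs)
  then have "infdist v (span (set vs)) \<noteq> 0" "rcovol {} vs \<noteq> 0" by auto
  then show ?case using Cons.IH rcovol_nonneg[of "{}" vs] infdist_span_eq_0[of v "set vs"]
    by (auto simp: lindep_Cons)
qed (simp add: lindep_Nil)

text \<open>All ranks are controlled at once so that submodularity can be applied; for the final
  conclusion rank 1 says that nonzero lattice vectors stay long. Non-primitive lists are included,
  which spares a notion of primitivity.\<close>

definition thick :: "(nat \<Rightarrow> real) \<Rightarrow> ('a::euclidean_space \<Rightarrow> 'a) \<Rightarrow> bool" where
  "thick m G \<longleftrightarrow> (\<forall>vs. (\<forall>v\<in>set vs. intvec v) \<longrightarrow> lindep vs \<longrightarrow> m (length vs) \<le> rcovol {} (map G vs))"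

text \<open>The logarithm is a convex quadratic in \<open>i\<close> with value \<open>- T\<close> at
  both 0 and \<open>d\<close>. Moving from \<open>i\<close> to \<open>i - j\<close> and
  \<open>i + j\<close> multiplies the product of two values by
  \<open>exp (2 * \<eta> * j * j)\<close>.\<close>

definition profile :: "real \<Rightarrow> real \<Rightarrow> nat \<Rightarrow> nat \<Rightarrow> real" where
  "profile T \<eta> d i = exp (- T - \<eta> * (real i * (real d - real i)))"

lemma profile_pos: "0 < profile T \<eta> d i"
  by (simp add: profile_def)

text \<open>The profile is strictly log-convex with a gap governed by \<open>\<eta>\<close>, which leaves room for at most one
  rational subspace of each dimension that is almost too small.\<close>
lemma small_span_unique:
  fixes G :: "'a::euclidean_space \<Rightarrow> 'a"
  assumes G: "linear G" "thick (profile T \<eta> d) G" and "0 \<le> \<eta>"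
    and vs: "\<forall>v\<in>set vs. intvec v" "lindep vs" "rcovol {} (map G vs) < exp \<eta> * profile T \<eta> d (length vs)"
    and us: "\<forall>v\<in>set us. intvec v" "lindep us" "rcovol {} (map G us) < exp \<eta> * profile T \<eta> d (length us)"
    and len: "length vs = length us"
  shows "span (set vs) = span (set us)"
proof (rule ccontr)
  assume "span (set vs) \<noteq> span (set us)"
  then obtain as es j where *: "\<forall>a\<in>set as. intvec a" "lindep as" "\<forall>e\<in>set es. intvec e" "lindep es"
    "0 < j" "length as + j = length vs" "length es = length vs + j"
    "rcovol {} (map G as) * rcovol {} (map G es) \<le> rcovol {} (map G vs) * rcovol {} (map G us)"
    using rcovol_submodular[OF G(1) vs(1,2) us(1,2) len] by metis
  define i where "i = length vs"
  have las: "real (length as) = real i - real j" "real (length es) = real i + real j"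
    using *(6,7) by (simp_all add: i_def)
  have j: "1 \<le> real j * real j" using *(5) mult_mono[of 1 "real j" 1 "real j"] by simp
  \<comment> \<open>The gap in the exponent is twice \<eta> times the square of \<open>j\<close>,
    and \<open>j\<close> is at least 1.\<close>
  have "exp (2 * \<eta>) * (profile T \<eta> d i * profile T \<eta> d i) =
     exp (2 * \<eta> + (- T - \<eta> * (real i * (real d - real i))) + (- T - \<eta> * (real i * (real d - real i))))"
    by (simp only: profile_def exp_add mult.assoc)
  also have "\<dots> \<le> exp ((- T - \<eta> * ((real i - real j) * (real d - (real i - real j)))) +
     (- T - \<eta> * ((real i + real j) * (real d - (real i + real j)))))"
  proof (subst exp_le_cancel_iff)
    have "\<eta> * 1 \<le> \<eta> * (real j * real j)" using j \<open>0 \<le> \<eta>\<close> by (intro mult_left_mono)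
    then show "2 * \<eta> + (- T - \<eta> * (real i * (real d - real i))) + (- T - \<eta> * (real i * (real d - real i)))
      \<le> (- T - \<eta> * ((real i - real j) * (real d - (real i - real j)))) +
     (- T - \<eta> * ((real i + real j) * (real d - (real i + real j))))"
      by (simp add: algebra_simps)
  qed
  also have "\<dots> = profile T \<eta> d (length as) * profile T \<eta> d (length es)"
    unfolding profile_def las exp_add ..
  also have "\<dots> \<le> rcovol {} (map G as) * rcovol {} (map G es)"
    using G(2) * by (intro mult_mono) (auto simp: thick_def rcovol_nonneg less_imp_le[OF profile_pos])
  also have "\<dots> \<le> rcovol {} (map G vs) * rcovol {} (map G us)" by fact
  also have "\<dots> < (exp \<eta> * profile T \<eta> d i) * (exp \<eta> * profile T \<eta> d i)"
    using vs us len by (intro mult_strict_mono') (auto simp: i_def rcovol_nonneg)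
  also have "\<dots> = exp (2 * \<eta>) * (profile T \<eta> d i * profile T \<eta> d i)"
    by (simp add: exp_double power2_eq_square)
  finally show False by simp
qed

text \<open>The subspaces \<open>F i\<close> depend on \<open>G\<close> alone and are fixed before
  \<open>b\<close>, so that later the fraction of bad \<open>b\<close> can be counted. A subspace
  with reserve \<open>exp \<eta>\<close> above the profile survives even the worst contraction; the
  at most one without reserve is expanded because its part \<open>F i\<close> is. Rank
  \<open>d\<close> has nothing to gain and enters as a separate assumption.\<close>

lemma thick_step:
  fixes G :: "(real ^ 'm) \<times> (real ^ 'n) \<Rightarrow> (real ^ 'm) \<times> (real ^ 'n)"
  defines "d \<equiv> CARD('m) + CARD('n)"
  assumes G: "linear G" "thick (profile T \<eta> d) G" and "0 \<le> \<eta>" "0 \<le> T"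
    and XY: "0 < Y" "Y \<le> 1" "Y \<le> X" "0 < \<delta>" "1 \<le> X * \<delta>" "0 \<le> R"
    and large: "\<And>i. CARD('m) \<le> i \<Longrightarrow> i < d \<Longrightarrow> 1 \<le> (X * \<delta>) ^ CARD('m) * (Y / (1 + R)) ^ (i - CARD('m))"
    and \<eta>: "1 \<le> (Y / (2 + R)) ^ d * exp \<eta>"
  obtains F :: "nat \<Rightarrow> ((real ^ 'm) \<times> (real ^ 'n)) set" where
    "\<And>i. i < d \<Longrightarrow> subspace (F i) \<and> dim (F i) \<le> CARD('m)"
    "\<And>b. norm b \<le> R \<Longrightarrow> (\<And>i v. i < d \<Longrightarrow> v \<in> F i \<Longrightarrow> \<delta> * norm v \<le> norm (shear b v)) \<Longrightarrow>
      (\<And>vs. \<forall>v\<in>set vs. intvec v \<Longrightarrow> lindep vs \<Longrightarrow> length vs = d \<Longrightarrow>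
         profile T \<eta> d d \<le> rcovol {} (map (flow X Y b \<circ> G) vs)) \<Longrightarrow>
      thick (profile T \<eta> d) (flow X Y b \<circ> G)"
proof -
  define dang where "dang vs \<longleftrightarrow> (\<forall>v\<in>set vs. intvec v) \<and> lindep vs \<and>
    rcovol {} (map G vs) < exp \<eta> * profile T \<eta> d (length vs)" for vs
  have dimG: "dim (span (set (map G vs))) = length vs" if "\<forall>v\<in>set vs. intvec v" "lindep vs" for vs
  proof -
    have "0 < rcovol {} (map G vs)" using G(2) that profile_pos[of T \<eta> d "length vs"]
      by (auto simp: thick_def intro: less_le_trans)
    then have "lindep (map G vs)" by (rule rcovol_pos_imp_lindep)
    then show ?thesis by (simp add: lindep_def)
  qed
  \<comment> \<open>For ranks up to \<open>CARD('m)\<close> the whole dangerous subspace is taken;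
    beyond that any part of dimension \<open>CARD('m)\<close> suffices. Without danger the choice is
    arbitrary.\<close>
  have "\<exists>F. subspace F \<and> dim F = min i CARD('m) \<and>
     (\<forall>vs. dang vs \<longrightarrow> length vs = i \<longrightarrow> F \<subseteq> span (set (map G vs)))" if i: "i < d" for i
  proof (cases "\<exists>vs. dang vs \<and> length vs = i")
    case True
    then obtain vs where vs: "dang vs" "length vs = i" by blast
    then have "min i CARD('m) \<le> dim (span (set (map G vs)))" using dimG[of vs] by (simp add: dang_def)
    then obtain F where F: "subspace F" "F \<subseteq> span (span (set (map G vs)))" "dim F = min i CARD('m)"
      using choose_subspace_of_subspace by metis
    have "F \<subseteq> span (set (map G us))" if us: "dang us" "length us = i" for us
    proof -
      have "span (set vs) = span (set us)"
        using vs us unfolding dang_def by (intro small_span_unique[OF G \<open>0 \<le> \<eta>\<close>]) auto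
      then have "span (G ` set vs) = span (G ` set us)" by (rule span_image_cong[OF G(1)])
      then show ?thesis using F by (simp add: span_span)
    qed
    then show ?thesis using F by blast
  next
    case False
    have "min i CARD('m) \<le> dim (UNIV :: ((real ^ 'm) \<times> (real ^ 'n)) set)" using i by (simp add: d_def)
    then obtain F :: "((real ^ 'm) \<times> (real ^ 'n)) set" where "subspace F" "dim F = min i CARD('m)"
      using choose_subspace_of_subspace by metis
    then show ?thesis using False by blast
  qed
  then obtain F where F: "\<And>i. i < d \<Longrightarrow> subspace (F i) \<and> dim (F i) = min i CARD('m) \<and>
     (\<forall>vs. dang vs \<longrightarrow> length vs = i \<longrightarrow> F i \<subseteq> span (set (map G vs)))" by metis
  show ?thesis
  proof (rule that[of F])
    show "subspace (F i) \<and> dim (F i) \<le> CARD('m)" if "i < d" for i using F[OF that] by simp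
    fix b :: "real ^ 'n ^ 'm"
    assume b: "norm b \<le> R" and Fb: "\<And>i v. i < d \<Longrightarrow> v \<in> F i \<Longrightarrow> \<delta> * norm v \<le> norm (shear b v)"
      and full: "\<And>vs. \<forall>v\<in>set vs. intvec v \<Longrightarrow> lindep vs \<Longrightarrow> length vs = d \<Longrightarrow>
         profile T \<eta> d d \<le> rcovol {} (map (flow X Y b \<circ> G) vs)"
    show "thick (profile T \<eta> d) (flow X Y b \<circ> G)" unfolding thick_def
    proof (intro allI impI)
      fix vs assume vs: "\<forall>v\<in>set vs. intvec (v :: (real ^ 'm) \<times> (real ^ 'n))" "lindep vs"
      define i where "i = length vs"
      define us where "us = map G vs"
      have li: "length us = i" by (simp add: us_def i_def)
      have mus: "map (flow X Y b \<circ> G) vs = map (flow X Y b) us" by (simp add: us_def)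
      have gd: "profile T \<eta> d i \<le> rcovol {} us" using G(2) vs by (simp add: thick_def i_def us_def)
      have "lindep us" using gd profile_pos[of T \<eta> d i] by (intro rcovol_pos_imp_lindep) linarith
      have "i \<le> d" using vs(2) dim_subset_UNIV[of "set vs"] by (simp add: lindep_def i_def d_def)
      have "profile T \<eta> d i \<le> rcovol {} (map (flow X Y b) us)"
      proof (cases "i = d")
        case True
        then show ?thesis using full[OF vs] by (simp add: i_def mus)
      next
        case False
        then have id: "i < d" using \<open>i \<le> d\<close> by simp
        show ?thesis
        proof (cases "dang vs")
          case False
          then have big: "exp \<eta> * profile T \<eta> d i \<le> rcovol {} us" using vs by (auto simp: dang_def us_def i_def)
          have c: "0 < Y / (2 + R)" "Y / (2 + R) \<le> 1" using XY by (auto simp: field_simps)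
          have "1 \<le> (Y / (2 + R)) ^ d * exp \<eta>" by fact
          also have "\<dots> \<le> (Y / (2 + R)) ^ i * exp \<eta>"
            using c id by (intro mult_right_mono power_decreasing) auto
          finally have "1 * profile T \<eta> d i \<le> ((Y / (2 + R)) ^ i * exp \<eta>) * profile T \<eta> d i"
            by (intro mult_right_mono) (auto intro: less_imp_le profile_pos)
          also have "\<dots> \<le> (Y / (2 + R)) ^ i * rcovol {} us"
            using big c mult_left_mono[OF big, of "(Y / (2 + R)) ^ i"] by (simp add: mult.assoc)
          also have "\<dots> \<le> rcovol {} (map (flow X Y b) us)"
            unfolding li[symmetric] using flow_norm_ge[OF b XY(1,3)] c
            by (intro rcovol_linear_ge[OF linear_flow]) auto
          finally show ?thesis by simp
        next
          case True
          then have sub: "F i \<subseteq> span (set us)" using F[OF id] by (auto simp: i_def us_def)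
          have "\<exists>a\<ge>1. a * rcovol {} us \<le> rcovol {} (map (flow X Y b) us)"
          proof (cases "i \<le> CARD('m)")
            case True
            then have "dim (F i) = dim (span (set us))" using F[OF id] \<open>lindep us\<close> li by (simp add: lindep_def)
            then have "F i = span (set us)"
              using sub F[OF id] by (intro subspace_dim_equal) auto
            then have "(X * \<delta>) ^ length us * rcovol {} us \<le> rcovol {} (map (flow X Y b) us)"
              using Fb[OF id] XY by (intro flow_rcovol_ge_small) auto
            moreover have "1 \<le> (X * \<delta>) ^ length us" using XY by (intro one_le_power)
            ultimately show ?thesis by blast
          next
            case False
            have "(X * \<delta>) ^ CARD('m) * (Y / (1 + R)) ^ (length us - CARD('m)) * rcovol {} us
               \<le> rcovol {} (map (flow X Y b) us)"
              using F[OF id] Fb[OF id] XY b sub False \<open>lindep us\<close> by (intro flow_rcovol_ge_large) auto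
            moreover have "1 \<le> (X * \<delta>) ^ CARD('m) * (Y / (1 + R)) ^ (length us - CARD('m))"
              using large[of i] False id li by simp
            ultimately show ?thesis by blast
          qed
          then obtain a where a: "1 \<le> a" "a * rcovol {} us \<le> rcovol {} (map (flow X Y b) us)" by blast
          have "1 * rcovol {} us \<le> a * rcovol {} us" using a by (intro mult_right_mono rcovol_nonneg)
          then show ?thesis using a gd by simp
        qed
      qed
      then show "profile T \<eta> d (length vs) \<le> rcovol {} (map (flow X Y b \<circ> G) vs)"
        by (simp only: mus i_def)
    qed
  qed
qed

text \<open>The flow has determinant 1. The constant comes from the large-rank estimate with the
  first factor as \<open>F\<close> and \<delta> = 1; it is independent of \<open>X\<close> and
  \<open>Y\<close>, hence uniform over all stages.\<close>

lemma flow_full_rank: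
  fixes c :: "real ^ 'n ^ 'm"
  assumes "norm c \<le> R" "0 < X" "0 < Y" "X ^ CARD('m) * Y ^ CARD('n) = 1"
    and vs: "\<forall>v\<in>set vs. intvec v" "lindep vs" "length vs = CARD('m) + CARD('n)"
  shows "(1 / (1 + R)) ^ CARD('n) \<le> rcovol {} (map (flow X Y c) vs)"
proof -
  have R: "0 \<le> R" using assms(1) norm_ge_zero order_trans by blast
  define F where "F = range (\<lambda>x :: real ^ 'm. (x, 0 :: real ^ 'n))"
  have lin: "linear (\<lambda>x :: real ^ 'm. (x, 0 :: real ^ 'n))" by (intro linearI) auto
  have sF: "subspace F" unfolding F_def by (rule linear_subspace_image[OF lin subspace_UNIV])
  have dF: "dim F = CARD('m)" unfolding F_def
    by (subst dim_image_eq[OF lin]) (auto simp: inj_on_def)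
  have U: "span (set vs) = UNIV" using vs dim_eq_full[of "set vs"] by (simp add: lindep_def)
  have "(X * 1) ^ CARD('m) * (Y / (1 + R)) ^ (length vs - CARD('m)) * rcovol {} vs
    \<le> rcovol {} (map (flow X Y c) vs)"
    using assms sF dF U by (intro flow_rcovol_ge_large[of X 1 Y c R F]) (auto simp: F_def shear_def norm_Pair)
  then have "(X ^ CARD('m) * Y ^ CARD('n)) * ((1 / (1 + R)) ^ CARD('n) * rcovol {} vs) \<le> rcovol {} (map (flow X Y c) vs)"
    using vs(3) by (simp add: power_divide)
  then have "(1 / (1 + R)) ^ CARD('n) * rcovol {} vs \<le> rcovol {} (map (flow X Y c) vs)" using assms(4) by simp
  moreover have "(1 / (1 + R)) ^ CARD('n) * 1 \<le> (1 / (1 + R)) ^ CARD('n) * rcovol {} vs"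
    using rcovol_integer_ge_1[OF vs(1,2)] R by (intro mult_left_mono) auto
  ultimately show ?thesis by simp
qed

section \<open>From orbits without short vectors to badly approximable matrices\<close>

lemma intvec_vec: "intvec (x :: real ^ 'k) \<longleftrightarrow> (\<forall>i. x $ i \<in> \<int>)"
  by (auto simp: intvec_def Basis_vec_def inner_axis)

lemma intvec_Pair: "intvec (x, y) \<longleftrightarrow> intvec x \<and> intvec y"
  unfolding intvec_def Basis_prod_def by (simp add: ball_Un)

lemma infnorm_int_ge_1:
  fixes q :: "int ^ 'n"
  assumes "q \<noteq> 0"
  shows "1 \<le> infnorm (\<chi> j. real_of_int (q $ j))"
proof -
  obtain j where "q $ j \<noteq> 0" using assms by (metis vec_eq_iff zero_index)
  then have "1 \<le> \<bar>real_of_int (q $ j)\<bar>" by linarith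
  also have "\<dots> \<le> infnorm (\<chi> j. real_of_int (q $ j))"
    using component_le_infnorm_cart[of "\<chi> j. real_of_int (q $ j)" j] by simp
  finally show ?thesis .
qed

lemma norm_le_infnorm_cart: "norm (x :: real ^ 'n) \<le> real CARD('n) * infnorm x"
proof -
  have "norm x \<le> (\<Sum>i\<in>UNIV. \<bar>x $ i\<bar>)" by (rule norm_le_l1_cart)
  also have "\<dots> \<le> (\<Sum>i\<in>(UNIV :: 'n set). infnorm x)" by (intro sum_mono component_le_infnorm_cart)
  finally show ?thesis by simp
qed

lemma nearest_integer_vector:
  fixes u :: "real ^ 'm"
  obtains p :: "real ^ 'm" where "intvec p" "norm (p + u) \<le> real CARD('m) * dist_int_lattice u"
proof
  let ?p = "\<chi> i. - of_int (round (u $ i)) :: real ^ 'm"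
  show "intvec ?p" by (simp add: intvec_vec)
  have "norm (?p + u) \<le> (\<Sum>i\<in>UNIV. \<bar>(?p + u) $ i\<bar>)" by (rule norm_le_l1_cart)
  also have "\<dots> \<le> (\<Sum>i\<in>(UNIV :: 'm set). dist_int_lattice u)"
  proof (rule sum_mono)
    fix i
    have "\<bar>(?p + u) $ i\<bar> = dist_nearest_int (u $ i)" by (simp add: dist_nearest_int_def)
    also have "\<dots> \<le> dist_int_lattice u" unfolding dist_int_lattice_def by (intro Max_ge) auto
    finally show "\<bar>(?p + u) $ i\<bar> \<le> dist_int_lattice u" .
  qed
  finally show "norm (?p + u) \<le> real CARD('m) * dist_int_lattice u" by simp
qed

text \<open>The Dani correspondence in discrete time, with approximations \<open>c k\<close> in
  place of \<open>A\<close>: the error of order \<open>(Y / X) ^ k\<close>, multiplied by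
  \<open>X ^ k\<close>, is no worse than the second component. For a given integer vector the time
  \<open>k\<close> is taken so large that both are below half of \<epsilon>, hence the first
  component must be large.\<close>

lemma badly_approximable_if_bounded_orbit:
  fixes A :: "real ^ 'n ^ 'm"
  assumes "0 < Y" "Y < 1" and X: "X = Y powr (- (real CARD('n) / real CARD('m)))"
    and "0 \<le> R" "0 < \<epsilon>"
    and c: "\<And>k. norm (A - c k) \<le> R * (Y / X) ^ k"
    and \<epsilon>: "\<And>k v. intvec v \<Longrightarrow> v \<noteq> 0 \<Longrightarrow> \<epsilon> \<le> norm (flow (X ^ k) (Y ^ k) (c k) v)"
  shows "badly_approximable A"
proof -
  define e where "e = - (real CARD('n) / real CARD('m))"
  \<comment> \<open>Large enough that \<open>(R + 1) * norm qr\<close> is at most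
    \<open>a * (\<epsilon> / 2)\<close> for \<open>a = B * infnorm qr\<close>; the summand 1 gives
    \<open>1 \<le> B\<close>.\<close>
  define B where "B = (2 * (R + 1) / \<epsilon> + 1) * real CARD('n)"
  have "1 * 1 \<le> B" unfolding B_def
    using \<open>0 \<le> R\<close> \<open>0 < \<epsilon>\<close> by (intro mult_mono) (auto simp: Suc_le_eq)
  then have B: "1 \<le> B" by simp
  have X0: "0 < X" using \<open>0 < Y\<close> by (simp add: X)
  \<comment> \<open>The argument yields the constant with 2 in place of 4; the difference provides
    the strict inequality.\<close>
  define C where "C = \<epsilon> / (4 * X * real CARD('m)) * B powr e"
  have "C > 0" using \<open>0 < \<epsilon>\<close> X0 B by (simp add: C_def)
  have "C * infnorm qr powr e < dist_int_lattice (A *v qr)"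
    if q: "q \<noteq> 0" and qr: "qr = (\<chi> j. real_of_int (q $ j))" for q :: "int ^ 'n" and qr
  proof -
    define a where "a = B * infnorm qr"
    have inf1: "1 \<le> infnorm qr" using infnorm_int_ge_1[OF q] qr by simp
    have a1: "1 \<le> a" using mult_mono[OF B inf1] B by (simp add: a_def)
    have "(R + 1) * norm qr \<le> (R + 1) * (real CARD('n) * infnorm qr)"
      using \<open>0 \<le> R\<close> by (intro mult_left_mono norm_le_infnorm_cart) auto
    also have "\<dots> \<le> a * (\<epsilon> / 2)"
      using \<open>0 < \<epsilon>\<close> inf1 by (simp add: a_def B_def field_simps)
    finally have aq: "(R + 1) * norm qr \<le> a * (\<epsilon> / 2)" .
    \<comment> \<open>\<open>Suc n\<close> is a time at which \<open>Y ^ k\<close> is below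
      \<open>1 / a\<close>, while at the preceding time \<open>n\<close> it is not; this also bounds
      \<open>X ^ k\<close> from above.\<close>
    obtain n where n: "Y ^ Suc n < 1 / a" "1 / a \<le> Y ^ n"
      using power_scale_exists[OF assms(1,2), of "1 / a"] a1 by auto
    define k where "k = Suc n"
    obtain p where p: "intvec p" "norm (p + A *v qr) \<le> real CARD('m) * dist_int_lattice (A *v qr)"
      using nearest_integer_vector by blast
    have "intvec qr" by (simp add: qr intvec_vec)
    moreover have "qr \<noteq> 0" using inf1 infnorm_eq_0[of qr] by linarith
    ultimately have "\<epsilon> \<le> norm (flow (X ^ k) (Y ^ k) (c k) (p, qr))"
      using p(1) by (intro \<epsilon>) (auto simp: intvec_Pair zero_prod_def)
    also have "\<dots> \<le> X ^ k * norm (p + c k *v qr) + Y ^ k * norm qr"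
      using norm_Pair_le[of "X ^ k *\<^sub>R (p + c k *v qr)" "Y ^ k *\<^sub>R qr"] X0 \<open>0 < Y\<close>
      by (simp add: flow_def shear_def)
    also have "norm (p + c k *v qr) \<le> norm (p + A *v qr) + R * (Y / X) ^ k * norm qr"
    proof -
      have "p + c k *v qr = (p + A *v qr) - (A - c k) *v qr" by (simp add: matrix_vector_mult_diff_rdistrib)
      then have "norm (p + c k *v qr) \<le> norm (p + A *v qr) + norm ((A - c k) *v qr)"
        by (metis norm_triangle_ineq4)
      also have "norm ((A - c k) *v qr) \<le> norm (A - c k) * norm qr" by (rule norm_matrix_vector_mult_le)
      also have "\<dots> \<le> R * (Y / X) ^ k * norm qr" by (intro mult_right_mono c) simp
      finally show ?thesis by simp
    qed
    also have "X ^ k * (norm (p + A *v qr) + R * (Y / X) ^ k * norm qr) + Y ^ k * norm qr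
       = X ^ k * norm (p + A *v qr) + Y ^ k * ((R + 1) * norm qr)"
      using X0 by (simp add: field_simps power_divide)
    also have "Y ^ k * ((R + 1) * norm qr) \<le> (1 / a) * (a * (\<epsilon> / 2))"
    proof (rule mult_mono[OF _ aq])
      show "Y ^ k \<le> 1 / a" using n(1) by (simp add: k_def)
    qed (use a1 \<open>0 \<le> R\<close> in auto)
    finally have 1: "\<epsilon> / 2 \<le> X ^ k * norm (p + A *v qr)"
      using X0 a1 by simp
    have "X ^ n = (Y ^ n) powr e"
      using \<open>0 < Y\<close> by (simp add: X e_def powr_powr mult.commute flip: powr_realpow)
    also have "\<dots> \<le> (1 / a) powr e"
    proof -
      have "e \<le> 0" by (simp add: e_def)
      then show ?thesis using n(2) a1 by (intro powr_mono2') auto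
    qed
    also have "\<dots> = a powr (- e)" using a1 by (simp add: powr_divide powr_minus_divide)
    finally have "X ^ k \<le> X * a powr (- e)" using X0 by (simp add: k_def)
    then have "\<epsilon> / 2 \<le> X * a powr (- e) * norm (p + A *v qr)"
      using 1 mult_right_mono[of "X ^ k" "X * a powr (- e)" "norm (p + A *v qr)"] by simp
    also have "\<dots> \<le> X * a powr (- e) * (real CARD('m) * dist_int_lattice (A *v qr))"
      using p(2) X0 by (intro mult_left_mono) auto
    finally have "\<epsilon> / 2 * a powr e \<le> X * (a powr (- e) * a powr e) * (real CARD('m) * dist_int_lattice (A *v qr))"
      using mult_right_mono[of "\<epsilon> / 2" "X * a powr (- e) * (real CARD('m) * dist_int_lattice (A *v qr))" "a powr e"]
      by (simp add: mult_ac)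
    then have "\<epsilon> / 2 * a powr e \<le> X * real CARD('m) * dist_int_lattice (A *v qr)"
      using a1 by (simp add: powr_minus)
    then have "\<epsilon> / 2 * a powr e / (X * real CARD('m)) \<le> dist_int_lattice (A *v qr)"
      using X0 by (subst pos_divide_le_eq) (simp_all add: mult_ac)
    moreover have "C * infnorm qr powr e < \<epsilon> / 2 * a powr e / (X * real CARD('m))"
    proof -
      have "C * infnorm qr powr e = \<epsilon> / 4 * a powr e / (X * real CARD('m))"
        using B inf1 by (simp add: C_def a_def powr_mult)
      also have "\<dots> < \<epsilon> / 2 * a powr e / (X * real CARD('m))"
        using a1 \<open>0 < \<epsilon>\<close> X0 by (intro divide_strict_right_mono mult_strict_right_mono) auto
      finally show ?thesis .
    qed
    ultimately show ?thesis by linarith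
  qed
  then show ?thesis unfolding badly_approximable_def e_def using \<open>C > 0\<close> by blast
qed

section \<open>Homogeneous self-similar sets\<close>

lemma similarity_with_ratio_dist:
  assumes "similarity_with_ratio \<rho> f"
  shows "dist (f x) (f y) = \<rho> * dist x y"
proof -
  obtain \<Theta> c where *: "0 < \<rho>" "orthogonal_transformation \<Theta>" "\<And>x. f x = \<rho> *\<^sub>R \<Theta> x + c"
    using assms by (auto simp: similarity_with_ratio_def)
  have "f x - f y = \<rho> *\<^sub>R \<Theta> (x - y)"
    using * linear_diff[OF orthogonal_transformation_linear, of \<Theta> x y] by (simp add: scaleR_diff_right)
  then show ?thesis using * by (simp add: dist_norm orthogonal_transformation_norm)
qed

lemma similarity_with_ratio_compose:
  assumes "similarity_with_ratio \<rho> f" "similarity_with_ratio \<sigma> g"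
  shows "similarity_with_ratio (\<rho> * \<sigma>) (\<lambda>x. f (g x))"
proof -
  obtain \<Theta> c where 1: "0 < \<rho>" "orthogonal_transformation \<Theta>" "\<And>x. f x = \<rho> *\<^sub>R \<Theta> x + c"
    using assms by (auto simp: similarity_with_ratio_def)
  obtain \<Phi> d where 2: "0 < \<sigma>" "orthogonal_transformation \<Phi>" "\<And>x. g x = \<sigma> *\<^sub>R \<Phi> x + d"
    using assms by (auto simp: similarity_with_ratio_def)
  have "orthogonal_transformation (\<Theta> \<circ> \<Phi>)" using 1 2 by (simp add: orthogonal_transformation_compose)
  moreover have "f (g x) = (\<rho> * \<sigma>) *\<^sub>R (\<Theta> \<circ> \<Phi>) x + (\<rho> *\<^sub>R \<Theta> d + c)" for x
    using 1 2 orthogonal_transformation_linear[OF 1(2)]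
    by (simp add: linear_add linear_scale scaleR_add_right)
  ultimately show ?thesis unfolding similarity_with_ratio_def using 1(1) 2(1) by fastforce
qed

lemma similarity_with_ratio_id: "similarity_with_ratio 1 (\<lambda>x. x)"
  unfolding similarity_with_ratio_def
  by (intro conjI exI[of _ id] exI[of _ 0]) (auto simp: orthogonal_transformation_def linear_id)

lemma similarity_with_ratio_surj:
  assumes "similarity_with_ratio \<rho> f"
  shows "\<exists>x. f x = y"
proof -
  obtain \<Theta> c where *: "0 < \<rho>" "orthogonal_transformation \<Theta>" "\<And>x. f x = \<rho> *\<^sub>R \<Theta> x + c"
    using assms by (auto simp: similarity_with_ratio_def)
  obtain x where "\<Theta> x = (1/\<rho>) *\<^sub>R (y - c)" using orthogonal_transformation_surj[OF *(2)] by (metis surjD)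
  then show ?thesis using * by (intro exI[of _ x]) simp
qed

lemma similarity_with_ratio_inj:
  assumes "similarity_with_ratio \<rho> f" shows "inj f"
proof (rule injI)
  fix x y assume "f x = f y"
  then have "\<rho> * dist x y = 0" using similarity_with_ratio_dist[OF assms, of x y] by simp
  then show "x = y" using assms by (auto simp: similarity_with_ratio_def)
qed

lemma orthogonal_transformation_adjoint:
  fixes \<Theta> :: "'a::euclidean_space \<Rightarrow> 'a"
  assumes "orthogonal_transformation \<Theta>"
  obtains g where "orthogonal_transformation g" "\<And>x v. \<Theta> x \<bullet> v = x \<bullet> g v"
proof (rule that[of "inv \<Theta>"])
  show "orthogonal_transformation (inv \<Theta>)" by (rule orthogonal_transformation_inv[OF assms])
  fix x v
  have "\<Theta> x \<bullet> v = \<Theta> x \<bullet> \<Theta> (inv \<Theta> v)" using orthogonal_transformation_surj[OF assms] by (simp add: surj_f_inv_f)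
  also have "\<dots> = x \<bullet> inv \<Theta> v" using assms by (simp add: orthogonal_transformation_def)
  finally show "\<Theta> x \<bullet> v = x \<bullet> inv \<Theta> v" .
qed

text \<open>A separated set injects into the centres of a finite cover by balls of half the
  radius.\<close>

lemma card_separated_bound:
  fixes R \<epsilon> :: real
  assumes "0 < \<epsilon>"
  obtains C :: nat where "\<And>S :: 'a::euclidean_space set. S \<subseteq> cball 0 R \<Longrightarrow>
     (\<And>x y. x \<in> S \<Longrightarrow> y \<in> S \<Longrightarrow> x \<noteq> y \<Longrightarrow> \<epsilon> \<le> dist x y) \<Longrightarrow> card S \<le> C"
proof -
  have "compact (cball (0::'a) R)" by simp
  moreover have "cball (0::'a) R \<subseteq> (\<Union>x\<in>cball 0 R. ball x (\<epsilon>/2))"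
    using assms by (auto intro!: bexI)
  ultimately obtain T where T: "finite T" "cball (0::'a) R \<subseteq> (\<Union>x\<in>T. ball x (\<epsilon>/2))"
    by (metis compactE_image open_ball)
  show ?thesis
  proof (rule that[of "card T"])
    fix S :: "'a set" assume S: "S \<subseteq> cball 0 R" "\<And>x y. x \<in> S \<Longrightarrow> y \<in> S \<Longrightarrow> x \<noteq> y \<Longrightarrow> \<epsilon> \<le> dist x y"
    have "\<exists>t\<in>T. dist t x < \<epsilon>/2" if "x \<in> S" for x using S(1) T(2) that by fastforce
    then obtain f where f: "\<And>x. x \<in> S \<Longrightarrow> f x \<in> T \<and> dist (f x) x < \<epsilon>/2" by metis
    have "inj_on f S"
    proof (rule inj_onI, rule ccontr)
      fix x y assume xy: "x \<in> S" "y \<in> S" "f x = f y" "x \<noteq> y"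
      have "dist x y \<le> dist (f x) x + dist (f x) y" by (metis dist_commute dist_triangle)
      then show False using f[OF xy(1)] f[OF xy(2)] S(2)[OF xy(1,2,4)] xy(3) by simp
    qed
    then show "card S \<le> card T" using f T(1) by (intro card_inj_on_le[of f]) auto
  qed
qed

text \<open>Words index compositions by \<open>foldr\<close>, where the first letter is applied
  last: prefixes correspond to larger cylinders.\<close>

definition words :: "'c set \<Rightarrow> nat \<Rightarrow> 'c list set" where
  "words A n = {w. set w \<subseteq> A \<and> length w = n}"

lemma finite_words: "finite A \<Longrightarrow> finite (words A n)"
  by (simp add: words_def finite_lists_length_eq)

lemma card_words: "finite A \<Longrightarrow> card (words A n) = card A ^ n"
  by (simp add: words_def card_lists_length_eq)

lemma words_append: "u \<in> words A n \<Longrightarrow> v \<in> words A k \<Longrightarrow> u @ v \<in> words A (n + k)"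
  by (auto simp: words_def)

lemma words_take: "w \<in> words A (n + k) \<Longrightarrow> take n w \<in> words A n"
  by (auto simp: words_def dest: in_set_takeD)

lemma words_drop: "w \<in> words A (n + k) \<Longrightarrow> drop n w \<in> words A k"
  by (auto simp: words_def dest: in_set_dropD)

lemma card_words_split:
  assumes "finite A"
  shows "card {w \<in> words A (n + k). Q (take n w) (drop n w)} \<le> (\<Sum>u\<in>words A n. card {v \<in> words A k. Q u v})"
proof -
  have "{w \<in> words A (n + k). Q (take n w) (drop n w)} \<subseteq> (\<Union>u\<in>words A n. (@) u ` {v \<in> words A k. Q u v})"
  proof
    fix w assume "w \<in> {w \<in> words A (n + k). Q (take n w) (drop n w)}"
    then have "take n w \<in> words A n" "drop n w \<in> words A k" "Q (take n w) (drop n w)" "w = take n w @ drop n w"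
      using words_take words_drop by auto
    then show "w \<in> (\<Union>u\<in>words A n. (@) u ` {v \<in> words A k. Q u v})" by blast
  qed
  then have "card {w \<in> words A (n + k). Q (take n w) (drop n w)} \<le> card (\<Union>u\<in>words A n. (@) u ` {v \<in> words A k. Q u v})"
    using finite_words[OF assms] by (intro card_mono) auto
  also have "\<dots> \<le> (\<Sum>u\<in>words A n. card ((@) u ` {v \<in> words A k. Q u v}))"
    by (rule card_UN_le) (rule finite_words[OF assms])
  also have "\<dots> \<le> (\<Sum>u\<in>words A n. card {v \<in> words A k. Q u v})"
    using finite_words[OF assms] by (intro sum_mono card_image_le) auto
  finally show ?thesis .
qed

lemma foldr_image_subset:
  assumes "\<And>a. a \<in> A \<Longrightarrow> \<psi> a ` S \<subseteq> S"
  shows "w \<in> words A n \<Longrightarrow> foldr \<psi> w ` S \<subseteq> S"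
  using assms by (induction w arbitrary: n) (fastforce simp: words_def)+

lemma foldr_image_disjoint:
  assumes inj: "\<And>a. a \<in> A \<Longrightarrow> inj (\<psi> a)" and S: "\<And>a. a \<in> A \<Longrightarrow> \<psi> a ` S \<subseteq> S"
    and disj: "\<And>a b. a \<in> A \<Longrightarrow> b \<in> A \<Longrightarrow> a \<noteq> b \<Longrightarrow> \<psi> a ` S \<inter> \<psi> b ` S = {}"
  shows "w \<in> words A n \<Longrightarrow> w' \<in> words A n \<Longrightarrow> w \<noteq> w' \<Longrightarrow> foldr \<psi> w ` S \<inter> foldr \<psi> w' ` S = {}"
proof (induction n arbitrary: w w')
  case (Suc n)
  obtain a v where w: "w = a # v" "a \<in> A" "v \<in> words A n" using Suc.prems(1) by (cases w) (auto simp: words_def)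
  obtain a' v' where w': "w' = a' # v'" "a' \<in> A" "v' \<in> words A n" using Suc.prems(2) by (cases w') (auto simp: words_def)
  have im: "foldr \<psi> w ` S = \<psi> a ` foldr \<psi> v ` S" "foldr \<psi> w' ` S = \<psi> a' ` foldr \<psi> v' ` S"
    using w w' by (auto simp: image_comp)
  show ?case
  proof (cases "a = a'")
    case False
    have "foldr \<psi> v ` S \<subseteq> S" "foldr \<psi> v' ` S \<subseteq> S" 
      by (rule foldr_image_subset[OF S w(3)], assumption, rule foldr_image_subset[OF S w'(3)], assumption)
    then show ?thesis unfolding im using disj[OF w(2) w'(2) False] by blast
  next
    case True
    then have "foldr \<psi> v ` S \<inter> foldr \<psi> v' ` S = {}" using Suc.IH[OF w(3) w'(3)] Suc.prems(3) w w' by auto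
    then show ?thesis unfolding im True[symmetric] image_Int[OF inj[OF w(2)], symmetric] by simp
  qed
qed (auto simp: words_def)

text \<open>Only inclusion of the images in \<open>K\<close> is asked for, because a subfamily of
  iterates may have a smaller attractor. \<open>nonplanar\<close> demands that a whole first-level
  piece avoid a neighbourhood of each hyperplane, which is the form that can be iterated.\<close>

locale homogeneous_ifs =
  fixes A :: "'c set" and \<psi> :: "'c \<Rightarrow> 'a::euclidean_space \<Rightarrow> 'a" and \<rho> \<epsilon>0 :: real and K :: "'a set"
  assumes finA: "finite A" and \<rho>: "\<rho> < 1" "0 < \<rho>"
    and sim: "\<And>a. a \<in> A \<Longrightarrow> similarity_with_ratio \<rho> (\<psi> a)"
    and compactK: "compact K" and neK: "K \<noteq> {}"
    and invK: "\<And>a. a \<in> A \<Longrightarrow> \<psi> a ` K \<subseteq> K"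
    and \<epsilon>0: "0 < \<epsilon>0"
    and nonplanar: "\<And>\<xi> \<tau>. norm \<xi> = 1 \<Longrightarrow> \<exists>a\<in>A. \<forall>z\<in>K. \<epsilon>0 \<le> \<bar>\<xi> \<bullet> \<psi> a z + \<tau>\<bar>"
begin

lemma sim_foldr: "w \<in> words A n \<Longrightarrow> similarity_with_ratio (\<rho> ^ n) (foldr \<psi> w)"
proof (induction n arbitrary: w)
  case 0
  then show ?case by (simp add: words_def similarity_with_ratio_id id_def)
next
  case (Suc n)
  then obtain a v where "w = a # v" "a \<in> A" "v \<in> words A n"
    by (cases w) (auto simp: words_def)
  then show ?case using similarity_with_ratio_compose[OF sim Suc.IH] by (simp add: comp_def)
qed

lemma foldr_inK: "w \<in> words A n \<Longrightarrow> z \<in> K \<Longrightarrow> foldr \<psi> w z \<in> K"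
  by (induction w arbitrary: n) (use invK in \<open>auto simp: words_def\<close>)

text \<open>Pulling a hyperplane back through one map gives another hyperplane, with unit normal and
  with the neighbourhood widened by \<open>1 / \<rho>\<close>. Hence at every level at least one
  child is lost to the neighbourhood.\<close>

lemma card_hyperplane:
  "norm \<xi> = 1 \<Longrightarrow>
    card {w \<in> words A n. \<exists>z\<in>K. \<bar>\<xi> \<bullet> foldr \<psi> w z + \<tau>\<bar> < \<epsilon>0 * \<rho> ^ n} \<le> (card A - 1) ^ n"
proof (induction n arbitrary: \<xi> \<tau>)
  case 0
  have "card {w \<in> words A 0. \<exists>z\<in>K. \<bar>\<xi> \<bullet> foldr \<psi> w z + \<tau>\<bar> < \<epsilon>0 * \<rho> ^ 0} \<le> card {[] :: 'c list}"
    by (intro card_mono) (auto simp: words_def)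
  then show ?case by simp
next
  case (Suc n)
  let ?B = "\<lambda>\<xi> \<tau> n. {w \<in> words A n. \<exists>z\<in>K. \<bar>\<xi> \<bullet> foldr \<psi> w z + \<tau>\<bar> < \<epsilon>0 * \<rho> ^ n}"
  obtain a0 where a0: "a0 \<in> A" "\<forall>z\<in>K. \<epsilon>0 \<le> \<bar>\<xi> \<bullet> \<psi> a0 z + \<tau>\<bar>" using nonplanar[OF Suc.prems] by blast
  have "\<exists>\<xi>' \<tau>'. norm \<xi>' = 1 \<and> (\<forall>z. \<xi> \<bullet> \<psi> a z + \<tau> = \<rho> * (\<xi>' \<bullet> z + \<tau>'))" if a: "a \<in> A" for a
  proof -
    obtain \<Theta> c where *: "orthogonal_transformation \<Theta>" "\<And>x. \<psi> a x = \<rho> *\<^sub>R \<Theta> x + c"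
      using sim[OF a] by (auto simp: similarity_with_ratio_def)
    obtain g where g: "orthogonal_transformation g" "\<And>x v. \<Theta> x \<bullet> v = x \<bullet> g v"
      using orthogonal_transformation_adjoint[OF *(1)] by blast
    have "norm (g \<xi>) = 1" using g(1) Suc.prems by (simp add: orthogonal_transformation_norm)
    moreover have "\<xi> \<bullet> \<psi> a z + \<tau> = \<rho> * (g \<xi> \<bullet> z + (\<xi> \<bullet> c + \<tau>) / \<rho>)" for z
      using g(2)[of z \<xi>] *(2) \<rho> by (simp add: inner_add_right inner_commute field_simps)
    ultimately show ?thesis by blast
  qed
  then obtain f t where ft: "\<And>a. a \<in> A \<Longrightarrow> norm (f a) = 1 \<and> (\<forall>z. \<xi> \<bullet> \<psi> a z + \<tau> = \<rho> * (f a \<bullet> z + t a))" by metis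
  have "?B \<xi> \<tau> (Suc n) \<subseteq> (\<Union>a\<in>A - {a0}. Cons a ` ?B (f a) (t a) n)"
  proof
    fix w assume "w \<in> ?B \<xi> \<tau> (Suc n)"
    then obtain a v z where w: "w = a # v" "a \<in> A" "v \<in> words A n" "z \<in> K"
      "\<bar>\<xi> \<bullet> \<psi> a (foldr \<psi> v z) + \<tau>\<bar> < \<epsilon>0 * \<rho> ^ Suc n"
      by (cases w) (auto simp: words_def)
    \<comment> \<open>The neighbourhood is no wider than \<open>\<epsilon>0\<close>, so the letter
      \<open>a0\<close>, whose whole piece keeps that distance, cannot occur first.\<close>
    have "\<epsilon>0 * \<rho> ^ Suc n \<le> \<epsilon>0 * 1" using \<rho> \<epsilon>0 by (intro mult_left_mono power_le_one) auto
    then have "a \<noteq> a0" using w a0 foldr_inK[OF w(3,4)] by force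
    moreover have "\<rho> * \<bar>f a \<bullet> foldr \<psi> v z + t a\<bar> < \<epsilon>0 * \<rho> ^ Suc n"
      using w(5) ft[OF w(2)] \<rho> by (simp add: abs_mult)
    then have "\<bar>f a \<bullet> foldr \<psi> v z + t a\<bar> < \<epsilon>0 * \<rho> ^ n" using \<rho> by (simp add: field_simps)
    ultimately show "w \<in> (\<Union>a\<in>A - {a0}. Cons a ` ?B (f a) (t a) n)" using w by auto
  qed
  then have "card (?B \<xi> \<tau> (Suc n)) \<le> card (\<Union>a\<in>A - {a0}. Cons a ` ?B (f a) (t a) n)"
    using finA finite_words[OF finA] by (intro card_mono) auto
  also have "\<dots> \<le> (\<Sum>a\<in>A - {a0}. card (Cons a ` ?B (f a) (t a) n))" using finA by (intro card_UN_le) auto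
  also have "\<dots> \<le> (\<Sum>a\<in>A - {a0}. (card A - 1) ^ n)"
  proof (rule sum_mono)
    fix a assume a: "a \<in> A - {a0}"
    have "card (Cons a ` ?B (f a) (t a) n) \<le> card (?B (f a) (t a) n)"
      using finite_words[OF finA] by (intro card_image_le) auto
    also have "\<dots> \<le> (card A - 1) ^ n" using ft a by (intro Suc.IH) auto
    finally show "card (Cons a ` ?B (f a) (t a) n) \<le> (card A - 1) ^ n" .
  qed
  also have "\<dots> = (card A - 1) ^ Suc n" using a0(1) by (simp add: card_Diff_singleton)
  finally show ?case .
qed

lemma cardA_pos: "0 < card A"
proof -
  obtain b :: 'a where "b \<in> Basis" using nonempty_Basis by blast
  then have "norm b = 1" by simp
  from nonplanar[OF this, of 0] finA show ?thesis by (auto simp: card_gt_0_iff)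
qed

text \<open>At a fixed depth \<open>n0\<close> the fraction is already small. A longer word can be
  bad only if its prefix of length \<open>n0\<close> is, so the same \<delta> works at all greater
  depths.\<close>

lemma hyperplane_fraction:
  assumes "0 < \<kappa>"
  obtains \<delta> n0 where "0 < \<delta>" "\<And>n \<xi> \<tau>. n0 \<le> n \<Longrightarrow> norm \<xi> = 1 \<Longrightarrow>
    real (card {w \<in> words A n. \<exists>z\<in>K. \<bar>\<xi> \<bullet> foldr \<psi> w z + \<tau>\<bar> < \<delta>}) \<le> \<kappa> * real (card A) ^ n"
proof -
  define m where "m = card A"
  have m: "0 < m" using cardA_pos by (simp add: m_def)
  have "real (m - 1) / real m < 1" using m by simp
  then obtain n0 where n0: "(real (m - 1) / real m) ^ n0 < \<kappa>" using real_arch_pow_inv[OF assms] by blast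
  show ?thesis
  proof (rule that[of "\<epsilon>0 * \<rho> ^ n0" n0])
    show "0 < \<epsilon>0 * \<rho> ^ n0" using \<epsilon>0 \<rho> by simp
    fix n \<tau> and \<xi> :: 'a assume n: "n0 \<le> n" and \<xi>: "norm \<xi> = 1"
    define P where "P u \<longleftrightarrow> (\<exists>z\<in>K. \<bar>\<xi> \<bullet> foldr \<psi> u z + \<tau>\<bar> < \<epsilon>0 * \<rho> ^ n0)" for u
    obtain k where k: "n = n0 + k" using n le_Suc_ex by blast
    have "{w \<in> words A n. P w} \<subseteq> {w \<in> words A (n0 + k). P (take n0 w)}"
    proof
      fix w assume w: "w \<in> {w \<in> words A n. P w}"
      then obtain z where z: "z \<in> K" "\<bar>\<xi> \<bullet> foldr \<psi> w z + \<tau>\<bar> < \<epsilon>0 * \<rho> ^ n0" by (auto simp: P_def)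
      have "foldr \<psi> w z = foldr \<psi> (take n0 w) (foldr \<psi> (drop n0 w) z)"
        by (metis append_take_drop_id comp_apply foldr_append)
      moreover have "foldr \<psi> (drop n0 w) z \<in> K" using w z(1) words_drop k by (intro foldr_inK) auto
      ultimately show "w \<in> {w \<in> words A (n0 + k). P (take n0 w)}" using w z k by (auto simp: P_def)
    qed
    then have "card {w \<in> words A n. P w} \<le> card {w \<in> words A (n0 + k). P (take n0 w)}"
      using finite_words[OF finA] by (intro card_mono) auto
    also have "\<dots> \<le> (\<Sum>u\<in>words A n0. card {v \<in> words A k. P u})" by (rule card_words_split[OF finA])
    also have "\<dots> = (\<Sum>u\<in>words A n0. if P u then m ^ k else 0)"
      using card_words[OF finA] by (intro sum.cong) (auto simp: m_def)
    also have "\<dots> = card {u \<in> words A n0. P u} * m ^ k"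
      using finite_words[OF finA] by (simp add: sum.If_cases Int_def)
    also have "\<dots> \<le> (m - 1) ^ n0 * m ^ k"
      using card_hyperplane[OF \<xi>, of n0 \<tau>] unfolding P_def m_def by (intro mult_right_mono) auto
    finally have "real (card {w \<in> words A n. P w}) \<le> real ((m - 1) ^ n0 * m ^ k)" by (simp only: of_nat_le_iff)
    also have "\<dots> = (real (m - 1) / real m) ^ n0 * real m ^ n"
      using m by (simp add: k power_add power_divide)
    also have "\<dots> \<le> \<kappa> * real m ^ n" using n0 by (intro mult_right_mono) auto
    finally show "real (card {w \<in> words A n. \<exists>z\<in>K. \<bar>\<xi> \<bullet> foldr \<psi> w z + \<tau>\<bar> < \<epsilon>0 * \<rho> ^ n0}) \<le> \<kappa> * real (card A) ^ n"
      by (simp add: P_def m_def)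
  qed
qed

text \<open>A fixed ball inside \<open>O'\<close> has disjoint images under different words of equal
  length. Rescaled by \<open>\<rho> ^ n\<close>, the images of its centre are separated, and those
  of cylinders meeting \<open>U\<close> lie in a fixed ball.\<close>

lemma cylinder_multiplicity:
  assumes O: "open O'" "O' \<noteq> {}" "\<And>a. a \<in> A \<Longrightarrow> \<psi> a ` O' \<subseteq> O'"
    and disj: "\<And>a b. a \<in> A \<Longrightarrow> b \<in> A \<Longrightarrow> a \<noteq> b \<Longrightarrow> \<psi> a ` O' \<inter> \<psi> b ` O' = {}"
  obtains C :: nat where "\<And>n U. bounded U \<Longrightarrow> diameter U \<le> \<rho> ^ n \<Longrightarrow>
     card {w \<in> words A n. foldr \<psi> w ` K \<inter> U \<noteq> {}} \<le> C"
proof -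
  obtain x1 \<epsilon> where x1: "0 < \<epsilon>" "ball x1 \<epsilon> \<subseteq> O'" using O(1,2) by (metis all_not_in_conv openE)
  then have x1O: "x1 \<in> O'" by auto
  obtain R where R: "\<And>z. z \<in> K \<Longrightarrow> dist x1 z \<le> R" using compact_imp_bounded[OF compactK] bounded_any_center[of K x1] by blast
  obtain C where C: "\<And>S :: 'a set. S \<subseteq> cball 0 (R + 1) \<Longrightarrow>
     (\<And>x y. x \<in> S \<Longrightarrow> y \<in> S \<Longrightarrow> x \<noteq> y \<Longrightarrow> \<epsilon> \<le> dist x y) \<Longrightarrow> card S \<le> C"
    using card_separated_bound[OF x1(1), of "R + 1"] by metis
  have inj: "inj (\<psi> a)" if "a \<in> A" for a
    using similarity_with_ratio_inj[OF sim[OF that]] .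
  have dj: "foldr \<psi> w ` O' \<inter> foldr \<psi> w' ` O' = {}" if "w \<in> words A n" "w' \<in> words A n" "w \<noteq> w'" for w w' n
    using that by (intro foldr_image_disjoint[OF inj O(3) disj])
  show ?thesis
  proof (rule that[of C])
    fix n and U :: "'a set" assume U: "bounded U" "diameter U \<le> \<rho> ^ n"
    define W where "W = {w \<in> words A n. foldr \<psi> w ` K \<inter> U \<noteq> {}}"
    show "card {w \<in> words A n. foldr \<psi> w ` K \<inter> U \<noteq> {}} \<le> C"
    proof (cases "U = {}")
      case False
      then obtain u where u: "u \<in> U" by blast
      define r where "r = \<rho> ^ n"
      have r: "0 < r" using \<rho> by (simp add: r_def)
      define g where "g w = (1/r) *\<^sub>R (foldr \<psi> w x1 - u)" for w
      have sep: "r * \<epsilon> \<le> dist (foldr \<psi> w x1) (foldr \<psi> w' x1)" if w: "w \<in> W" "w' \<in> W" "w \<noteq> w'" for w w'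
      proof (rule ccontr)
        assume n: "\<not> ?thesis"
        have s: "similarity_with_ratio r (foldr \<psi> w')" using w sim_foldr by (auto simp: W_def r_def)
        obtain x where x: "foldr \<psi> w' x = foldr \<psi> w x1" using similarity_with_ratio_surj[OF s] by blast
        then have "r * dist x x1 < r * \<epsilon>" using n similarity_with_ratio_dist[OF s, of x x1] by simp
        then have "x \<in> O'" using r x1(2) by (auto simp: dist_commute)
        then have "foldr \<psi> w x1 \<in> foldr \<psi> w ` O' \<inter> foldr \<psi> w' ` O'" using x x1O by (metis IntI imageI)
        then show False using dj[of w n w'] w by (auto simp: W_def)
      qed
      have gd: "dist (g w) (g w') = (1/r) * dist (foldr \<psi> w x1) (foldr \<psi> w' x1)" for w w'
        using r by (simp add: g_def dist_norm flip: scaleR_diff_right)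
      have gsep: "\<epsilon> \<le> dist (g w) (g w')" if "w \<in> W" "w' \<in> W" "w \<noteq> w'" for w w'
        using sep[OF that] r by (simp add: gd field_simps)
      have "inj_on g W" using gsep x1(1) by (intro inj_onI) (metis dist_self not_less)
      moreover have "card (g ` W) \<le> C"
      proof (rule C)
        show "g ` W \<subseteq> cball 0 (R + 1)"
        proof
          fix y assume "y \<in> g ` W"
          then obtain w where w: "w \<in> W" "y = g w" by blast
          then obtain z where z: "z \<in> K" "foldr \<psi> w z \<in> U" by (auto simp: W_def)
          have s: "similarity_with_ratio r (foldr \<psi> w)" using w sim_foldr by (auto simp: W_def r_def)
          have "dist (foldr \<psi> w x1) (foldr \<psi> w z) \<le> r * R"
            using similarity_with_ratio_dist[OF s] R[OF z(1)] r by simp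
          moreover have "dist (foldr \<psi> w z) u \<le> r"
            using diameter_bounded_bound[OF U(1) z(2) u] U(2) by (simp add: r_def)
          ultimately have "dist (foldr \<psi> w x1) u \<le> r * (R + 1)"
            using dist_triangle[of "foldr \<psi> w x1" u "foldr \<psi> w z"] by (simp add: algebra_simps)
          then have "1 / r * dist (foldr \<psi> w x1) u \<le> R + 1" using r by (simp add: field_simps)
          then show "y \<in> cball 0 (R + 1)" using r w by (simp add: g_def dist_norm)
        qed
      qed (use gsep in auto)
      ultimately show ?thesis by (simp add: card_image W_def)
    qed simp
  qed
qed

end

section \<open>Most points of a cylinder shear a given subspace robustly\<close>

lemma two_sided_lower_bound:
  fixes a b N s \<delta> \<eta> :: real
  assumes "0 \<le> a" "0 \<le> b" "0 < s" "0 < \<delta>" "0 < \<eta>" "4 * s \<le> \<delta>" "24 * s * s \<le> \<delta> * \<eta>"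
    and 1: "\<delta> / 2 * b - 3 * s * a \<le> N" and 2: "\<eta> * a - s * b \<le> N"
  shows "min (min (\<delta> / 8) s) (\<eta> / 8) * (a + b) \<le> N"
proof -
  define m where "m = min (min (\<delta> / 8) s) (\<eta> / 8)"
  have m: "m \<le> \<delta> / 8" "m \<le> s" "m \<le> \<eta> / 8" by (auto simp: m_def)
  \<comment> \<open>If \<open>b\<close> dominates, the first inequality suffices; otherwise
    \<open>a\<close> dominates, and \<open>24 * s * s \<le> \<delta> * \<eta>\<close> makes the loss
    \<open>s * b\<close> in the second at most half of \<open>\<eta> * a\<close>.\<close>
  have "m * (a + b) \<le> N"
  proof (cases "12 * s * a \<le> \<delta> * b")
    case True
    have "m * a + m * b \<le> s * a + \<delta> / 8 * b" using m assms by (intro add_mono mult_right_mono) auto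
    moreover have "0 \<le> s * a" using assms by simp
    ultimately show ?thesis using 1 True by (simp add: algebra_simps)
  next
    case False
    have "\<delta> * (2 * (s * b)) = (2 * s) * (\<delta> * b)" by simp
    also have "\<dots> \<le> (2 * s) * (12 * s * a)" using False assms by (intro mult_left_mono) auto
    also have "\<dots> = (24 * s * s) * a" by simp
    also have "\<dots> \<le> (\<delta> * \<eta>) * a" using assms by (intro mult_right_mono) auto
    finally have "\<delta> * (2 * (s * b)) \<le> \<delta> * (\<eta> * a)" by simp
    then have sb: "2 * (s * b) \<le> \<eta> * a" using assms by simp
    have "\<delta> * b \<le> 12 * s * a" using False by simp
    also have "\<dots> \<le> \<delta> * (3 * a)" using mult_right_mono[OF assms(6), of "3 * a"] assms by simp
    finally have "b \<le> 3 * a" using assms by simp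
    then have "m * (a + b) \<le> \<eta> / 8 * (a + b)" "\<eta> / 8 * (a + b) \<le> \<eta> / 8 * (4 * a)"
      using m assms by (intro mult_right_mono mult_left_mono; auto)+
    then show ?thesis using 2 sb by simp
  qed
  then show ?thesis by (simp add: m_def)
qed

text \<open>The rank-one matrix that turns \<open>x \<bullet> (B *v y)\<close> into a linear
  functional of the matrix \<open>B\<close>.\<close>

definition outer :: "real ^ 'm \<Rightarrow> real ^ 'n \<Rightarrow> real ^ 'n ^ 'm" where
  "outer x y = (\<chi> i. x $ i *\<^sub>R y)"

lemma inner_outer: "x \<bullet> (B *v y) = B \<bullet> outer x y"
  by (simp add: outer_def inner_vec_def[of x] inner_vec_def[of B] matrix_vector_mul_component)

lemma norm_outer: "norm (outer x y) = norm x * norm y"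
  by (simp add: outer_def norm_vec_def[of "\<chi> i. x $ i *\<^sub>R y"] norm_vec_def[of x] L2_set_left_distrib)

lemma subspace_decompose_insert:
  fixes F :: "'a::euclidean_space set"
  assumes "subspace F" "subspace F'" "F' \<subseteq> F" "dim F = Suc (dim F')" "e \<in> F" "e \<notin> F'" "f \<in> F"
  obtains \<alpha> f' where "f' \<in> F'" "f = \<alpha> *\<^sub>R e + f'"
proof -
  have sp: "span F' = F'" using assms(2) by simp
  have "dim (insert e F') = Suc (dim F')" using assms(6) by (simp add: dim_insert sp)
  then have "span (insert e F') = F"
    using assms by (intro subspace_dim_equal span_minimal) (auto simp: subspace_span)
  then obtain k where "f - k *\<^sub>R e \<in> span F'" using assms(7) span_breakdown_eq by blast
  then have "f - k *\<^sub>R e \<in> F'" by (simp only: sp)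
  then show ?thesis by (intro that[of "f - k *\<^sub>R e" k]) auto
qed

text \<open>Induction on the dimension. Once the image of a hyperplane \<open>F'\<close> of \<open>F\<close> is known to be thick
  on a cylinder, the image of all of \<open>F\<close> can only fail to be thick on smaller cylinders near the
  zero set of one affine function.\<close>
lemma shear_fraction:
  fixes \<psi> :: "'c \<Rightarrow> real ^ 'n ^ 'm \<Rightarrow> real ^ 'n ^ 'm"
  assumes ifs: "homogeneous_ifs A \<psi> \<rho> \<epsilon>0 K" and x0: "x0 \<in> K"
  shows "j \<le> CARD('m) \<Longrightarrow> 0 < \<kappa> \<Longrightarrow> \<exists>\<delta>>0. \<exists>n0. \<forall>n\<ge>n0.
    \<forall>(\<Theta> :: real ^ 'n ^ 'm \<Rightarrow> real ^ 'n ^ 'm) F. orthogonal_transformation \<Theta> \<longrightarrow> subspace F \<longrightarrow> dim F = j \<longrightarrow>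
    real (card {w \<in> words A n. \<not> (\<forall>f\<in>F. \<delta> * norm f \<le> norm (shear (\<Theta> (foldr \<psi> w x0 - x0)) f))})
      \<le> \<kappa> * real (card A) ^ n"
proof (induction j arbitrary: \<kappa>)
  case 0
  have base: "real (card {w \<in> words A n. \<not> (\<forall>f\<in>F. 1 * norm f \<le> norm (shear (\<Theta> (foldr \<psi> w x0 - x0)) f))})
      \<le> \<kappa> * real (card A) ^ n"
    if "subspace F" "dim F = 0" for F :: "((real ^ 'm) \<times> (real ^ 'n)) set"
      and \<Theta> :: "real ^ 'n ^ 'm \<Rightarrow> real ^ 'n ^ 'm" and n
  proof -
    have "F \<subseteq> {0}" using that by (simp add: dim_eq_0)
    then have "\<forall>f\<in>F. 1 * norm f \<le> norm (shear b f)" for b :: "real ^ 'n ^ 'm" by auto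
    then show ?thesis using 0 by simp
  qed
  then show ?case
    by (intro exI[of _ "1::real"] conjI exI[of _ "0::nat"] allI impI) simp_all
next
  case (Suc j)
  interpret homogeneous_ifs A \<psi> \<rho> \<epsilon>0 K by fact
  define m where "m = card A"
  have k2: "0 < \<kappa> / 2" using Suc.prems by simp
  obtain \<delta>1 n1 where \<delta>1: "0 < \<delta>1" and IH: "\<forall>n\<ge>n1.
    \<forall>(\<Theta> :: real ^ 'n ^ 'm \<Rightarrow> real ^ 'n ^ 'm) F. orthogonal_transformation \<Theta> \<longrightarrow> subspace F \<longrightarrow> dim F = j \<longrightarrow>
    real (card {w \<in> words A n. \<not> (\<forall>f\<in>F. \<delta>1 * norm f \<le> norm (shear (\<Theta> (foldr \<psi> w x0 - x0)) f))})
      \<le> \<kappa> / 2 * real (card A) ^ n"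
    using Suc.IH[OF Suc_leD[OF Suc.prems(1)] k2] by blast
  obtain \<delta>H nH where \<delta>H: "0 < \<delta>H" and hyp: "\<And>n \<xi> \<tau>. nH \<le> n \<Longrightarrow> norm \<xi> = 1 \<Longrightarrow>
    real (card {w \<in> words A n. \<exists>z\<in>K. \<bar>\<xi> \<bullet> foldr \<psi> w z + \<tau>\<bar> < \<delta>H}) \<le> \<kappa> / 2 * real (card A) ^ n"
    by (rule hyperplane_fraction[OF k2]) (rule that)
  obtain R0 where R0: "\<And>z. z \<in> K \<Longrightarrow> dist x0 z \<le> R0"
    using compact_imp_bounded[OF compactK] bounded_any_center[of K x0] by blast
  define R where "R = max R0 1"
  have R: "norm (z - x0) \<le> R" if "z \<in> K" for z using R0[OF that] by (simp add: R_def dist_norm norm_minus_commute)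
  have R1: "1 \<le> R" by (simp add: R_def)
  \<comment> \<open>Lower bound for the second component of a unit vector that is almost killed by a
    shear of norm at most \<open>R\<close>; see \<open>yc\<close>.\<close>
  define c where "c = 1 / (2 * (R + 1))"
  have c: "0 < c" using R1 by (simp add: c_def)
  \<comment> \<open>The cylinder size \<open>r\<close> must give
    \<open>4 * s \<le> \<delta>1\<close>, \<open>4 * s \<le> 1\<close> and
    \<open>24 * s * s \<le> \<delta>1 * \<eta>\<close>. Since \<open>s\<close> and \<eta> are both
    proportional to \<open>r\<close>, the last condition compares a quadratic with a linear term, so
    it also holds for small \<open>r\<close>.\<close>
  define r0 where "r0 = min (min (\<delta>1 / (4 * R)) (1 / (4 * R))) (\<delta>1 * (\<delta>H * c) / (24 * R * R))"
  have "0 < r0" using \<delta>1 \<delta>H c R1 by (simp add: r0_def)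
  then obtain p where p: "\<rho> ^ p < r0" using real_arch_pow_inv[OF _ \<rho>(1)] by blast
  define N1 where "N1 = max n1 p"
  define r where "r = \<rho> ^ N1"
  have "r \<le> \<rho> ^ p" unfolding r_def using \<rho> by (intro power_decreasing) (auto simp: N1_def)
  then have rr0: "r < r0" using p by simp
  have r: "0 < r" using \<rho> by (simp add: r_def)
  define s where "s = r * R"
  have s: "0 < s" using r R1 by (simp add: s_def)
  have s1: "4 * s \<le> \<delta>1" "4 * s \<le> 1" using rr0 R1 by (auto simp: r0_def s_def field_simps)
  define \<eta> where "\<eta> = \<delta>H * c * r"
  have \<eta>: "0 < \<eta>" using \<delta>H c r by (simp add: \<eta>_def)
  have s2: "24 * s * s \<le> \<delta>1 * \<eta>"
  proof -
    have "r * (24 * R * R) \<le> \<delta>1 * (\<delta>H * c)" using rr0 R1 by (auto simp: r0_def pos_less_divide_eq)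
    then have "r * (r * (24 * R * R)) \<le> r * (\<delta>1 * (\<delta>H * c))" using r by (intro mult_left_mono) auto
    then show ?thesis by (simp add: s_def \<eta>_def mult_ac)
  qed
  define \<delta> where "\<delta> = min (min (\<delta>1 / 8) s) (\<eta> / 8)"
  have \<delta>: "0 < \<delta>" "\<delta> \<le> s" using \<delta>1 s \<eta> by (auto simp: \<delta>_def)
  have main: "real (card {w \<in> words A n. \<not> (\<forall>f\<in>F. \<delta> * norm f \<le> norm (shear (\<Theta> (foldr \<psi> w x0 - x0)) f))})
      \<le> \<kappa> * real (card A) ^ n"
    if n: "N1 + nH \<le> n" and \<Theta>: "orthogonal_transformation \<Theta>" and F: "subspace F" "dim F = Suc j"
    for n and \<Theta> :: "real ^ 'n ^ 'm \<Rightarrow> real ^ 'n ^ 'm" and F :: "((real ^ 'm) \<times> (real ^ 'n)) set"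
  proof -
    obtain k where k: "n = N1 + k" "nH \<le> k" using n by (metis add_leD1 le_Suc_ex nat_add_left_cancel_le)
    have "j \<le> dim F" using F by simp
    then obtain F' where F': "subspace F'" "F' \<subseteq> span F" "dim F' = j"
      by (rule choose_subspace_of_subspace)
    have F'F: "F' \<subseteq> F" using F'(2) F(1) by (simp add: span_eq_iff[THEN iffD2])
    have lin\<Theta>: "linear \<Theta>" by (rule orthogonal_transformation_linear[OF \<Theta>])
    define b where "b z = \<Theta> (z - x0)" for z
    have bb: "norm (b z - b z') = dist z z'" for z z'
    proof -
      have "b z - b z' = \<Theta> (z - z')" using linear_diff[OF lin\<Theta>, of "z - x0" "z' - x0"] by (simp add: b_def)
      then show ?thesis using orthogonal_transformation_norm[OF \<Theta>] by (simp add: dist_norm)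
    qed
    have bR: "norm (b z) \<le> R" if "z \<in> K" for z
      using orthogonal_transformation_norm[OF \<Theta>] R[OF that] by (simp add: b_def)
    define good where "good u \<longleftrightarrow> (\<forall>f\<in>F'. \<delta>1 * norm f \<le> norm (shear (b (foldr \<psi> u x0)) f))" for u
    define Q where "Q u v \<longleftrightarrow> \<not> (\<forall>f\<in>F. \<delta> * norm f \<le> norm (shear (b (foldr \<psi> u (foldr \<psi> v x0))) f))" for u v
    have Qgood: "real (card {v \<in> words A k. Q u v}) \<le> \<kappa> / 2 * real m ^ k" if u: "u \<in> words A N1" "good u" for u
    proof -
      define g where "g = foldr \<psi> u"
      define b0 where "b0 = b (g x0)"
      have sg: "similarity_with_ratio r g" using sim_foldr[OF u(1)] by (simp add: g_def r_def)
      have gK: "g z \<in> K" if "z \<in> K" for z using foldr_inK[OF u(1) that] by (simp add: g_def)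
      have near: "norm (shear (b (g z)) f - shear b0 f) \<le> s * norm f" if "z \<in> K" for z f
      proof -
        have "norm (b (g z) - b0) = r * norm (z - x0)"
          unfolding b0_def bb using similarity_with_ratio_dist[OF sg] by (simp add: dist_norm)
        also have "\<dots> \<le> s" using R[OF that] r by (simp add: s_def)
        finally have "norm (b (g z) - b0) * norm (snd f) \<le> s * norm f"
          using s norm_snd_prod_le[of f] by (intro mult_mono) auto
        then show ?thesis using norm_shear_diff_le[of "b (g z)" f b0] by linarith
      qed
      \<comment> \<open>Inside the cylinder of \<open>u\<close> the shear varies by at most
        \<open>s\<close>. Either it is bounded below by \<open>2 * s\<close> at the centre, and then
        throughout, or some unit vector \<open>e\<close> is almost killed there and all depends on
        how \<open>shear\<close> acts on \<open>e\<close>.\<close>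
      show ?thesis
      proof (cases "\<forall>f\<in>F. 2 * s * norm f \<le> norm (shear b0 f)")
        case True
        have "\<not> Q u v" if "v \<in> words A k" for v
        proof -
          have "\<delta> * norm f \<le> norm (shear (b (g (foldr \<psi> v x0))) f)" if "f \<in> F" for f
          proof -
            have "norm (shear b0 f) \<le> norm (shear (b (g (foldr \<psi> v x0))) f) + s * norm f"
              using near[OF foldr_inK[OF \<open>v \<in> words A k\<close> x0], of f] norm_triangle_sub[of "shear b0 f" "shear (b (g (foldr \<psi> v x0))) f"]
              by (simp add: norm_minus_commute)
            moreover have "\<delta> * norm f \<le> s * norm f" using \<delta> by (intro mult_right_mono) auto
            ultimately show ?thesis using True that by fastforce
          qed
          then show ?thesis by (simp add: Q_def g_def)
        qed
        then have "{v \<in> words A k. Q u v} = {}" by auto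
        then have "card {v \<in> words A k. Q u v} = 0" by (simp only: card.empty)
        moreover have "0 \<le> \<kappa> / 2 * real m ^ k" using Suc.prems by simp
        ultimately show ?thesis by linarith
      next
        case False
        then obtain e' where e': "e' \<in> F" "norm (shear b0 e') < 2 * s * norm e'" by (auto simp: not_le)
        then have ne: "norm e' \<noteq> 0" using norm_ge_zero[of "shear b0 e'"] by (metis mult_zero_right not_less)
        define e where "e = (1 / norm e') *\<^sub>R e'"
        have e: "e \<in> F" "norm e = 1" using e'(1) F(1) ne by (auto simp: e_def subspace_scale)
        have "shear b0 e = (1 / norm e') *\<^sub>R shear b0 e'" by (simp add: e_def linear_scale[OF linear_shear])
        then have e2s: "norm (shear b0 e) < 2 * s" using e'(2) ne by (simp add: field_simps)
        have eF': "e \<notin> F'"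
        proof
          assume "e \<in> F'"
          then have "\<delta>1 \<le> norm (shear b0 e)" using u(2) e(2) by (auto simp: good_def b0_def g_def)
          then show False using e2s s1 s by linarith
        qed
        \<comment> \<open>Since \<open>j\<close> is smaller than the dimension of the target, there
          is a direction \<xi> orthogonal to the image of \<open>F'\<close>; it detects the
          contribution of \<open>e\<close> alone.\<close>
        have "dim (shear b0 ` F') \<le> j" using dim_image_le[OF linear_shear, of b0 F'] F' by simp
        then have "dim (shear b0 ` F') < DIM(real ^ 'm)" using Suc.prems by simp
        then obtain \<xi>' where \<xi>': "\<xi>' \<noteq> 0" "\<And>y. y \<in> span (shear b0 ` F') \<Longrightarrow> orthogonal \<xi>' y"
          using orthogonal_to_subspace_exists by blast
        define \<xi> where "\<xi> = (1 / norm \<xi>') *\<^sub>R \<xi>'"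
        have "\<xi>' \<bullet> shear b0 f = 0" if "f \<in> F'" for f
          using \<xi>'(2)[OF span_base[OF imageI[OF that]]] by (simp add: orthogonal_def)
        then have \<xi>: "norm \<xi> = 1" "\<And>f. f \<in> F' \<Longrightarrow> \<xi> \<bullet> shear b0 f = 0"
          using \<xi>'(1) by (simp_all add: \<xi>_def)
        define y0 where "y0 = snd e"
        \<comment> \<open>As \<open>shear b0 e\<close> is small, the first component of
          \<open>e\<close> is nearly determined by the second, which therefore cannot be
          small.\<close>
        have yc: "c \<le> norm y0"
        proof -
          have "norm (b0 *v y0) \<le> R * norm y0"
            using norm_matrix_vector_mult_le[of b0 y0] mult_right_mono[OF bR[OF gK[OF x0]], of "norm y0"] by (simp add: b0_def)
          moreover have "norm (fst e) \<le> norm (shear b0 e) + norm (b0 *v y0)"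
            using norm_triangle_ineq4[of "shear b0 e" "b0 *v y0"] by (simp add: shear_def y0_def)
          moreover have "1 \<le> norm (fst e) + norm y0" using norm_Pair_le[of "fst e" "snd e"] e(2) by (simp add: y0_def)
          ultimately have "1 / 2 \<le> (R + 1) * norm y0" using e2s s1 by (simp add: algebra_simps)
          then show ?thesis using R1 by (simp add: c_def field_simps)
        qed
        have ny: "0 < norm y0" using yc c by linarith
        obtain \<Phi> d where \<Phi>: "orthogonal_transformation \<Phi>" "\<And>z. g z = r *\<^sub>R \<Phi> z + d"
          using sg by (auto simp: similarity_with_ratio_def)
        obtain h where h: "orthogonal_transformation h" "\<And>x v. (\<Theta> \<circ> \<Phi>) x \<bullet> v = x \<bullet> h v"
          using orthogonal_transformation_adjoint[OF orthogonal_transformation_compose[OF \<Theta> \<Phi>(1)]] by blast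
        define \<zeta> where "\<zeta> = (1 / norm y0) *\<^sub>R h (outer \<xi> y0)"
        have \<zeta>: "norm \<zeta> = 1" using ny \<xi>(1) orthogonal_transformation_norm[OF h(1)] by (simp add: \<zeta>_def norm_outer)
        define \<tau> where "\<tau> = (\<xi> \<bullet> fst e + \<Theta> (d - x0) \<bullet> outer \<xi> y0) / (r * norm y0)"
        \<comment> \<open>On the cylinder the \<xi>-component of the sheared \<open>e\<close> is an
          affine function of the unscaled point \<open>z\<close>, with unit normal \<zeta>. Avoiding
          the neighbourhood of its zero set is a hyperplane condition.\<close>
        have ell: "\<xi> \<bullet> shear (b (g z)) e = r * norm y0 * (\<zeta> \<bullet> z + \<tau>)" for z
        proof -
          have "b (g z) = r *\<^sub>R (\<Theta> \<circ> \<Phi>) z + \<Theta> (d - x0)"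
            using \<Phi>(2) by (simp add: b_def linear_scale[OF lin\<Theta>] flip: linear_add[OF lin\<Theta>])
              (simp add: linear_scale[OF lin\<Theta>] linear_add[OF lin\<Theta>] linear_diff[OF lin\<Theta>] algebra_simps)
          then have "\<xi> \<bullet> shear (b (g z)) e = \<xi> \<bullet> fst e + r * (z \<bullet> h (outer \<xi> y0)) + \<Theta> (d - x0) \<bullet> outer \<xi> y0"
            using h(2)[of z "outer \<xi> y0"] by (simp add: shear_def inner_add_right inner_outer y0_def inner_add_left)
          then show ?thesis using r ny by (simp add: \<zeta>_def \<tau>_def inner_commute field_simps)
        qed
        have "{v \<in> words A k. Q u v} \<subseteq> {v \<in> words A k. \<exists>z\<in>K. \<bar>\<zeta> \<bullet> foldr \<psi> v z + \<tau>\<bar> < \<delta>H}"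
        proof (rule ccontr)
          assume "\<not> ?thesis"
          then obtain v where v12: "v \<in> words A k" "Q u v" "\<not> (\<exists>z\<in>K. \<bar>\<zeta> \<bullet> foldr \<psi> v z + \<tau>\<bar> < \<delta>H)" by blast
          then have "\<delta>H \<le> \<bar>\<zeta> \<bullet> foldr \<psi> v x0 + \<tau>\<bar>" using x0 by (meson not_less)
          note v = v12(1,2) this
          define z where "z = foldr \<psi> v x0"
          have z: "z \<in> K" unfolding z_def by (rule foldr_inK[OF v(1) x0])
          define S where "S = shear (b (g z))"
          have linS: "linear S" unfolding S_def by (rule linear_shear)
          have "\<eta> \<le> r * norm y0 * \<bar>\<zeta> \<bullet> z + \<tau>\<bar>"
          proof -
            have "\<eta> = (r * c) * \<delta>H" by (simp add: \<eta>_def)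
            also have "\<dots> \<le> (r * norm y0) * \<bar>\<zeta> \<bullet> z + \<tau>\<bar>"
              using v(3) yc r c \<delta>H by (intro mult_mono) (auto simp: z_def)
            finally show ?thesis .
          qed
          then have \<xi>e: "\<eta> \<le> \<bar>\<xi> \<bullet> S e\<bar>" using ell[of z] r by (simp add: S_def abs_mult)
          have Se: "norm (S e) \<le> 3 * s"
            using near[OF z, of e] e(2) e2s norm_triangle_sub[of "S e" "shear b0 e"] by (simp add: S_def)
          have "\<delta> * norm f \<le> norm (S f)" if fF: "f \<in> F" for f
          proof -
            have dF: "dim F = Suc (dim F')" by (simp add: F(2) F'(3))
            obtain \<alpha> f' where f: "f' \<in> F'" "f = \<alpha> *\<^sub>R e + f'"
              by (rule subspace_decompose_insert[OF F(1) F'(1) F'F dF e(1) eF' fF])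
            have Sf: "S f = \<alpha> *\<^sub>R S e + S f'" using f linS by (simp add: linear_add linear_scale)
            have near': "norm (S f' - shear b0 f') \<le> s * norm f'" using near[OF z] by (simp add: S_def)
            have good': "\<delta>1 * norm f' \<le> norm (shear b0 f')" using u(2) f(1) by (simp add: good_def b0_def g_def)
            have 1: "\<delta>1 / 2 * norm f' - 3 * s * \<bar>\<alpha>\<bar> \<le> norm (S f)"
            proof -
              have "norm (shear b0 f') \<le> norm (S f') + s * norm f'"
                using near' norm_triangle_sub[of "shear b0 f'" "S f'"] by (simp add: norm_minus_commute)
              moreover have "norm (S f') \<le> norm (S f) + \<bar>\<alpha>\<bar> * norm (S e)"
                using norm_triangle_ineq4[of "S f" "\<alpha> *\<^sub>R S e"] by (simp add: Sf)
              moreover have "\<bar>\<alpha>\<bar> * norm (S e) \<le> \<bar>\<alpha>\<bar> * (3 * s)" using Se by (intro mult_left_mono) auto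
              moreover have "s * norm f' \<le> \<delta>1 / 4 * norm f'" using s1 by (intro mult_right_mono) auto
              moreover have "0 \<le> \<delta>1 * norm f'" using \<delta>1 by simp
              ultimately show ?thesis using good' by (simp add: algebra_simps)
            qed
            \<comment> \<open>At the centre \<xi> annihilates the image of \<open>f'\<close>;
              elsewhere in the cylinder this fails by at most \<open>s * norm f'\<close>.\<close>
            have 2: "\<eta> * \<bar>\<alpha>\<bar> - s * norm f' \<le> norm (S f)"
            proof -
              have "\<xi> \<bullet> S f = \<alpha> * (\<xi> \<bullet> S e) + \<xi> \<bullet> (S f' - shear b0 f')"
                using \<xi>(2)[OF f(1)] by (simp add: Sf inner_add_right inner_diff_right)
              moreover have "\<bar>\<xi> \<bullet> (S f' - shear b0 f')\<bar> \<le> s * norm f'"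
                using Cauchy_Schwarz_ineq2[of \<xi> "S f' - shear b0 f'"] near' \<xi>(1) by simp
              moreover have "\<bar>\<xi> \<bullet> S f\<bar> \<le> norm (S f)" using Cauchy_Schwarz_ineq2[of \<xi> "S f"] \<xi>(1) by simp
              moreover have "\<eta> * \<bar>\<alpha>\<bar> \<le> \<bar>\<alpha> * (\<xi> \<bullet> S e)\<bar>"
                using mult_right_mono[OF \<xi>e, of "\<bar>\<alpha>\<bar>"] by (simp add: abs_mult mult.commute)
              ultimately show ?thesis by linarith
            qed
            have "\<delta> * (\<bar>\<alpha>\<bar> + norm f') \<le> norm (S f)"
              unfolding \<delta>_def using two_sided_lower_bound[OF _ _ s \<delta>1 \<eta> s1(1) s2 1 2] by simp
            moreover have "norm f \<le> \<bar>\<alpha>\<bar> + norm f'" using norm_triangle_ineq[of "\<alpha> *\<^sub>R e" f'] e(2) by (simp add: f)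
            then have "\<delta> * norm f \<le> \<delta> * (\<bar>\<alpha>\<bar> + norm f')" using \<delta> by (intro mult_left_mono) auto
            ultimately show ?thesis by linarith
          qed
          then show False using v(2) by (auto simp: Q_def S_def g_def z_def)
        qed
        then have "card {v \<in> words A k. Q u v} \<le> card {v \<in> words A k. \<exists>z\<in>K. \<bar>\<zeta> \<bullet> foldr \<psi> v z + \<tau>\<bar> < \<delta>H}"
          using finite_words[OF finA] by (intro card_mono) auto
        then show ?thesis using hyp[OF k(2) \<zeta>, of \<tau>] unfolding m_def by linarith
      qed
    qed
    have Qall: "real (card {v \<in> words A k. Q u v}) \<le> real m ^ k" for u
    proof -
      have "card {v \<in> words A k. Q u v} \<le> card (words A k)" using finite_words[OF finA] by (intro card_mono) auto
      then show ?thesis using card_words[OF finA] by (simp add: m_def flip: of_nat_power)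
    qed
    have bad: "real (card {u \<in> words A N1. \<not> good u}) \<le> \<kappa> / 2 * real m ^ N1"
      unfolding good_def b_def m_def by (rule IH[rule_format]) (use \<Theta> F' in \<open>auto simp: N1_def\<close>)
    have fw: "finite (words A N1)" by (rule finite_words[OF finA])
    have "{w \<in> words A n. \<not> (\<forall>f\<in>F. \<delta> * norm f \<le> norm (shear (\<Theta> (foldr \<psi> w x0 - x0)) f))}
      = {w \<in> words A (N1 + k). Q (take N1 w) (drop N1 w)}"
    proof -
      have "foldr \<psi> (take N1 w) (foldr \<psi> (drop N1 w) x0) = foldr \<psi> w x0" for w
        by (metis append_take_drop_id comp_apply foldr_append)
      then show ?thesis by (simp only: Q_def b_def k(1))
    qed
    then have "real (card {w \<in> words A n. \<not> (\<forall>f\<in>F. \<delta> * norm f \<le> norm (shear (\<Theta> (foldr \<psi> w x0 - x0)) f))})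
      \<le> (\<Sum>u\<in>words A N1. real (card {v \<in> words A k. Q u v}))"
      using card_words_split[OF finA, of N1 k Q] by (simp flip: of_nat_sum)
    \<comment> \<open>One half of \<kappa> pays for prefixes bad for \<open>F'\<close>, where the
      trivial bound is used, the other half for bad continuations of good prefixes.\<close>
    also have "\<dots> \<le> (\<Sum>u\<in>words A N1. \<kappa> / 2 * real m ^ k + (if good u then 0 else real m ^ k))"
    proof (rule sum_mono)
      fix u assume u: "u \<in> words A N1"
      show "real (card {v \<in> words A k. Q u v}) \<le> \<kappa> / 2 * real m ^ k + (if good u then 0 else real m ^ k)"
        using Qgood[OF u] Qall[of u] Suc.prems(2) by (auto intro: add_increasing)
    qed
    also have "\<dots> = \<kappa> / 2 * real m ^ k * real m ^ N1 + real (card {u \<in> words A N1. \<not> good u}) * real m ^ k"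
      using fw card_words[OF finA, of N1]
      by (simp add: sum.distrib sum.If_cases m_def Int_def)
    also have "\<dots> \<le> \<kappa> / 2 * real m ^ k * real m ^ N1 + \<kappa> / 2 * real m ^ N1 * real m ^ k"
      using bad by (intro add_left_mono mult_right_mono) auto
    also have "\<dots> = \<kappa> * real (card A) ^ n" by (simp add: k(1) power_add m_def)
    finally show ?thesis .
  qed
  show ?case using \<delta>(1) main by blast
qed

lemma shear_fraction_uniform:
  fixes \<psi> :: "'c \<Rightarrow> real ^ 'n ^ 'm \<Rightarrow> real ^ 'n ^ 'm"
  assumes ifs: "homogeneous_ifs A \<psi> \<rho> \<epsilon>0 K" and x0: "x0 \<in> K" and \<kappa>: "0 < \<kappa>"
  obtains \<delta> n0 where "0 < \<delta>" "\<And>n (\<Theta> :: real ^ 'n ^ 'm \<Rightarrow> real ^ 'n ^ 'm) F. n0 \<le> n \<Longrightarrow> orthogonal_transformation \<Theta> \<Longrightarrow>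
    subspace F \<Longrightarrow> dim F \<le> CARD('m) \<Longrightarrow>
    real (card {w \<in> words A n. \<not> (\<forall>f\<in>F. \<delta> * norm f \<le> norm (shear (\<Theta> (foldr \<psi> w x0 - x0)) f))})
      \<le> \<kappa> * real (card A) ^ n"
proof -
  interpret homogeneous_ifs A \<psi> \<rho> \<epsilon>0 K by fact
  define Q where "Q j \<delta> n0 \<longleftrightarrow> (\<forall>n\<ge>n0. \<forall>(\<Theta> :: real ^ 'n ^ 'm \<Rightarrow> real ^ 'n ^ 'm) F. orthogonal_transformation \<Theta> \<longrightarrow> subspace F \<longrightarrow> dim F = j \<longrightarrow>
    real (card {w \<in> words A n. \<not> (\<forall>f\<in>F. \<delta> * norm f \<le> norm (shear (\<Theta> (foldr \<psi> w x0 - x0)) f))})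
      \<le> \<kappa> * real (card A) ^ n)" for j \<delta> n0
  have "\<exists>\<delta> n0. 0 < \<delta> \<and> Q j \<delta> n0" if "j \<le> CARD('m)" for j
    using shear_fraction[OF ifs x0 that \<kappa>] unfolding Q_def by blast
  then obtain D n where Dn: "\<And>j. j \<le> CARD('m) \<Longrightarrow> 0 < D j \<and> Q j (D j) (n j)" by metis
  define \<delta> where "\<delta> = Min (D ` {..CARD('m)})"
  define n0 where "n0 = Max (n ` {..CARD('m)})"
  have \<delta>: "0 < \<delta>" using Dn by (auto simp: \<delta>_def)
  show ?thesis
  proof (rule that[OF \<delta>, of n0])
    fix k and \<Theta> :: "real ^ 'n ^ 'm \<Rightarrow> real ^ 'n ^ 'm" and F :: "((real ^ 'm) \<times> (real ^ 'n)) set"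
    assume h: "n0 \<le> k" "orthogonal_transformation \<Theta>" "subspace F" "dim F \<le> CARD('m)"
    define j where "j = dim F"
    have j: "j \<le> CARD('m)" using h by (simp add: j_def)
    have \<delta>D: "\<delta> \<le> D j" using j by (auto simp: \<delta>_def)
    have nk: "n j \<le> k" using j h(1) by (auto simp: n0_def)
    let ?B = "\<lambda>\<delta>. {w \<in> words A k. \<not> (\<forall>f\<in>F. \<delta> * norm f \<le> norm (shear (\<Theta> (foldr \<psi> w x0 - x0)) f))}"
    have "?B \<delta> \<subseteq> ?B (D j)"
    proof -
      have "\<delta> * norm f \<le> D j * norm f" for f :: "(real ^ 'm) \<times> (real ^ 'n)" using \<delta>D by (intro mult_right_mono) auto
      then show ?thesis using order_trans by blast
    qed
    then have "card (?B \<delta>) \<le> card (?B (D j))" using finite_words[OF finA] by (intro card_mono) auto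
    moreover have "real (card (?B (D j))) \<le> \<kappa> * real (card A) ^ k"
      using Dn[OF j] nk h unfolding Q_def j_def by blast
    ultimately show "real (card (?B \<delta>)) \<le> \<kappa> * real (card A) ^ k" by linarith
  qed
qed

section \<open>The Cantor set of badly approximable matrices\<close>

lemma eventually_power_ge:
  fixes a c :: real
  assumes "1 < a" shows "\<forall>\<^sub>F n in sequentially. c \<le> a ^ n"
proof -
  obtain N where "c < a ^ N" using real_arch_pow[OF assms] by blast
  moreover have "a ^ N \<le> a ^ n" if "N \<le> n" for n using that assms by (intro power_increasing) auto
  ultimately show ?thesis unfolding eventually_sequentially by (meson less_imp_le order_trans)
qed

text \<open>Stages consist of \<open>L\<close> letters, and at least half of the
  \<open>m ^ L\<close> continuations survive each stage. The loss of a factor 2 per stage is covered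
  by the strict inequality in the hypothesis on \<open>t\<close>, once \<open>L\<close> is
  large.\<close>

lemma homogeneous_dim_BA:
  fixes \<psi> :: "'c \<Rightarrow> real ^ 'n ^ 'm \<Rightarrow> real ^ 'n ^ 'm"
  assumes ifs: "homogeneous_ifs A \<psi> \<rho> \<epsilon>0 K"
    and O: "open O'" "O' \<noteq> {}" "\<And>a. a \<in> A \<Longrightarrow> \<psi> a ` O' \<subseteq> O'"
    and disj: "\<And>a b. a \<in> A \<Longrightarrow> b \<in> A \<Longrightarrow> a \<noteq> b \<Longrightarrow> \<psi> a ` O' \<inter> \<psi> b ` O' = {}"
    and t: "0 \<le> t" "1 < real (card A) * \<rho> powr t"
  shows "ennreal t \<le> hausdorff_dim (BA \<inter> K)"
proof -
  interpret homogeneous_ifs A \<psi> \<rho> \<epsilon>0 K by fact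
  obtain x0 where x0: "x0 \<in> K" using neK by blast
  define M N d where "M = CARD('m)" and "N = CARD('n)" and "d = M + N"
  have MN: "0 < M" "0 < N" "0 < d" by (simp_all add: M_def N_def d_def)
  define m where "m = card A"
  obtain C where C: "\<And>n U. bounded U \<Longrightarrow> diameter U \<le> \<rho> ^ n \<Longrightarrow>
     card {w \<in> words A n. foldr \<psi> w ` K \<inter> U \<noteq> {}} \<le> C"
    by (rule cylinder_multiplicity[OF O disj]) (assumption | rule that)+
  obtain R' where R': "\<And>z. z \<in> K \<Longrightarrow> norm z \<le> R'" "0 \<le> R'"
    using compact_imp_bounded[OF compactK] x0 unfolding bounded_iff by (meson norm_ge_zero order_trans)
  define R where "R = 2 * R'"
  have R: "norm (z - x0) \<le> R" if "z \<in> K" for z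
    using norm_triangle_ineq4[of z x0] R'(1)[OF that] R'(1)[OF x0] by (simp add: R_def)
  have R0: "0 \<le> R" using R' by (simp add: R_def)
  \<comment> \<open>Each of the \<open>d\<close> ranks below full rank may spoil a fraction
    \<open>1 / (2 * d)\<close> of the continuations, together at most half.\<close>
  have "0 < 1 / (2 * real d)" using MN by simp
  then obtain \<delta> n0 where \<delta>: "0 < \<delta>" and frac: "\<And>n (\<Theta> :: real ^ 'n ^ 'm \<Rightarrow> real ^ 'n ^ 'm) F. n0 \<le> n \<Longrightarrow>
    orthogonal_transformation \<Theta> \<Longrightarrow> subspace F \<Longrightarrow> dim F \<le> CARD('m) \<Longrightarrow>
    real (card {w \<in> words A n. \<not> (\<forall>f\<in>F. \<delta> * norm f \<le> norm (shear (\<Theta> (foldr \<psi> w x0 - x0)) f))})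
      \<le> 1 / (2 * real d) * real (card A) ^ n"
    by (rule shear_fraction_uniform[OF ifs x0]) (rule that)
  \<comment> \<open>The exponents solve \<open>x ^ M * y ^ N = 1\<close> together with
    \<open>y / x = \<rho>\<close>: the flow has determinant 1 and magnifies exactly by the
    contraction ratio.\<close>
  define x y where "x = \<rho> powr (- (real N / real d))" and "y = \<rho> powr (real M / real d)"
  have lt1: "\<rho> powr a < 1" if "0 < a" for a using powr_less_mono2[OF that, of \<rho> 1] \<rho> by simp
  have y: "0 < y" "y < 1" using \<rho> MN lt1 by (auto simp: y_def)
  have x: "1 < x" using \<rho> MN lt1[of "real N / real d"] by (simp add: x_def powr_minus_divide)
  have xy1: "x ^ M * y ^ N = 1"
    using \<rho> MN by (simp add: x_def y_def powr_powr powr_add[symmetric] mult.commute flip: powr_realpow)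
  have yx: "y = \<rho> * x"
  proof -
    have "\<rho> * x = \<rho> powr (1 + - (real N / real d))" using \<rho> unfolding powr_add x_def by simp
    also have "1 + - (real N / real d) = real M / real d" using MN by (simp add: d_def field_simps)
    finally show ?thesis by (simp add: y_def)
  qed
  have xpowr: "x = y powr (- (real N / real M))"
    using MN by (simp add: x_def y_def powr_powr)
  \<comment> \<open>Collects all constants lost in the estimate \<open>large\<close>;
    \<open>L\<close> is then taken so long that \<open>Y\<close> is below it.\<close>
  define \<theta> where "\<theta> = \<delta> ^ M * (1 / (1 + R)) ^ N"
  have \<theta>: "0 < \<theta>" using \<delta> R0 by (simp add: \<theta>_def)
  have "1 < 1 / y" using y by simp
  then have "\<forall>\<^sub>F L in sequentially. 2 \<le> (real m * \<rho> powr t) ^ L \<and> 1 / \<delta> \<le> x ^ L \<and> 1 / \<theta> \<le> (1 / y) ^ L \<and> max n0 1 \<le> L"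
    using t(2) x by (intro eventually_conj eventually_power_ge eventually_ge_at_top) (auto simp: m_def)
  then obtain L where L: "2 \<le> (real m * \<rho> powr t) ^ L" "1 / \<delta> \<le> x ^ L" "1 / \<theta> \<le> (1 / y) ^ L" "max n0 1 \<le> L"
    unfolding eventually_sequentially by blast
  define X Y \<beta> where "X = x ^ L" and "Y = y ^ L" and "\<beta> = \<rho> ^ L"
  have L0: "0 < L" using L by simp
  have XY: "0 < Y" "Y < 1" "1 \<le> X" "0 < X" using x y L0
    by (auto simp: X_def Y_def power_less_one_iff intro: one_le_power)
  have X\<delta>: "1 \<le> X * \<delta>" using L(2) \<delta> by (simp add: X_def field_simps)
  have Y\<theta>: "Y \<le> \<theta>" using L(3) y \<theta> by (simp add: Y_def power_one_over field_simps)
  have XY1: "X ^ M * Y ^ N = 1"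
  proof -
    have "X ^ M * Y ^ N = (x ^ M * y ^ N) ^ L"
      by (simp add: X_def Y_def power_mult_distrib flip: power_mult) (simp add: mult.commute)
    then show ?thesis by (simp add: xy1)
  qed
  have YX: "Y / X = \<beta>" using x by (simp add: X_def Y_def \<beta>_def yx power_mult_distrib)
  have \<beta>: "0 < \<beta>" "\<beta> < 1" using \<rho> L0 by (auto simp: \<beta>_def power_less_one_iff)
  \<comment> \<open>Below full rank at least one factor \<open>Y\<close> is missing, so
    \<open>X ^ M * Y ^ (i - M)\<close> is at least \<open>1 / Y\<close>, which pays for
    \<open>1 / \<theta>\<close>.\<close>
  have large: "1 \<le> (X * \<delta>) ^ M * (Y / (1 + R)) ^ (i - M)" if i: "M \<le> i" "i < d" for i
  proof -
    have le: "i - M < N" using i by (auto simp: d_def)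
    have "Y * Y ^ (i - M) \<ge> Y ^ N"
      using power_decreasing[of "Suc (i - M)" N Y] le XY by simp
    then have "X ^ M * Y ^ N \<le> X ^ M * (Y * Y ^ (i - M))" using XY by (intro mult_left_mono) auto
    then have "1 \<le> X ^ M * Y ^ (i - M) * Y" by (simp add: XY1 mult_ac)
    also have "\<dots> \<le> X ^ M * Y ^ (i - M) * (\<delta> ^ M * (1 / (1 + R)) ^ (i - M))"
    proof (intro mult_left_mono)
      have "(1 / (1 + R)) ^ N \<le> (1 / (1 + R)) ^ (i - M)" using le R0 by (intro power_decreasing) auto
      then have "\<theta> \<le> \<delta> ^ M * (1 / (1 + R)) ^ (i - M)" unfolding \<theta>_def using \<delta> by (intro mult_left_mono) auto
      then show "Y \<le> \<delta> ^ M * (1 / (1 + R)) ^ (i - M)" using Y\<theta> by linarith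
    qed (use XY in auto)
    finally show ?thesis by (simp add: power_mult_distrib power_divide mult_ac)
  qed
  \<comment> \<open>The reserve \<open>exp \<eta>\<close> is exactly the inverse of the worst
    contraction in one stage.\<close>
  define \<eta> where "\<eta> = - ln ((Y / (2 + R)) ^ d)"
  \<comment> \<open>Puts the whole profile below the covolumes of the initial lattice, sheared by
    \<open>x0\<close>, and below the full-rank bound valid at every stage.\<close>
  define T where "T = real d * ln (2 + R')"
  have YR: "0 < Y / (2 + R)" "Y / (2 + R) \<le> 1" using XY R0 by (auto simp: field_simps)
  have \<eta>: "1 \<le> (Y / (2 + R)) ^ d * exp \<eta>" "0 \<le> \<eta>"
  proof -
    define e where "e = (Y / (2 + R)) ^ d"
    have "0 < e" "e \<le> 1" unfolding e_def using YR by (auto intro: power_le_one zero_less_power)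
    then show "1 \<le> (Y / (2 + R)) ^ d * exp \<eta>" "0 \<le> \<eta>"
      unfolding \<eta>_def e_def[symmetric] by (simp_all add: exp_minus)
  qed
  have T: "0 \<le> T" using R' by (simp add: T_def)
  have eT: "exp (- T) = (1 / (2 + R')) ^ d"
  proof -
    have "exp (- T) = inverse (exp (ln (2 + R')) ^ d)" by (simp add: T_def exp_minus exp_of_nat_mult)
    then show ?thesis using R' by (simp add: power_one_over divide_inverse power_inverse)
  qed
  have prof_le: "profile T \<eta> d i \<le> (1 / (2 + R')) ^ d" if "i \<le> d" for i
  proof -
    have "0 \<le> \<eta> * (real i * (real d - real i))" using that \<eta>(2) by simp
    then show ?thesis unfolding eT[symmetric] profile_def by simp
  qed
  define G where "G n w = flow (X ^ n) (Y ^ n) (foldr \<psi> w x0)" for n w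
  define P where "P n w \<longleftrightarrow> w \<in> words A (n * L) \<and> thick (profile T \<eta> d) (G n w)" for n w
  have sim_w: "similarity_with_ratio (\<beta> ^ n) (foldr \<psi> w)" if "w \<in> words A (n * L)" for n w
    using sim_foldr[OF that] by (simp add: \<beta>_def power_mult mult.commute)
  have P0: "P 0 []"
  proof -
    have "thick (profile T \<eta> d) (G 0 [])" unfolding thick_def
    proof (intro allI impI)
      fix vs :: "((real ^ 'm) \<times> (real ^ 'n)) list" assume vs: "\<forall>v\<in>set vs. intvec v" "lindep vs"
      have len: "length vs \<le> d" using vs(2) dim_subset_UNIV[of "set vs"] by (simp add: lindep_def d_def M_def N_def)
      have "profile T \<eta> d (length vs) \<le> (1 / (2 + R')) ^ d" by (rule prof_le[OF len])
      also have "\<dots> \<le> (1 / (2 + R')) ^ length vs * 1" using R' len power_decreasing[of "length vs" d "1 / (2 + R')"] by simp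
      also have "\<dots> \<le> (1 / (2 + R')) ^ length vs * rcovol {} vs"
        using rcovol_integer_ge_1[OF vs] R' by (intro mult_left_mono) auto
      also have "\<dots> \<le> rcovol {} (map (G 0 []) vs)"
        unfolding G_def using flow_norm_ge[OF R'(1)[OF x0], of 1 1] R'
        by (intro rcovol_linear_ge[OF linear_flow]) auto
      finally show "profile T \<eta> d (length vs) \<le> rcovol {} (map (G 0 []) vs)" .
    qed
    then show ?thesis by (simp add: P_def words_def)
  qed
  have half: "real m ^ L / 2 \<le> real (card {a \<in> words A L. P (Suc n) (w @ a)})" if Pw: "P n w" for n w
  proof -
    have w: "w \<in> words A (n * L)" and th: "thick (profile T \<eta> d) (G n w)" using Pw by (auto simp: P_def)
    obtain \<Theta> c where \<Theta>: "orthogonal_transformation \<Theta>" "\<And>z. foldr \<psi> w z = \<beta> ^ n *\<^sub>R \<Theta> z + c"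
      using sim_w[OF w] by (auto simp: similarity_with_ratio_def)
    have lin\<Theta>: "linear \<Theta>" by (rule orthogonal_transformation_linear[OF \<Theta>(1)])
    define b where "b a = \<Theta> (foldr \<psi> a x0 - x0)" for a
    \<comment> \<open>The cylinder map of \<open>w\<close> has linear part \<Theta> scaled by
      \<open>(Y / X) ^ n\<close>, so the renormalisation identity turns the continuation
      \<open>a\<close> into a shear of size at most \<open>R\<close>, rotated by \<Theta>.\<close>
    have Gstep: "G (Suc n) (w @ a) = flow X Y (b a) \<circ> G n w" for a
    proof
      fix v
      have "foldr \<psi> (w @ a) x0 = foldr \<psi> w x0 + (Y ^ n / X ^ n) *\<^sub>R b a"
        using \<Theta>(2) YX by (simp add: b_def linear_diff[OF lin\<Theta>] algebra_simps flip: power_divide)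
      then show "G (Suc n) (w @ a) v = (flow X Y (b a) \<circ> G n w) v"
        using XY by (simp add: G_def flow_flow)
    qed
    obtain F where F: "\<And>i. i < d \<Longrightarrow> subspace (F i) \<and> dim (F i) \<le> CARD('m)"
      and step: "\<And>b. norm b \<le> R \<Longrightarrow> (\<And>i v. i < d \<Longrightarrow> v \<in> F i \<Longrightarrow> \<delta> * norm v \<le> norm (shear b v)) \<Longrightarrow>
        (\<And>vs. \<forall>v\<in>set vs. intvec v \<Longrightarrow> lindep vs \<Longrightarrow> length vs = d \<Longrightarrow>
         profile T \<eta> d d \<le> rcovol {} (map (flow X Y b \<circ> G n w) vs)) \<Longrightarrow>
        thick (profile T \<eta> d) (flow X Y b \<circ> G n w)"
    proof (rule thick_step[where 'm = 'm and 'n = 'n and G = "G n w" and T = T and \<eta> = \<eta> and X = X and Y = Y and \<delta> = \<delta> and R = R,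
          folded M_def N_def, folded d_def])
      show "linear (G n w)" unfolding G_def by (rule linear_flow)
      show "Y \<le> X" using XY by linarith
      show "thick (profile T \<eta> d) (G n w)" by fact
    qed (use \<eta> T XY \<delta> X\<delta> R0 large in \<open>auto simp: M_def\<close>)
    define Bad where "Bad i = {a \<in> words A L. \<not> (\<forall>f\<in>F i. \<delta> * norm f \<le> norm (shear (\<Theta> (foldr \<psi> a x0 - x0)) f))}" for i
    have sub: "words A L - (\<Union>i<d. Bad i) \<subseteq> {a \<in> words A L. P (Suc n) (w @ a)}"
    proof
      fix a assume a: "a \<in> words A L - (\<Union>i<d. Bad i)"
      then have wa: "w @ a \<in> words A (Suc n * L)" using words_append[OF w, of a L] by (simp add: add.commute)
      have "thick (profile T \<eta> d) (flow X Y (b a) \<circ> G n w)"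
      proof (rule step)
        show "norm (b a) \<le> R" using R[OF foldr_inK[of a L x0]] a x0 orthogonal_transformation_norm[OF \<Theta>(1)] by (simp add: b_def)
        show "\<delta> * norm v \<le> norm (shear (b a) v)" if "i < d" "v \<in> F i" for i v
          using a that by (auto simp: Bad_def b_def)
        fix vs :: "((real ^ 'm) \<times> (real ^ 'n)) list" assume vs: "\<forall>v\<in>set vs. intvec v" "lindep vs" "length vs = d"
        have "profile T \<eta> d d \<le> (1 / (2 + R')) ^ d" by (rule prof_le) simp
        also have "\<dots> \<le> (1 / (2 + R')) ^ N" using R' by (intro power_decreasing) (auto simp: d_def)
        also have "\<dots> \<le> (1 / (1 + R')) ^ N" using R' by (intro power_mono) (auto intro: divide_left_mono)
        also have "\<dots> \<le> rcovol {} (map (flow (X ^ Suc n) (Y ^ Suc n) (foldr \<psi> (w @ a) x0)) vs)"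
          unfolding N_def
        proof (rule flow_full_rank[OF _ _ _ _ vs(1,2)])
          show "norm (foldr \<psi> (w @ a) x0) \<le> R'" by (rule R'(1)[OF foldr_inK[OF wa x0]])
          have "(X ^ Suc n) ^ M * (Y ^ Suc n) ^ N = (X ^ M * Y ^ N) ^ Suc n"
            by (simp only: power_mult_distrib power_mult[symmetric] mult.commute)
          then show "(X ^ Suc n) ^ CARD('m) * (Y ^ Suc n) ^ CARD('n) = 1"
            by (simp only: XY1 power_one M_def[symmetric] N_def[symmetric])
        qed (use XY vs in \<open>auto simp: d_def M_def N_def\<close>)
        finally show "profile T \<eta> d d \<le> rcovol {} (map (flow X Y (b a) \<circ> G n w) vs)"
          using Gstep[of a] by (simp add: G_def)
      qed
      then show "a \<in> {a \<in> words A L. P (Suc n) (w @ a)}" using a wa Gstep[of a] by (simp add: P_def)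
    qed
    have fw: "finite (words A L)" by (rule finite_words[OF finA])
    have "real (card (\<Union>i<d. Bad i)) \<le> (\<Sum>i<d. real (card (Bad i)))"
      using card_UN_le[of "{..<d}" Bad] by (simp flip: of_nat_sum)
    also have "\<dots> \<le> (\<Sum>i<d. 1 / (2 * real d) * real m ^ L)"
      unfolding Bad_def m_def using L(4) \<Theta>(1) F by (intro sum_mono frac) auto
    also have "\<dots> = real m ^ L / 2" using MN by simp
    finally have "real (card (\<Union>i<d. Bad i)) \<le> real m ^ L / 2" .
    moreover have "card (words A L) \<le> card (words A L - (\<Union>i<d. Bad i)) + card (\<Union>i<d. Bad i)"
      using diff_card_le_card_Diff[of "\<Union>i<d. Bad i" "words A L"] fw by (simp add: Bad_def)
    moreover have "card (words A L - (\<Union>i<d. Bad i)) \<le> card {a \<in> words A L. P (Suc n) (w @ a)}"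
      using sub fw by (intro card_mono) auto
    moreover have "real (card (words A L)) = real m ^ L" using card_words[OF finA] by (simp add: m_def)
    ultimately show ?thesis by linarith
  qed
  \<comment> \<open>Half of \<open>m ^ L\<close> rounded up; exactly this many children are kept,
    since the tree argument needs constant branching.\<close>
  define q where "q = (m ^ L + 1) div 2"
  define PP where "PP w \<longleftrightarrow> P (length w div L) w" for w
  have PPn: "P n w \<Longrightarrow> PP w \<and> length w div L = n" for n w
    using L0 by (auto simp: P_def PP_def words_def)
  define ext where "ext w D \<longleftrightarrow> finite D \<and> card D = q \<and>
    D \<subseteq> {w @ a |a. a \<in> words A L \<and> P (Suc (length w div L)) (w @ a)}" for w D
  have "\<exists>D. ext w D" if w: "PP w" for w
  proof -
    let ?B = "{a \<in> words A L. P (Suc (length w div L)) (w @ a)}"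
    have "real m ^ L / 2 \<le> real (card ?B)" using half w by (simp add: PP_def)
    then have "m ^ L \<le> 2 * card ?B" by (simp flip: of_nat_power of_nat_le_iff[where 'a = real])
    then have "q \<le> card ?B" by (simp add: q_def)
    then obtain D where D: "D \<subseteq> ?B" "card D = q" "finite D" by (rule obtain_subset_with_card_n)
    have "card ((@) w ` D) = q" using D by (simp add: card_image inj_on_def)
    then show ?thesis using D unfolding ext_def by (intro exI[of _ "(@) w ` D"]) auto
  qed
  then obtain ch where "\<And>w. PP w \<Longrightarrow> ext w (ch w)" by metis
  then have ch: "\<And>w. PP w \<Longrightarrow> finite (ch w) \<and> card (ch w) = q \<and>
    ch w \<subseteq> {w @ a |a. a \<in> words A L \<and> P (Suc (length w div L)) (w @ a)}"
    unfolding ext_def by blast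
  have lev: "P n w" if "w \<in> tree_level ch [] n" for n w
    using that
  proof (induction n arbitrary: w)
    case (Suc n)
    then obtain v where v: "P n v" "w \<in> ch v" by auto
    then show ?case using ch[of v] PPn[OF v(1)] by auto
  qed (use P0 in simp)
  define S where "S w = foldr \<psi> w ` K" for w
  define E where "E = {z. \<forall>n. \<exists>v\<in>tree_level ch [] n. z \<in> S v}"
  have "hausdorff_measure s E \<noteq> 0" if s: "0 \<le> s" "s < t" for s
    unfolding E_def
  proof (rule hausdorff_measure_tree[where P = PP and \<beta> = \<beta> and q = q and C = C])
    show "PP []" using PPn[OF P0] by simp
    show "finite (ch v) \<and> card (ch v) = q \<and> (\<forall>u\<in>ch v. PP u \<and> S u \<subseteq> S v)" if "PP v" for v
    proof -
      have "PP u \<and> S u \<subseteq> S v" if u: "u \<in> ch v" for u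
      proof -
        obtain a where a: "u = v @ a" "a \<in> words A L" "P (Suc (length v div L)) u" using ch[OF \<open>PP v\<close>] u by blast
        then show ?thesis using PPn[OF a(3)] foldr_inK[OF a(2)] by (auto simp: S_def)
      qed
      then show ?thesis using ch[OF that] by blast
    qed
    show "compact (S v) \<and> S v \<noteq> {}" if "PP v" for v
    proof -
      have sv: "similarity_with_ratio (\<beta> ^ (length v div L)) (foldr \<psi> v)" using that sim_w by (simp add: PP_def P_def)
      have "(\<beta> ^ (length v div L))-lipschitz_on K (foldr \<psi> v)"
        using similarity_with_ratio_dist[OF sv] \<beta> by (intro lipschitz_onI) auto
      then show ?thesis using compactK neK unfolding S_def
        by (auto intro: compact_continuous_image lipschitz_on_continuous_on)
    qed
    \<comment> \<open>Children extend their parents, and nodes of one level have the same length, so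
      a common child would make the parents equal.\<close>
    show "ch v \<inter> ch v' = {}" if "v \<in> tree_level ch [] n" "v' \<in> tree_level ch [] n" "v \<noteq> v'" for n v v'
    proof -
      have "P n v" "P n v'" using lev that by auto
      then have "length v = length v'" "PP v" "PP v'" using PPn by (auto simp: P_def words_def)
      then show ?thesis using ch[of v] ch[of v'] that(3) by fastforce
    qed
    show "card {v \<in> tree_level ch [] n. S v \<inter> U \<noteq> {}} \<le> C" if U: "bounded U" "diameter U \<le> \<beta> ^ n" for n U
    proof -
      have "card {v \<in> tree_level ch [] n. S v \<inter> U \<noteq> {}} \<le> card {w \<in> words A (n * L). foldr \<psi> w ` K \<inter> U \<noteq> {}}"
        using lev finite_words[OF finA] by (intro card_mono) (auto simp: P_def S_def)
      also have "\<dots> \<le> C" using U by (intro C) (auto simp: \<beta>_def mult.commute simp flip: power_mult)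
      finally show ?thesis .
    qed
    have "1 \<le> (real m * \<rho> powr t) ^ L / 2" using L(1) by simp
    also have "\<dots> = real m ^ L / 2 * \<beta> powr t"
      using \<rho> by (simp add: \<beta>_def power_mult_distrib powr_powr mult.commute flip: powr_realpow)
    also have "\<dots> \<le> real q * \<beta> powr s"
    proof (intro mult_mono)
      have "m ^ L \<le> 2 * q" by (simp add: q_def)
      then show "real m ^ L / 2 \<le> real q" by (simp flip: of_nat_power)
      show "\<beta> powr t \<le> \<beta> powr s" using \<beta> s by (intro powr_mono') auto
    qed auto
    finally show "1 \<le> real q * \<beta> powr s" .
  qed (use \<beta> s in auto)
  then have "ennreal t \<le> hausdorff_dim E" by (rule hausdorff_dim_ge)
  also have "E \<subseteq> BA \<inter> K"
  proof
    fix z assume z: "z \<in> E"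
    then have "\<exists>v\<in>tree_level ch [] 0. z \<in> S v" unfolding E_def by blast
    then have zK: "z \<in> K" by (simp add: S_def)
    have "\<exists>v. P n v \<and> z \<in> S v" for n using z lev unfolding E_def by blast
    then obtain v where v: "\<And>n. P n (v n) \<and> z \<in> S (v n)" by metis
    \<comment> \<open>Rank 1 of the profile bounds all nonzero vectors of the flowed lattices from
      below along the approximations \<open>foldr \<psi> (v n) x0\<close>.\<close>
    have "badly_approximable z"
    proof (rule badly_approximable_if_bounded_orbit[where X = X and Y = Y and R = R and \<epsilon> = "profile T \<eta> d 1" and c = "\<lambda>n. foldr \<psi> (v n) x0"])
      show "X = Y powr - (real CARD('n) / real CARD('m))"
        using y by (simp add: X_def Y_def xpowr M_def N_def powr_powr mult.commute flip: powr_realpow)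
      show "norm (z - foldr \<psi> (v n) x0) \<le> R * (Y / X) ^ n" for n
      proof -
        obtain k where k: "k \<in> K" "z = foldr \<psi> (v n) k" using v by (auto simp: S_def)
        have "similarity_with_ratio (\<beta> ^ n) (foldr \<psi> (v n))" using v sim_w by (simp add: P_def)
        then have "norm (z - foldr \<psi> (v n) x0) = \<beta> ^ n * norm (k - x0)"
          using similarity_with_ratio_dist[of "\<beta> ^ n" "foldr \<psi> (v n)" k x0] by (simp add: dist_norm k(2))
        also have "\<dots> \<le> \<beta> ^ n * R" using R[OF k(1)] \<beta> by (intro mult_left_mono) auto
        finally show ?thesis by (simp add: YX mult.commute)
      qed
      show "profile T \<eta> d 1 \<le> norm (flow (X ^ n) (Y ^ n) (foldr \<psi> (v n) x0) u)" if "intvec u" "u \<noteq> 0" for n u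
      proof -
        have "lindep [u]" using that by (simp add: lindep_Cons lindep_Nil)
        then have "profile T \<eta> d (length [u]) \<le> rcovol {} (map (G n (v n)) [u])"
          using v[of n] that unfolding P_def thick_def by (metis empty_iff empty_set list.set_intros(1) set_ConsD)
        then show ?thesis by (simp add: G_def infdist_def)
      qed
    qed (use XY R0 profile_pos in auto)
    then show "z \<in> BA \<inter> K" using zK by (simp add: BA_def)
  qed
  then have "hausdorff_dim E \<le> hausdorff_dim (BA \<inter> K)" by (rule hausdorff_dim_mono)
  finally show ?thesis .
qed

section \<open>Reduction to homogeneous families\<close>

text \<open>Compactness of the unit sphere of pairs \<open>(\<xi>, \<tau>)\<close>, on which no
  affine function vanishes on all of \<open>K\<close>. Pairs with unit \<xi> have norm at least 1,
  so homogeneity extends the bound to unbounded \<tau>.\<close>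

lemma nonplanar_uniform:
  fixes K :: "'a::euclidean_space set"
  assumes "K \<noteq> {}" "affine hull K = UNIV"
  obtains \<epsilon> where "0 < \<epsilon>" "\<And>\<xi> \<tau>. norm \<xi> = 1 \<Longrightarrow> \<exists>z\<in>K. \<epsilon> \<le> \<bar>\<xi> \<bullet> z + \<tau>\<bar>"
proof -
  define ell where "ell z p = fst p \<bullet> z + snd p" for z :: 'a and p :: "'a \<times> real"
  define S where "S = sphere (0 :: 'a \<times> real) 1"
  have cont: "continuous_on UNIV (ell z)" for z unfolding ell_def by (intro continuous_intros)
  have ex: "\<exists>z\<in>K. ell z p \<noteq> 0" if p: "p \<noteq> 0" for p
  proof (rule ccontr)
    assume "\<not> ?thesis"
    then have *: "\<forall>z\<in>K. fst p \<bullet> z = - snd p" by (auto simp: ell_def eq_neg_iff_add_eq_0)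
    show False
    proof (cases "fst p = 0")
      case True
      then have "p = 0" using * \<open>K \<noteq> {}\<close> by (auto simp: prod_eq_iff)
      then show False using p by simp
    next
      case False
      have "affine hull K \<subseteq> {z. fst p \<bullet> z = - snd p}" using * by (intro hull_minimal) (auto simp: affine_hyperplane)
      then have "fst p \<bullet> 0 = - snd p" "fst p \<bullet> fst p = - snd p" using assms(2) by blast+
      then show False using False by simp
    qed
  qed
  have "S \<subseteq> (\<Union>z\<in>K. {p. ell z p \<noteq> 0})"
  proof
    fix p assume "p \<in> S"
    then have "p \<noteq> 0" by (auto simp: S_def)
    then show "p \<in> (\<Union>z\<in>K. {p. ell z p \<noteq> 0})" using ex by blast
  qed
  moreover have "open {p. ell z p \<noteq> 0}" for z
    using cont by (intro open_Collect_neq continuous_on_const)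
  moreover have "compact S" by (simp add: S_def)
  ultimately obtain Z where Z: "Z \<subseteq> K" "finite Z" "S \<subseteq> (\<Union>z\<in>Z. {p. ell z p \<noteq> 0})"
    by (metis (no_types, lifting) compactE_image)
  \<comment> \<open>Finitely many points detect every affine function; the minimum of the sum over
    the sphere is positive, and at some point at least the average is attained.\<close>
  define g where "g p = (\<Sum>z\<in>Z. \<bar>ell z p\<bar>)" for p
  obtain b :: 'a where "b \<in> Basis" using nonempty_Basis by blast
  then have "(b, 0) \<in> S" by (simp add: S_def norm_Pair)
  then have neS: "S \<noteq> {}" by blast
  have "continuous_on S g" unfolding g_def using cont continuous_on_subset
    by (intro continuous_intros) blast
  then obtain p0 where p0: "p0 \<in> S" "\<forall>p\<in>S. g p0 \<le> g p"
    using continuous_attains_inf[OF \<open>compact S\<close> neS] by blast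
  obtain z0 where z0: "z0 \<in> Z" "ell z0 p0 \<noteq> 0" using Z(3) p0(1) by blast
  have "\<bar>ell z0 p0\<bar> \<le> g p0" unfolding g_def using z0(1) Z(2) by (intro member_le_sum) auto
  then have c: "0 < g p0" using z0 by linarith
  have cZ: "0 < card Z" using z0 Z(2) by (auto simp: card_gt_0_iff)
  define \<epsilon> where "\<epsilon> = g p0 / real (card Z)"
  have "0 < \<epsilon>" using c cZ by (simp add: \<epsilon>_def)
  moreover have "\<exists>z\<in>K. \<epsilon> \<le> \<bar>\<xi> \<bullet> z + \<tau>\<bar>" if \<xi>: "norm \<xi> = 1" for \<xi> \<tau>
  proof (rule ccontr)
    assume "\<not> ?thesis"
    then have lt: "\<bar>ell z (\<xi>, \<tau>)\<bar> < \<epsilon>" if "z \<in> Z" for z using that Z(1) by (force simp: ell_def)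
    define l where "l = norm (\<xi>, \<tau>)"
    have l: "1 \<le> l" using norm_fst_le[of \<xi> \<tau>] \<xi> by (simp add: l_def)
    have "g ((1 / l) *\<^sub>R (\<xi>, \<tau>)) = (\<Sum>z\<in>Z. 1 / l * \<bar>ell z (\<xi>, \<tau>)\<bar>)"
      unfolding g_def
    proof (rule sum.cong[OF refl])
      fix z
      have "ell z ((1 / l) *\<^sub>R (\<xi>, \<tau>)) = 1 / l * ell z (\<xi>, \<tau>)" by (simp add: ell_def distrib_left add_divide_distrib)
      then show "\<bar>ell z ((1 / l) *\<^sub>R (\<xi>, \<tau>))\<bar> = 1 / l * \<bar>ell z (\<xi>, \<tau>)\<bar>" using l by (simp only: abs_mult) simp
    qed
    also have "\<dots> \<le> (\<Sum>z\<in>Z. 1 * \<bar>ell z (\<xi>, \<tau>)\<bar>)" using l by (intro sum_mono mult_right_mono) auto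
    also have "\<dots> < (\<Sum>z\<in>Z. \<epsilon>)" using lt z0 Z(2) by (intro sum_strict_mono) auto
    also have "\<dots> = g p0" using cZ by (simp add: \<epsilon>_def)
    finally have "g ((1 / l) *\<^sub>R (\<xi>, \<tau>)) < g p0" .
    moreover have "(1 / l) *\<^sub>R (\<xi>, \<tau>) \<in> S" using l by (simp add: S_def l_def[symmetric] del: scaleR_Pair)
    ultimately show False using p0(2) by force
  qed
  ultimately show ?thesis by (rule that)
qed

text \<open>Each map sends the affine hull of \<open>K\<close> into itself and preserves its
  dimension, hence onto itself. Were it proper, it would alone form an invariant collection.\<close>

lemma affine_hull_attractor:
  fixes K :: "'a::euclidean_space set"
  assumes sim: "\<And>i. i \<in> I \<Longrightarrow> similarity_with_ratio (r i) (\<phi> i)" and irr: "irreducible_family I \<phi>"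
    and K: "is_attractor I \<phi> K"
  shows "affine hull K = UNIV"
proof (rule ccontr)
  assume ne: "affine hull K \<noteq> UNIV"
  have "\<phi> i ` (affine hull K) = affine hull K" if i: "i \<in> I" for i
  proof -
    obtain \<Theta> c where *: "0 < r i" "orthogonal_transformation \<Theta>" "\<And>x. \<phi> i x = r i *\<^sub>R \<Theta> x + c"
      using sim[OF i] by (auto simp: similarity_with_ratio_def)
    define f where "f x = r i *\<^sub>R \<Theta> x" for x
    have lf: "linear f" unfolding f_def by (intro linear_compose_scale_right orthogonal_transformation_linear *)
    have "\<phi> i = (+) c \<circ> f" using *(3) by (auto simp: f_def add.commute)
    then have im: "\<phi> i ` T = (+) c ` f ` T" for T by (simp add: image_comp)
    have inj: "inj f" unfolding f_def using *(1) orthogonal_transformation_inj[OF *(2)] by (auto simp: inj_def)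
    have hull: "\<phi> i ` (affine hull K) = affine hull (\<phi> i ` K)"
      unfolding im using affine_hull_linear_image[of f K] lf
      by (simp add: affine_hull_translation linear_conv_bounded_linear)
    have "\<phi> i ` K \<subseteq> K" using K i by (auto simp: is_attractor_def)
    then have sub: "\<phi> i ` (affine hull K) \<subseteq> affine hull K" unfolding hull by (rule hull_mono)
    have "aff_dim (\<phi> i ` (affine hull K)) = aff_dim (affine hull K)"
      unfolding im aff_dim_translation_eq using lf inj by (rule aff_dim_injective_linear_image)
    moreover have "affine (\<phi> i ` (affine hull K))" unfolding hull by (rule affine_affine_hull)
    ultimately show ?thesis using sub K by (intro affine_dim_equal) (auto simp: is_attractor_def)
  qed
  moreover have "affine hull K \<noteq> {}" using K by (simp add: is_attractor_def)
  ultimately show False using irr ne unfolding irreducible_family_def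
    by (auto dest!: spec[of _ "{affine hull K}"])
qed

section \<open>Contraction ratios of words and similarity dimension\<close>

lemma sum_words_Suc:
  assumes "finite A"
  shows "(\<Sum>w\<in>words A (Suc n). f w) = (\<Sum>a\<in>A. \<Sum>v\<in>words A n. f (a # v))"
proof -
  have "words A (Suc n) = (\<lambda>(a, v). a # v) ` (A \<times> words A n)"
  proof
    show "words A (Suc n) \<subseteq> (\<lambda>(a, v). a # v) ` (A \<times> words A n)"
    proof
      fix w assume "w \<in> words A (Suc n)"
      then obtain a v where "w = a # v" "a \<in> A" "v \<in> words A n" by (cases w) (auto simp: words_def)
      then show "w \<in> (\<lambda>(a, v). a # v) ` (A \<times> words A n)" by force
    qed
  qed (auto simp: words_def)
  moreover have "inj_on (\<lambda>(a, v). a # v) (A \<times> words A n)" by (auto simp: inj_on_def)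
  ultimately show ?thesis by (simp add: sum.reindex sum.cartesian_product case_prod_unfold)
qed

lemma prod_list_count:
  fixes r :: "'c \<Rightarrow> 'b::comm_monoid_mult"
  assumes "finite I" shows "set w \<subseteq> I \<Longrightarrow> prod_list (map r w) = (\<Prod>i\<in>I. r i ^ count_list w i)"
proof (induction w)
  case (Cons a w)
  have "(\<Prod>i\<in>I. r i ^ count_list (a # w) i) = (\<Prod>i\<in>I. (if i = a then r i else 1) * r i ^ count_list w i)"
    by (intro prod.cong) auto
  also have "\<dots> = r a * (\<Prod>i\<in>I. r i ^ count_list w i)"
    using Cons.prems assms by (simp add: prod.distrib)
  finally show ?case using Cons by simp
qed simp

text \<open>The ratio depends only on how often each letter occurs, and each count lies between 0
  and \<open>n\<close>.\<close>

lemma card_ratios_le: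
  fixes r :: "'c \<Rightarrow> real"
  assumes "finite I"
  shows "card ((\<lambda>w. prod_list (map r w)) ` words I n) \<le> (n + 1) ^ card I"
proof -
  have "(\<lambda>w. prod_list (map r w)) ` words I n \<subseteq> (\<lambda>c. \<Prod>i\<in>I. r i ^ c i) ` (PiE I (\<lambda>_. {..n}))"
  proof
    fix y assume "y \<in> (\<lambda>w. prod_list (map r w)) ` words I n"
    then obtain w where w: "set w \<subseteq> I" "length w = n" "y = prod_list (map r w)" by (auto simp: words_def)
    then have "y = (\<Prod>i\<in>I. r i ^ restrict (count_list w) I i)" using prod_list_count[OF assms w(1), of r] by simp
    moreover have "restrict (count_list w) I \<in> PiE I (\<lambda>_. {..n})"
      using count_le_length[of w] w(2) by auto
    ultimately show "y \<in> (\<lambda>c. \<Prod>i\<in>I. r i ^ c i) ` (PiE I (\<lambda>_. {..n}))" by blast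
  qed
  then have "card ((\<lambda>w. prod_list (map r w)) ` words I n) \<le> card (PiE I (\<lambda>_. {..n}))"
    using assms by (intro surj_card_le finite_PiE) auto
  also have "\<dots> = (n + 1) ^ card I" using assms by (simp add: card_PiE)
  finally show ?thesis .
qed

lemma words_0: "words A 0 = {[]}"
  by (auto simp: words_def)

locale similarity_ifs =
  fixes I :: "'c set" and \<phi> :: "'c \<Rightarrow> 'a::euclidean_space \<Rightarrow> 'a" and r :: "'c \<Rightarrow> real" and K :: "'a set"
  assumes finI: "finite I" and r: "\<And>i. i \<in> I \<Longrightarrow> 0 < r i \<and> r i < 1"
    and sim: "\<And>i. i \<in> I \<Longrightarrow> similarity_with_ratio (r i) (\<phi> i)"
    and attractor: "is_attractor I \<phi> K"
begin

abbreviation ratio :: "'c list \<Rightarrow> real" where "ratio w \<equiv> prod_list (map r w)"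

lemma neK: "K \<noteq> {}" and compactK: "compact K" and KU: "K = (\<Union>i\<in>I. \<phi> i ` K)"
  using attractor by (auto simp: is_attractor_def)

lemma neI: "I \<noteq> {}"
  using neK KU by auto

definition rmax :: real where "rmax = Max (r ` I)"

lemma rmax: "0 < rmax" "rmax < 1" "\<And>i. i \<in> I \<Longrightarrow> r i \<le> rmax"
proof -
  have "rmax \<in> r ` I" unfolding rmax_def using finI neI by (intro Max_in) auto
  then show "0 < rmax" "rmax < 1" using r by auto
  show "r i \<le> rmax" if "i \<in> I" for i unfolding rmax_def using finI that by (intro Max_ge) auto
qed

lemma ratio_bounds: "w \<in> words I n \<Longrightarrow> 0 < ratio w \<and> ratio w \<le> rmax ^ n"
proof (induction n arbitrary: w)
  case (Suc n)
  then obtain a v where w: "w = a # v" "a \<in> I" "v \<in> words I n" by (cases w) (auto simp: words_def)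
  have "r a * ratio v \<le> rmax * rmax ^ n" using Suc.IH[OF w(3)] rmax w r[OF w(2)] by (intro mult_mono) auto
  then show ?case using Suc.IH[OF w(3)] w r[OF w(2)] by simp
qed (simp add: words_def)

lemma sim_word: "w \<in> words I n \<Longrightarrow> similarity_with_ratio (ratio w) (foldr \<phi> w)"
proof (induction n arbitrary: w)
  case 0
  then show ?case by (simp add: words_def similarity_with_ratio_id id_def)
next
  case (Suc n)
  then obtain a v where "w = a # v" "a \<in> I" "v \<in> words I n" by (cases w) (auto simp: words_def)
  then show ?case using similarity_with_ratio_compose[OF sim Suc.IH] by (simp add: comp_def)
qed

lemma word_inK: "w \<in> words I n \<Longrightarrow> foldr \<phi> w ` K \<subseteq> K"
  using KU by (intro foldr_image_subset) auto

lemma K_words: "K = (\<Union>w\<in>words I n. foldr \<phi> w ` K)"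
proof
  show "K \<subseteq> (\<Union>w\<in>words I n. foldr \<phi> w ` K)"
  proof (induction n)
    case (Suc n)
    show ?case
    proof
      fix z assume "z \<in> K"
      then have "z \<in> (\<Union>i\<in>I. \<phi> i ` K)" unfolding KU[symmetric] .
      then obtain i y where i: "i \<in> I" "y \<in> K" "z = \<phi> i y" by blast
      then obtain v x where "v \<in> words I n" "x \<in> K" "y = foldr \<phi> v x" using Suc by blast
      then show "z \<in> (\<Union>w\<in>words I (Suc n). foldr \<phi> w ` K)"
        using i by (intro UN_I[of "i # v"]) (auto simp: words_def)
    qed
  qed (simp add: words_def)
qed (use word_inK in blast)

lemma diameter_word:
  assumes "w \<in> words I n"
  shows "bounded (foldr \<phi> w ` K)" "diameter (foldr \<phi> w ` K) \<le> ratio w * diameter K"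
proof -
  have bK: "bounded K" using compactK by (rule compact_imp_bounded)
  show "bounded (foldr \<phi> w ` K)" using bounded_subset[OF bK word_inK[OF assms]] .
  have "dist x y \<le> ratio w * diameter K" if xy: "x \<in> foldr \<phi> w ` K" "y \<in> foldr \<phi> w ` K" for x y
  proof -
    obtain x' y' where "x' \<in> K" "y' \<in> K" "x = foldr \<phi> w x'" "y = foldr \<phi> w y'" using xy by blast
    then show ?thesis using similarity_with_ratio_dist[OF sim_word[OF assms]] diameter_bounded_bound[OF bK]
       ratio_bounds[OF assms] by (simp add: mult_left_mono)
  qed
  then show "diameter (foldr \<phi> w ` K) \<le> ratio w * diameter K"
    using neK by (intro diameter_le) (auto simp: dist_norm)
qed

lemma sum_ratio_powr: "(\<Sum>w\<in>words I n. ratio w powr s) = (\<Sum>i\<in>I. r i powr s) ^ n"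
proof (induction n)
  case (Suc n)
  have "(\<Sum>w\<in>words I (Suc n). ratio w powr s) = (\<Sum>a\<in>I. \<Sum>v\<in>words I n. r a powr s * ratio v powr s)"
    unfolding sum_words_Suc[OF finI] using r ratio_bounds by (intro sum.cong) (auto simp: powr_mult less_imp_le)
  also have "\<dots> = (\<Sum>i\<in>I. r i powr s) * (\<Sum>i\<in>I. r i powr s) ^ n"
    by (simp add: Suc.IH flip: sum_distrib_left sum_distrib_right)
  finally show ?case by simp
qed (simp add: words_0)

lemma similarity_dimension_exists:
  obtains s where "0 \<le> s" "(\<Sum>i\<in>I. r i powr s) = 1"
proof -
  define f where "f s = (\<Sum>i\<in>I. r i powr s)" for s
  have f0: "1 \<le> f 0"
  proof -
    have "f 0 = (\<Sum>i\<in>I. 1)" unfolding f_def using r by (intro sum.cong) force+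
    then show ?thesis using finI neI by (simp add: Suc_le_eq card_gt_0_iff)
  qed
  obtain n where n: "rmax ^ n < 1 / real (card I)"
    using real_arch_pow_inv[of "1 / real (card I)" rmax] rmax finI neI by (auto simp: card_gt_0_iff)
  have "f (real n) \<le> (\<Sum>i\<in>I. rmax ^ n)"
    unfolding f_def
  proof (rule sum_mono)
    fix i assume i: "i \<in> I"
    show "r i powr real n \<le> rmax ^ n" using r[OF i] rmax(3)[OF i] by (simp add: powr_realpow power_mono)
  qed
  also have "\<dots> \<le> 1" using n finI neI by (simp add: card_gt_0_iff field_simps)
  finally have "f (real n) \<le> 1" .
  moreover have "continuous_on {0..real n} f" unfolding f_def using r
    by (intro continuous_intros) force+
  ultimately obtain s where "0 \<le> s" "f s = 1" using IVT2'[of f "real n" 1 0] f0 by auto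
  then show ?thesis using that by (simp add: f_def)
qed

text \<open>The cylinders of level \<open>n\<close> are used as covers; for an exponent above
  \<open>s\<close> their sum decays geometrically in \<open>n\<close>.\<close>

lemma hausdorff_dim_le_similarity_dimension:
  assumes "0 \<le> s" "(\<Sum>i\<in>I. r i powr s) = 1"
  shows "hausdorff_dim K \<le> ennreal s"
proof (rule hausdorff_dim_le[OF assms(1)])
  fix s' assume s': "s < s'"
  define D where "D = diameter K"
  have D: "0 \<le> D" unfolding D_def using compactK by (intro diameter_ge_0 compact_imp_bounded)
  define c where "c = (\<Sum>i\<in>I. r i powr s')"
  have "c < (\<Sum>i\<in>I. r i powr s)" unfolding c_def using finI neI r s' by (intro sum_strict_mono) (auto intro: powr_less_mono')
  then have c: "0 \<le> c" "c < 1" using assms(2) by (auto simp: c_def intro: sum_nonneg)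
  show "hausdorff_measure s' K = 0"
  proof (rule hausdorff_measure_eq_0I)
    fix \<delta> e :: real assume "0 < \<delta>" "0 < e"
    have "(\<lambda>n. rmax ^ n * D) \<longlonglongrightarrow> 0 * D" using rmax by (intro tendsto_intros LIMSEQ_realpow_zero) auto
    then have 1: "\<forall>\<^sub>F n in sequentially. rmax ^ n * D < \<delta>" using \<open>0 < \<delta>\<close> by (intro order_tendstoD) auto
    have "(\<lambda>n. c ^ n * D powr s') \<longlonglongrightarrow> 0 * D powr s'" using c by (intro tendsto_intros LIMSEQ_realpow_zero) auto
    then have 2: "\<forall>\<^sub>F n in sequentially. c ^ n * D powr s' < e" using \<open>0 < e\<close> by (intro order_tendstoD) auto
    obtain n where n: "rmax ^ n * D < \<delta>" "c ^ n * D powr s' < e"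
      using eventually_happens[OF eventually_conj[OF 1 2]] by auto
    show "\<exists>(J :: 'c list set) V. finite J \<and> K \<subseteq> (\<Union>i\<in>J. V i) \<and>
     (\<forall>i\<in>J. bounded (V i) \<and> diameter (V i) \<le> \<delta>) \<and> (\<Sum>i\<in>J. diam_powr s' (V i)) \<le> e"
    proof (intro exI conjI ballI)
      show "finite (words I n)" by (rule finite_words[OF finI])
      show "K \<subseteq> (\<Union>w\<in>words I n. foldr \<phi> w ` K)" using K_words[of n] by simp
      fix w assume w: "w \<in> words I n"
      show "bounded (foldr \<phi> w ` K)" by (rule diameter_word[OF w])
      have "diameter (foldr \<phi> w ` K) \<le> rmax ^ n * D"
        using diameter_word(2)[OF w] ratio_bounds[OF w] D mult_right_mono[of "ratio w" "rmax ^ n" D] by (simp add: D_def)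
      then show "diameter (foldr \<phi> w ` K) \<le> \<delta>" using n by simp
    next
      have "(\<Sum>w\<in>words I n. diam_powr s' (foldr \<phi> w ` K)) \<le> (\<Sum>w\<in>words I n. ratio w powr s' * D powr s')"
      proof (rule sum_mono)
        fix w assume w: "w \<in> words I n"
        have "diam_powr s' (foldr \<phi> w ` K) = diameter (foldr \<phi> w ` K) powr s'"
          using s' assms(1) neK by (simp add: diam_powr_def)
        also have "\<dots> \<le> (ratio w * D) powr s'"
          using diameter_word[OF w] s' assms(1) diameter_ge_0 by (intro powr_mono2) (auto simp: D_def)
        also have "\<dots> = ratio w powr s' * D powr s'" using ratio_bounds[OF w] D by (simp add: powr_mult)
        finally show "diam_powr s' (foldr \<phi> w ` K) \<le> ratio w powr s' * D powr s'" .
      qed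
      also have "\<dots> = c ^ n * D powr s'" by (simp add: c_def sum_ratio_powr flip: sum_distrib_right)
      finally show "(\<Sum>w\<in>words I n. diam_powr s' (foldr \<phi> w ` K)) \<le> e" using n(2) by simp
    qed
  qed
qed

text \<open>Words of length \<open>n\<close> have only polynomially many different contraction ratios, so by
  pigeonhole restricting to one ratio costs nothing in dimension.\<close>
lemma popular_ratio:
  assumes s: "(\<Sum>i\<in>I. r i powr s) = 1"
  obtains \<rho> where "\<rho> \<in> ratio ` words I n"
    "1 \<le> real ((n + 1) ^ card I) * (real (card {w \<in> words I n. ratio w = \<rho>}) * \<rho> powr s)"
proof -
  note result = that
  let ?R = "ratio ` words I n"
  let ?f = "\<lambda>\<rho>. real (card {w \<in> words I n. ratio w = \<rho>}) * \<rho> powr s"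
  have fw: "finite (words I n)" by (rule finite_words[OF finI])
  have "1 = (\<Sum>w\<in>words I n. ratio w powr s)" by (simp add: sum_ratio_powr s)
  also have "\<dots> = (\<Sum>\<rho>\<in>?R. \<Sum>w\<in>{w \<in> words I n. ratio w = \<rho>}. ratio w powr s)"
    by (rule sum.image_gen[OF fw])
  also have "\<dots> = (\<Sum>\<rho>\<in>?R. ?f \<rho>)" by (intro sum.cong) auto
  finally have one: "1 = (\<Sum>\<rho>\<in>?R. ?f \<rho>)" .
  obtain i where "i \<in> I" using neI by blast
  then have "replicate n i \<in> words I n" by (auto simp: words_def)
  then have neR: "?R \<noteq> {}" by blast
  show ?thesis
  proof (rule ccontr)
    assume n: "\<not> thesis"
    have "?f \<rho> < 1 / real ((n + 1) ^ card I)" if \<rho>: "\<rho> \<in> ?R" for \<rho>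
    proof -
      have "real ((n + 1) ^ card I) * ?f \<rho> < 1" using n result[OF \<rho>] by (metis not_le)
      moreover have "0 < real ((n + 1) ^ card I)" by simp
      ultimately show ?thesis by (subst pos_less_divide_eq) (simp_all add: mult.commute)
    qed
    then have "(\<Sum>\<rho>\<in>?R. ?f \<rho>) < (\<Sum>\<rho>\<in>?R. 1 / real ((n + 1) ^ card I))"
      using fw neR by (intro sum_strict_mono) auto
    also have "\<dots> \<le> 1" using card_ratios_le[OF finI, of r n] by (simp add: field_simps flip: of_nat_power of_nat_Suc)
    finally show False using one by simp
  qed
qed

end

text \<open>Writing \<open>b\<close> as a k-th power \<open>c ^ k\<close> makes the sequence the
  k-th power of \<open>(n + 1) * c ^ n\<close>.\<close>

lemma polynomial_times_geometric_tendsto_0: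
  fixes b :: real
  assumes "0 < b" "b < 1" "0 < k"
  shows "(\<lambda>n. real (n + 1) ^ k * b ^ n) \<longlonglongrightarrow> 0"
proof -
  define c where "c = b powr (1 / real k)"
  have c: "0 < c" "c < 1" using assms powr_less_mono2[of "1 / real k" b 1] by (auto simp: c_def)
  have ck: "c ^ k = b" using assms by (simp add: c_def powr_powr flip: powr_realpow)
  have "(\<lambda>n. real n * c ^ n + c ^ n) \<longlonglongrightarrow> 0 + 0"
    using c powser_times_n_limit_0[of c] by (intro tendsto_add LIMSEQ_realpow_zero) auto
  then have "(\<lambda>n. (real n * c ^ n + c ^ n) ^ k) \<longlonglongrightarrow> 0 ^ k" by (intro tendsto_power) simp
  moreover have "(real n * c ^ n + c ^ n) ^ k = real (n + 1) ^ k * b ^ n" for n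
  proof -
    have "(real n * c ^ n + c ^ n) ^ k = (real (n + 1) * c ^ n) ^ k" by (simp add: algebra_simps)
    also have "\<dots> = real (n + 1) ^ k * (c ^ k) ^ n"
      by (simp add: power_mult_distrib flip: power_mult) (simp add: mult.commute)
    finally show ?thesis by (simp add: ck)
  qed
  ultimately show ?thesis using assms(3) by (simp add: zero_power)
qed

context similarity_ifs
begin

text \<open>The prefixes run through all words \<open>u\<close> of a fixed length, so that the subfamily still sees all
  of \<open>K\<close>; each \<open>u\<close> is padded by the remaining words of that length to make all ratios equal.\<close>
lemma homogeneous_subfamily:
  assumes s: "(\<Sum>i\<in>I. r i powr s) = 1" and t: "t < s" and flat: "affine hull K = UNIV"
  obtains A \<rho> \<epsilon>0 l where "homogeneous_ifs A (foldr \<phi>) \<rho> \<epsilon>0 K" "A \<subseteq> words I l" "1 < real (card A) * \<rho> powr t"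
proof -
  obtain \<epsilon> where \<epsilon>: "0 < \<epsilon>" "\<And>\<xi> \<tau>. norm \<xi> = 1 \<Longrightarrow> \<exists>z\<in>K. \<epsilon> \<le> \<bar>\<xi> \<bullet> z + \<tau>\<bar>"
    using nonplanar_uniform[OF neK flat] by metis
  define D where "D = diameter K"
  have D: "0 \<le> D" unfolding D_def using compactK by (intro diameter_ge_0 compact_imp_bounded)
  have "(\<lambda>n. rmax ^ n * D) \<longlonglongrightarrow> 0 * D" using rmax by (intro tendsto_intros LIMSEQ_realpow_zero) auto
  then have "\<forall>\<^sub>F n in sequentially. rmax ^ n * D < \<epsilon> / 2" using \<epsilon> by (intro order_tendstoD) auto
  \<comment> \<open>Pieces of level \<open>n1\<close> are so small that one containing a point at
    distance \<epsilon> from a hyperplane stays \<epsilon>/2 away from it as a whole.\<close>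
  then obtain n1 where n1: "rmax ^ n1 * D < \<epsilon> / 2" using eventually_happens by force
  obtain js where js: "set js = words I n1" using finite_list[OF finite_words[OF finI]] by blast
  \<comment> \<open>All of \<open>js\<close> is used up whichever \<open>u\<close> comes first, so
    the total ratio is the same; as \<open>u\<close> is the prefix, the cylinder still lies in that
    of \<open>u\<close>.\<close>
  define pre where "pre u = u @ concat (remove1 u js)" for u
  have js_len: "concat us \<in> words I (n1 * length us)" if "set us \<subseteq> words I n1" for us
    using that by (induction us) (auto simp: words_def)
  have pre_word: "pre u \<in> words I (n1 * length js)" if "u \<in> words I n1" for u
  proof -
    have "concat (u # remove1 u js) \<in> words I (n1 * length (u # remove1 u js))"
      using that js set_remove1_subset[of u js] by (intro js_len) auto
    moreover have "length (u # remove1 u js) = length js"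
      using that js length_pos_if_in_set[of u js] by (simp add: length_remove1)
    moreover have "pre u = concat (u # remove1 u js)" by (simp add: pre_def)
    ultimately show ?thesis by (simp only:)
  qed
  define \<rho>1 where "\<rho>1 = prod_list (map ratio js)"
  have pre_ratio: "ratio (pre u) = \<rho>1" if "u \<in> words I n1" for u
  proof -
    have cc: "ratio (concat us) = prod_list (map ratio us)" for us by (induction us) auto
    have "mset js = mset (u # remove1 u js)" using that js by simp
    then have "mset (map ratio js) = mset (map ratio (u # remove1 u js))" by (simp only: mset_map)
    then have "\<rho>1 = prod_list (map ratio (u # remove1 u js))"
      unfolding \<rho>1_def by (simp only: flip: prod_mset_prod_list)
    also have "\<dots> = ratio (pre u)" by (simp add: pre_def cc)
    finally show ?thesis by simp
  qed
  obtain u0 where u0: "u0 \<in> words I n1" using K_words[of n1] neK by blast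
  have \<rho>1: "0 < \<rho>1" "\<rho>1 \<le> 1"
    using ratio_bounds[OF pre_word[OF u0]] pre_ratio[OF u0] power_le_one[of rmax "n1 * length js"] rmax by auto
  \<comment> \<open>Lowering the exponent from \<open>s\<close> to \<open>t\<close> gains at least
    \<open>b\<close> to the power \<open>-n\<close> on words of length \<open>n\<close>. This
    outweighs the polynomial number of ratios and the fixed cost \<open>\<rho>1 powr t\<close> of
    the prefix.\<close>
  define b where "b = rmax powr (s - t)"
  have b: "0 < b" "b < 1" using rmax t powr_less_mono2[of "s - t" rmax 1] by (auto simp: b_def)
  have "(\<lambda>n. real (n + 1) ^ card I * b ^ n) \<longlonglongrightarrow> 0"
    using b finI neI by (intro polynomial_times_geometric_tendsto_0) (auto simp: card_gt_0_iff)
  then have "\<forall>\<^sub>F n in sequentially. real (n + 1) ^ card I * b ^ n < \<rho>1 powr t"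
    using \<rho>1 by (intro order_tendstoD) auto
  then have "\<forall>\<^sub>F n in sequentially. real (n + 1) ^ card I * b ^ n < \<rho>1 powr t \<and> 1 \<le> n"
    using eventually_ge_at_top by (rule eventually_conj)
  then obtain n where n: "real (n + 1) ^ card I * b ^ n < \<rho>1 powr t" "1 \<le> n"
    using eventually_happens by force
  obtain \<rho>2 where \<rho>2: "\<rho>2 \<in> ratio ` words I n"
    "1 \<le> real ((n + 1) ^ card I) * (real (card {w \<in> words I n. ratio w = \<rho>2}) * \<rho>2 powr s)"
    using popular_ratio[OF s, of n] by blast
  define W where "W = {w \<in> words I n. ratio w = \<rho>2}"
  obtain w0 where w0: "w0 \<in> W" using \<rho>2(1) by (auto simp: W_def)
  have "rmax ^ n < 1" using rmax n(2) by (simp add: power_less_one_iff)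
  then have \<rho>2b: "0 < \<rho>2" "\<rho>2 \<le> rmax ^ n" "\<rho>2 < 1"
    using ratio_bounds[of w0 n] w0 by (auto simp: W_def)
  define A where "A = (\<lambda>(u, v). pre u @ v) ` (words I n1 \<times> W)"
  define l where "l = n1 * length js + n"
  define \<rho> where "\<rho> = \<rho>1 * \<rho>2"
  have finW: "finite W" using finite_words[OF finI] by (simp add: W_def)
  have Al: "A \<subseteq> words I l"
    using pre_word by (auto simp: A_def l_def W_def intro!: words_append)
  have A\<rho>: "ratio a = \<rho>" if "a \<in> A" for a
    using that pre_ratio by (auto simp: A_def W_def \<rho>_def)
  have "\<rho>1 * \<rho>2 \<le> 1 * \<rho>2" using \<rho>1 \<rho>2b by (intro mult_right_mono) auto
  then have \<rho>: "0 < \<rho>" "\<rho> < 1" using \<rho>1 \<rho>2b unfolding \<rho>_def by (simp, linarith)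
  have "1 < real (card A) * \<rho> powr t"
  proof -
    \<comment> \<open>The words with a single prefix are already numerous enough; the other prefixes
      serve only non-planarity.\<close>
    have "inj_on (\<lambda>v. pre u0 @ v) W" by (auto simp: inj_on_def)
    then have "card W = card ((\<lambda>v. pre u0 @ v) ` W)" by (simp add: card_image)
    also have "\<dots> \<le> card A" using finW finite_words[OF finI] u0 unfolding A_def by (intro card_mono) auto
    finally have cW: "card W \<le> card A" .
    have "\<rho>2 powr s = \<rho>2 powr (s - t) * \<rho>2 powr t" by (simp flip: powr_add)
    also have "\<dots> \<le> b ^ n * \<rho>2 powr t"
    proof (rule mult_right_mono)
      have "\<rho>2 powr (s - t) \<le> (rmax ^ n) powr (s - t)" using \<rho>2b t by (intro powr_mono2) auto
      also have "\<dots> = b ^ n" using rmax by (simp add: b_def powr_powr mult.commute flip: powr_realpow)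
      finally show "\<rho>2 powr (s - t) \<le> b ^ n" .
    qed simp
    finally have "real (card W) * \<rho>2 powr s \<le> real (card W) * (b ^ n * \<rho>2 powr t)" by (rule mult_left_mono) simp
    then have "real ((n + 1) ^ card I) * (real (card W) * \<rho>2 powr s)
        \<le> real ((n + 1) ^ card I) * (real (card W) * (b ^ n * \<rho>2 powr t))" by (rule mult_left_mono) simp
    then have "1 \<le> real ((n + 1) ^ card I) * (real (card W) * (b ^ n * \<rho>2 powr t))"
      using \<rho>2(2) unfolding W_def[symmetric] by (rule order_trans[rotated])
    then have "1 \<le> (real (n + 1) ^ card I * b ^ n) * (real (card W) * \<rho>2 powr t)"
      by (simp add: mult_ac)
    also have "\<dots> < \<rho>1 powr t * (real (card W) * \<rho>2 powr t)"
      using n(1) w0 finW \<rho>2b by (intro mult_strict_right_mono mult_pos_pos) (auto simp: card_gt_0_iff)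
    also have "\<dots> = real (card W) * \<rho> powr t" using \<rho>1 \<rho>2b by (simp add: \<rho>_def powr_mult)
    also have "\<dots> \<le> real (card A) * \<rho> powr t" using cW by (intro mult_right_mono) auto
    finally show ?thesis .
  qed
  moreover have "homogeneous_ifs A (foldr \<phi>) \<rho> (\<epsilon> / 2) K"
  proof
    show "finite A" using finW finite_words[OF finI] by (simp add: A_def)
    show "similarity_with_ratio \<rho> (foldr \<phi> a)" if "a \<in> A" for a
      using sim_word[of a l] Al A\<rho>[OF that] that by auto
    show "foldr \<phi> a ` K \<subseteq> K" if "a \<in> A" for a using word_inK[of a l] Al that by blast
    fix \<xi> :: 'a and \<tau> assume \<xi>: "norm \<xi> = 1"
    obtain z where z: "z \<in> K" "\<epsilon> \<le> \<bar>\<xi> \<bullet> z + \<tau>\<bar>" using \<epsilon>(2)[OF \<xi>] by blast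
    then obtain u where u: "u \<in> words I n1" "z \<in> foldr \<phi> u ` K" using K_words[of n1] by blast
    have a: "pre u @ w0 \<in> A" using u(1) w0 by (auto simp: A_def)
    have "\<epsilon> / 2 \<le> \<bar>\<xi> \<bullet> foldr \<phi> (pre u @ w0) y + \<tau>\<bar>" if y: "y \<in> K" for y
    proof -
      define x where "x = foldr \<phi> (pre u @ w0) y"
      have "concat (remove1 u js) \<in> words I (n1 * length (remove1 u js))"
        using js set_remove1_subset[of u js] by (intro js_len) auto
      then have "foldr \<phi> (concat (remove1 u js)) (foldr \<phi> w0 y) \<in> K"
        using word_inK w0 y by (auto simp: W_def image_subset_iff)
      then have "x \<in> foldr \<phi> u ` K" by (simp add: x_def pre_def)
      then have "dist x z \<le> diameter (foldr \<phi> u ` K)"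
        using u(2) by (intro diameter_bounded_bound diameter_word(1)[OF u(1)])
      also have "\<dots> \<le> rmax ^ n1 * D"
        using diameter_word(2)[OF u(1)] ratio_bounds[OF u(1)] D mult_right_mono[of "ratio u" "rmax ^ n1" D] by (simp add: D_def)
      finally have "dist x z \<le> \<epsilon> / 2" using n1 by simp
      moreover have "\<bar>\<xi> \<bullet> (x - z)\<bar> \<le> dist x z" using Cauchy_Schwarz_ineq2[of \<xi> "x - z"] \<xi> by (simp add: dist_norm)
      moreover have "\<xi> \<bullet> x + \<tau> = (\<xi> \<bullet> z + \<tau>) + \<xi> \<bullet> (x - z)" by (simp add: inner_diff_right)
      ultimately show ?thesis using z(2) unfolding x_def[symmetric] by linarith
    qed
    then show "\<exists>a\<in>A. \<forall>z\<in>K. \<epsilon> / 2 \<le> \<bar>\<xi> \<bullet> foldr \<phi> a z + \<tau>\<bar>" using a by blast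
  qed (use \<rho> compactK neK \<epsilon> in auto)
  ultimately show ?thesis using Al by (intro that)
qed

end

theorem corollary3:
  fixes k :: nat
    and \<phi> :: "nat \<Rightarrow> real ^ 'n ^ 'm \<Rightarrow> real ^ 'n ^ 'm"
    and K :: "(real ^ 'n ^ 'm) set"
  assumes "\<And>i. i \<in> {1..k} \<Longrightarrow> contracting_similarity (\<phi> i)"
    and "irreducible_family {1..k} \<phi>"
    and "open_set_condition {1..k} \<phi>"
    and "is_attractor {1..k} \<phi> K"
  shows "hausdorff_dim (BA \<inter> K) = hausdorff_dim K"
proof (rule antisym)
  show "hausdorff_dim (BA \<inter> K) \<le> hausdorff_dim K" by (rule hausdorff_dim_mono) simp
  define I where "I = {1..k}"
  obtain r where r: "\<And>i. i \<in> I \<Longrightarrow> r i < 1 \<and> similarity_with_ratio (r i) (\<phi> i)"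
    using assms(1) unfolding I_def contracting_similarity_def by metis
  have r0: "0 < r i" if "i \<in> I" for i using r[OF that] by (simp add: similarity_with_ratio_def)
  interpret similarity_ifs I \<phi> r K
  proof
    show "finite I" by (simp add: I_def)
    show "is_attractor I \<phi> K" unfolding I_def by fact
    show "0 < r i \<and> r i < 1" if "i \<in> I" for i using r[OF that] r0[OF that] by simp
    show "similarity_with_ratio (r i) (\<phi> i)" if "i \<in> I" for i using r[OF that] by simp
  qed
  obtain U where osc: "open U \<and> U \<noteq> {} \<and> (\<forall>i\<in>I. \<phi> i ` U \<subseteq> U) \<and>
      (\<forall>i\<in>I. \<forall>j\<in>I. i \<noteq> j \<longrightarrow> \<phi> i ` U \<inter> \<phi> j ` U = {})"
    using assms(3) unfolding open_set_condition_def I_def[symmetric] by (elim exE)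
  have U: "open U" "U \<noteq> {}" using osc by simp_all
  have U_sub: "\<phi> i ` U \<subseteq> U" if "i \<in> I" for i using osc that by (elim conjE bspec)
  have U_disj: "\<phi> i ` U \<inter> \<phi> j ` U = {}" if "i \<in> I" "j \<in> I" "i \<noteq> j" for i j
    using osc that by simp
  have flat: "affine hull K = UNIV"
    by (rule affine_hull_attractor[OF sim assms(2)[folded I_def] attractor])
  obtain s where s: "0 \<le> s" "(\<Sum>i\<in>I. r i powr s) = 1" using similarity_dimension_exists by blast
  have lower: "ennreal t \<le> hausdorff_dim (BA \<inter> K)" if t: "0 \<le> t" "t < s" for t
  proof -
    obtain A \<rho> \<epsilon>0 l where A: "homogeneous_ifs A (foldr \<phi>) \<rho> \<epsilon>0 K" "A \<subseteq> words I l" "1 < real (card A) * \<rho> powr t"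
      using homogeneous_subfamily[OF s(2) t(2) flat] by blast
    \<comment> \<open>The open set \<open>U\<close> of the original family works for the subfamily
      too: its words have equal length \<open>l\<close>, so distinct ones have disjoint images of
      \<open>U\<close>.\<close>
    show ?thesis
    proof (rule homogeneous_dim_BA[OF A(1) U(1,2)])
      show "foldr \<phi> a ` U \<subseteq> U" if "a \<in> A" for a
        by (rule foldr_image_subset[OF U_sub subsetD[OF A(2) that]])
      show "foldr \<phi> a ` U \<inter> foldr \<phi> b ` U = {}" if "a \<in> A" "b \<in> A" "a \<noteq> b" for a b
        by (rule foldr_image_disjoint[OF similarity_with_ratio_inj[OF sim] U_sub U_disj
              subsetD[OF A(2) that(1)] subsetD[OF A(2) that(2)] that(3)])
    qed (use A t in auto)
  qed
  \<comment> \<open>The bound for all \<open>t\<close> below \<open>s\<close> passes to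
    \<open>s\<close>: a smaller dimension \<open>h\<close> would be contradicted at the midpoint of
    \<open>h\<close> and \<open>s\<close>.\<close>
  have "ennreal s \<le> hausdorff_dim (BA \<inter> K)"
  proof (rule ccontr)
    assume "\<not> ?thesis"
    then have lt: "hausdorff_dim (BA \<inter> K) < ennreal s" by simp
    then obtain h where h: "hausdorff_dim (BA \<inter> K) = ennreal h" "0 \<le> h"
      by (cases "hausdorff_dim (BA \<inter> K)") auto
    then have "h < s" using lt s(1) by (simp add: ennreal_less_iff)
    then have "ennreal ((h + s) / 2) \<le> ennreal h" using lower[of "(h + s) / 2"] h by simp
    then show False using h(2) \<open>h < s\<close> by (simp add: ennreal_le_iff)
  qed
  then show "hausdorff_dim K \<le> hausdorff_dim (BA \<inter> K)"
    using hausdorff_dim_le_similarity_dimension[OF s] by (rule order_trans[rotated])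
qed

end
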